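(* Let $M$ be an $n$-dimensional Hadamard manifold and let $f:M\to\mathbb{R}\cup\{+\infty\}$ be radial at $p\in M$, with $f=h(d(\cdot,p))$, where $h:[0,\infty)\to\mathbb{R}$ is differentiable and convex. Assume that $$h(0)=h'(0)=0\qquad\text{and}\qquad h'(t)>0,\quad t>0,$$ where $h'(0)$ denotes the right derivative at the origin. Then $\partial B^p f(x)=\{\operatorname{grad}f(x)\}$ for $x\neq p$, and $\partial B^p f(p)=\{0\}$.
   Context: A Hadamard manifold is a complete, simply connected Riemannian manifold of nonpositive sectional curvature; $d$ is its Riemannian distance and $\exp$ its exponential map (each $\exp_p$ is a diffeomorphism). $\operatorname{grad}$ denotes the Riemannian gradient. For $q\in M$ and a unit vector $u\in T_qM$, $\gamma_{(q,u)}(t)=\exp_q(tu)$, $t\ge 0$, is the unit-speed geodesic ray from $q$ in direction $u$, and $B_u^q(x)=\lim_{t\to+\infty}\bigl(d(x,\gamma_{(q,u)}(t))-t\bigr)$ is the Busemann function. For a nonzero $u\in T_qM$, $B_u^q:=B_{u/\|u\|}^q$. Two unit-speed rays $\gamma,\sigma$ are asymptotic if $t\mapsto d(\gamma(t),\sigma(t))$ is bounded on $[0,\infty)$; for each ray and each point $q$ there is exactly one ray from $q$ asymptotic to it. Busemann coupling with base point $p$: $H_p:M\times M\to\mathbb{R}$, $H_p(z,y)=d(p,z)\,B^p_{-\exp_p^{-1}z}(y)$ if $z\ne p$, and $H_p(p,y)=0$. For $x\in M$ and $v\in T_xM\setminus\{0\}$, $\eta_{p,x}(v)\in T_pM$ is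 the unique unit vector such that $\gamma_{(p,\eta_{p,x}(v))}$ and $\gamma_{(x,-v/\|v\|)}$ are asymptotic; $Y_p(x,v):=\exp_p(-\|v\|\,\eta_{p,x}(v))$ for $v\neq 0$ and $Y_p(x,0):=p$. $B^p$-subdifferential: for $x\in\operatorname{dom}f=\{x:f(x)<+\infty\}$, $\partial B^p f(x)$ is the set of all $v\in T_xM$ such that $f(z)\ge f(x)+H_p(z,Y_p(x,v))-H_p(x,Y_p(x,v))$ for all $z\in M$. *)

theory Defs
  imports "HOL-Analysis.Analysis"
begin

section \<open>Smooth maps between open subsets of normed spaces\<close>

text \<open>Only meaningful for open \<open>S\<close>.\<close>

fun Ck_on :: "nat \<Rightarrow> ('a::real_normed_vector \<Rightarrow> 'b::real_normed_vector) \<Rightarrow> 'a set \<Rightarrow> bool" where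
  "Ck_on 0 f S \<longleftrightarrow> continuous_on S f"
| "Ck_on (Suc k) f S \<longleftrightarrow>
     f differentiable_on S \<and> (\<forall>v. Ck_on k (\<lambda>x. frechet_derivative f (at x) v) S)"

definition smooth_on :: "('a::real_normed_vector \<Rightarrow> 'b::real_normed_vector) \<Rightarrow> 'a set \<Rightarrow> bool" where
  "smooth_on f S \<longleftrightarrow> (\<forall>k. Ck_on k f S)"

section \<open>Smooth and Riemannian manifolds\<close>

text \<open>
  The points of the manifold are the elements of the type \<open>'a\<close>, and the dimension is
  \<open>DIM('e)\<close>. A chart is a pair of its domain and a map that is relevant on this domain only.

  The tangent space at \<open>x\<close> is the vector space \<open>'e\<close>: a tangent vector is given by its coordinates
  in one chart around \<open>x\<close>, selected once and for all by \<open>chart_at\<close>. No continuity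
  of this selection in \<open>x\<close> is assumed, so a tensor field is smooth when its expressions in all
  charts of the atlas are. In particular \<open>metric M x\<close> is the inner product on the tangent space
  at \<open>x\<close>. The inner product of the type \<open>'e\<close> plays no geometric role.
\<close>

type_synonym ('a, 'e) chart = "'a set \<times> ('a \<Rightarrow> 'e)"

record ('a, 'e) riemannian =
  atlas :: "('a, 'e) chart set"
  metric :: "'a \<Rightarrow> 'e \<Rightarrow> 'e \<Rightarrow> real"

definition chart_inv :: "('a, 'e) chart \<Rightarrow> 'e \<Rightarrow> 'a" where
  "chart_inv c = inv_into (fst c) (snd c)"

definition smooth_atlas ::
  "('a::topological_space, 'e::euclidean_space) chart set \<Rightarrow> bool" where
  "smooth_atlas A \<longleftrightarrow>
     (\<Union>c\<in>A. fst c) = UNIV \<and>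
     (\<forall>c\<in>A. open (fst c) \<and> open (snd c ` fst c) \<and>
        homeomorphism (fst c) (snd c ` fst c) (snd c) (chart_inv c)) \<and>
     (\<forall>c\<in>A. \<forall>d\<in>A. smooth_on (snd d \<circ> chart_inv c) (snd c ` (fst c \<inter> fst d)))"

definition chart_at :: "('a, 'e) riemannian \<Rightarrow> 'a \<Rightarrow> ('a, 'e) chart" where
  "chart_at M x = (SOME c. c \<in> atlas M \<and> x \<in> fst c)"

definition coord_change ::
  "('a, 'e::euclidean_space) chart \<Rightarrow> ('a, 'e) chart \<Rightarrow> 'a \<Rightarrow> 'e \<Rightarrow> 'e" where
  "coord_change c d x = frechet_derivative (snd d \<circ> chart_inv c) (at (snd c x))"

text \<open>The metric in the coordinates of the chart \<open>c\<close>, at the coordinate point \<open>y\<close>.\<close>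

definition metric_in ::
  "('a, 'e::euclidean_space) riemannian \<Rightarrow> ('a, 'e) chart \<Rightarrow> 'e \<Rightarrow> 'e \<Rightarrow> 'e \<Rightarrow> real" where
  "metric_in M c y u v =
     (let x = chart_inv c y; T = coord_change c (chart_at M x) x in metric M x (T u) (T v))"

definition riemannian_manifold ::
  "('a::{t2_space, second_countable_topology}, 'e::euclidean_space) riemannian \<Rightarrow> bool" where
  "riemannian_manifold M \<longleftrightarrow>
     smooth_atlas (atlas M) \<and>
     (\<forall>x. bilinear (metric M x) \<and>
        (\<forall>u v. metric M x u v = metric M x v u) \<and>
        (\<forall>u. u \<noteq> 0 \<longrightarrow> metric M x u u > 0)) \<and>
     (\<forall>c\<in>atlas M. \<forall>u v. smooth_on (\<lambda>y. metric_in M c y u v) (snd c ` fst c))"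

definition tnorm :: "('a, 'e) riemannian \<Rightarrow> 'a \<Rightarrow> 'e \<Rightarrow> real" where
  "tnorm M x v = sqrt (metric M x v v)"

section \<open>Riemannian distance\<close>

definition velocity :: "('a, 'e::euclidean_space) riemannian \<Rightarrow> (real \<Rightarrow> 'a) \<Rightarrow> real \<Rightarrow> 'e" where
  "velocity M \<gamma> t = vector_derivative (snd (chart_at M (\<gamma> t)) \<circ> \<gamma>) (at t)"

definition C1_curve_on ::
  "('a::topological_space, 'e::euclidean_space) riemannian \<Rightarrow> real \<Rightarrow> real \<Rightarrow> (real \<Rightarrow> 'a) \<Rightarrow> bool" where
  "C1_curve_on M a b \<gamma> \<longleftrightarrow>
     continuous_on {a..b} \<gamma> \<and>
     (\<forall>c\<in>atlas M. \<exists>w. continuous_on {t\<in>{a..b}. \<gamma> t \<in> fst c} w \<and>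
        (\<forall>t\<in>{a..b}. \<gamma> t \<in> fst c \<longrightarrow>
           ((snd c \<circ> \<gamma>) has_vector_derivative w t) (at t within {a..b})))"

text \<open>\<open>S\<close> is the set of break points; the curve is \<open>C1\<close> up to the end points of every piece.\<close>

definition piecewise_C1_curve ::
  "('a::topological_space, 'e::euclidean_space) riemannian \<Rightarrow> (real \<Rightarrow> 'a) \<Rightarrow> bool" where
  "piecewise_C1_curve M \<gamma> \<longleftrightarrow>
     continuous_on {0..1} \<gamma> \<and>
     (\<exists>S. finite S \<and> {0, 1} \<subseteq> S \<and> S \<subseteq> {0..1} \<and>
        (\<forall>a\<in>S. \<forall>b\<in>S. a < b \<and> {a<..<b} \<inter> S = {} \<longrightarrow> C1_curve_on M a b \<gamma>))"

definition curve_length :: "('a, 'e::euclidean_space) riemannian \<Rightarrow> (real \<Rightarrow> 'a) \<Rightarrow> real" where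
  "curve_length M \<gamma> = integral {0..1} (\<lambda>t. tnorm M (\<gamma> t) (velocity M \<gamma> t))"

definition rdist ::
  "('a::topological_space, 'e::euclidean_space) riemannian \<Rightarrow> 'a \<Rightarrow> 'a \<Rightarrow> real" where
  "rdist M x y = Inf {curve_length M \<gamma> | \<gamma>. piecewise_C1_curve M \<gamma> \<and> \<gamma> 0 = x \<and> \<gamma> 1 = y}"

section \<open>Levi-Civita connection, geodesics, curvature\<close>

text \<open>
  In the coordinates of a chart the Levi-Civita connection is
  \<open>\<nabla>\<^sub>u W = DW(u) + \<Gamma>(u, W)\<close>, where \<open>\<Gamma>\<close> is the bilinear map whose components are the Christoffel
  symbols; it is given by the Koszul formula for constant vector fields.
\<close>

definition metric_deriv ::
  "('a, 'e::euclidean_space) riemannian \<Rightarrow> ('a, 'e) chart \<Rightarrow> 'e \<Rightarrow> 'e \<Rightarrow> 'e \<Rightarrow> 'e \<Rightarrow> real" where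
  "metric_deriv M c y u v w = frechet_derivative (\<lambda>y'. metric_in M c y' v w) (at y) u"

definition christoffel ::
  "('a, 'e::euclidean_space) riemannian \<Rightarrow> ('a, 'e) chart \<Rightarrow> 'e \<Rightarrow> 'e \<Rightarrow> 'e \<Rightarrow> 'e" where
  "christoffel M c y u v =
     (THE w. \<forall>z. 2 * metric_in M c y w z =
        metric_deriv M c y u v z + metric_deriv M c y v u z - metric_deriv M c y z u v)"

definition geodesic ::
  "('a::topological_space, 'e::euclidean_space) riemannian \<Rightarrow> (real \<Rightarrow> 'a) \<Rightarrow> bool" where
  "geodesic M \<gamma> \<longleftrightarrow>
     continuous_on UNIV \<gamma> \<and>
     (\<forall>c\<in>atlas M. \<exists>w. \<forall>t. \<gamma> t \<in> fst c \<longrightarrow>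
        ((snd c \<circ> \<gamma>) has_vector_derivative w t) (at t) \<and>
        (w has_vector_derivative - christoffel M c (snd c (\<gamma> t)) (w t) (w t)) (at t))"

definition geodesically_complete ::
  "('a::topological_space, 'e::euclidean_space) riemannian \<Rightarrow> bool" where
  "geodesically_complete M \<longleftrightarrow>
     (\<forall>p v. \<exists>\<gamma>. geodesic M \<gamma> \<and> \<gamma> 0 = p \<and> velocity M \<gamma> 0 = v)"

definition expmap ::
  "('a::topological_space, 'e::euclidean_space) riemannian \<Rightarrow> 'a \<Rightarrow> 'e \<Rightarrow> 'a" where
  "expmap M p v = (THE q. \<exists>\<gamma>. geodesic M \<gamma> \<and> \<gamma> 0 = p \<and> velocity M \<gamma> 0 = v \<and> \<gamma> 1 = q)"

text \<open>
  \<open>R(u,v)w = \<nabla>\<^sub>u \<nabla>\<^sub>v w - \<nabla>\<^sub>v \<nabla>\<^sub>u w\<close> for constant fields \<open>u\<close>, \<open>v\<close>, \<open>w\<close> in the coordinates of \<open>c\<close>.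
\<close>

definition curvature_tensor ::
  "('a, 'e::euclidean_space) riemannian \<Rightarrow> ('a, 'e) chart \<Rightarrow> 'e \<Rightarrow> 'e \<Rightarrow> 'e \<Rightarrow> 'e \<Rightarrow> 'e" where
  "curvature_tensor M c y u v w =
     (let \<Gamma> = christoffel M c; D\<Gamma> = (\<lambda>a b d. frechet_derivative (\<lambda>y'. \<Gamma> y' b d) (at y) a)
      in D\<Gamma> u v w - D\<Gamma> v u w + \<Gamma> y u (\<Gamma> y v w) - \<Gamma> y v (\<Gamma> y u w))"

definition sectional_curvature ::
  "('a, 'e::euclidean_space) riemannian \<Rightarrow> 'a \<Rightarrow> 'e \<Rightarrow> 'e \<Rightarrow> real" where
  "sectional_curvature M x u v =
     (let c = chart_at M x
      in metric M x (curvature_tensor M c (snd c x) u v v) u /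
         (metric M x u u * metric M x v v - (metric M x u v)\<^sup>2))"

section \<open>Hadamard manifolds\<close>

definition hadamard_manifold ::
  "('a::{t2_space, second_countable_topology}, 'e::euclidean_space) riemannian \<Rightarrow> bool" where
  "hadamard_manifold M \<longleftrightarrow>
     riemannian_manifold M \<and>
     geodesically_complete M \<and>
     simply_connected (UNIV :: 'a set) \<and>
     (\<forall>x u v. u \<noteq> v \<and> independent {u, v} \<longrightarrow> sectional_curvature M x u v \<le> 0)"

text \<open>The Riemannian gradient: \<open>\<langle>grad f(x), v\<rangle> = df\<^sub>x(v)\<close> for all tangent vectors \<open>v\<close>.\<close>

definition grad ::
  "('a, 'e::euclidean_space) riemannian \<Rightarrow> ('a \<Rightarrow> real) \<Rightarrow> 'a \<Rightarrow> 'e" where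
  "grad M f x =
     (THE w. ((f \<circ> chart_inv (chart_at M x)) has_derivative (\<lambda>v. metric M x w v))
        (at (snd (chart_at M x) x)))"

section \<open>Busemann functions and the Busemann subdifferential\<close>

definition ray ::
  "('a::topological_space, 'e::euclidean_space) riemannian \<Rightarrow> 'a \<Rightarrow> 'e \<Rightarrow> real \<Rightarrow> 'a" where
  "ray M q u t = expmap M q (t *\<^sub>R u)"

definition unit_vec :: "('a, 'e::euclidean_space) riemannian \<Rightarrow> 'a \<Rightarrow> 'e \<Rightarrow> 'e" where
  "unit_vec M q u = u /\<^sub>R tnorm M q u"

text \<open>The direction \<open>u\<close> is any nonzero vector; it is normalised first.\<close>

definition busemann ::
  "('a::topological_space, 'e::euclidean_space) riemannian \<Rightarrow> 'a \<Rightarrow> 'e \<Rightarrow> 'a \<Rightarrow> real" where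
  "busemann M q u x = Lim at_top (\<lambda>t. rdist M x (ray M q (unit_vec M q u) t) - t)"

definition asymptotic ::
  "('a::topological_space, 'e::euclidean_space) riemannian \<Rightarrow> (real \<Rightarrow> 'a) \<Rightarrow> (real \<Rightarrow> 'a) \<Rightarrow> bool" where
  "asymptotic M \<gamma> \<sigma> \<longleftrightarrow> bounded ((\<lambda>t. rdist M (\<gamma> t) (\<sigma> t)) ` {0..})"

definition busemann_coupling ::
  "('a::topological_space, 'e::euclidean_space) riemannian \<Rightarrow> 'a \<Rightarrow> 'a \<Rightarrow> 'a \<Rightarrow> real" where
  "busemann_coupling M p z y =
     (if z = p then 0 else rdist M p z * busemann M p (- inv (expmap M p) z) y)"

definition asym_dir ::
  "('a::topological_space, 'e::euclidean_space) riemannian \<Rightarrow> 'a \<Rightarrow> 'a \<Rightarrow> 'e \<Rightarrow> 'e" where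
  "asym_dir M p x v =
     (THE w. tnorm M p w = 1 \<and> asymptotic M (ray M p w) (ray M x (- unit_vec M x v)))"

definition busemann_point ::
  "('a::topological_space, 'e::euclidean_space) riemannian \<Rightarrow> 'a \<Rightarrow> 'a \<Rightarrow> 'e \<Rightarrow> 'a" where
  "busemann_point M p x v =
     (if v = 0 then p else expmap M p (- (tnorm M x v *\<^sub>R asym_dir M p x v)))"

text \<open>For \<open>x\<close> in the effective domain of \<open>f\<close>, that is \<open>f x < \<infinity>\<close>.\<close>

definition busemann_subdiff ::
  "('a::topological_space, 'e::euclidean_space) riemannian \<Rightarrow> 'a \<Rightarrow> ('a \<Rightarrow> ereal) \<Rightarrow> 'a \<Rightarrow> 'e set" where
  "busemann_subdiff M p f x =
     {v. \<forall>z. f z \<ge> f x + ereal (busemann_coupling M p z (busemann_point M p x v))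
                      - ereal (busemann_coupling M p x (busemann_point M p x v))}"

end

(* Along a geodesic, a Jacobi field J with J(0) = 0 has convex norm because the curvature is
   nonpositive, so exp_q does not decrease lengths. It is therefore a local diffeomorphism along which
   curves lift, and a bijection by simple connectedness. Lifting curves through exp_q gives the hinge
   inequality |a - b|_q <= d(exp_q a, exp_q b), from which all comparison geometry needed here follows:
   geodesics minimise, the CN inequality, convexity of the distance, existence and uniqueness of
   asymptotic rays.

   The coupling satisfies H_p(z, y) <= d(p, z) d(p, y), with equality for z <> p only if y lies on the
   ray from p through z. For x = exp_p(R u) with |u| = 1 and R > 0, grad f(x) = h'(R) G, where G is the
   velocity of this ray at x, and Y_p(x, grad f(x)) = exp_p(h'(R) u). The subgradient inequality at
   grad f(x) thus follows from the tangent inequality of h. Conversely, let v be a subgradient at x. The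
   point z = p excludes v = 0. Testing with the point z at distance R from p on the ray through Y_p(x, v)
   gives equality in the bound for the coupling, hence Y_p(x, v) lies on the ray from p through x. Testing
   with the other points of that ray shows that |v| is a slope of a supporting line of h at R. At x = p the
   same test on a ray, with h(t) / t tending to 0, excludes v <> 0. *)
theory Submission
  imports Defs
begin

section \<open>Strict differentiability\<close>

text \<open>Tangent vectors are coordinates in a chart that may jump from point to point, so
  \<open>velocity\<close> cannot be differentiated along a curve. All calculus is therefore done in
  one fixed chart near one time; statements that do not depend on the chart carry the result over to
  the next one. Strict differentiability is the notion used for the geodesic flow: a Gronwall
  estimate for two nearby solutions yields it at a single parameter value, it composes, and it gives
  a local inverse with explicit constants without continuity of the derivative in the parameter. The
  covering argument rests on local sections of uniform size: the expansion bound keeps a partial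
  section in a compact set. After the hinge inequality neither lengths of curves nor angles occur
  any more: a lower bound for distances in the tangent space at a well chosen point replaces the law
  of cosines, the first variation formula and the Gauss lemma. The gradient of the distance, for
  instance, is found because a squared distance and a quadratic polynomial below it touch at one
  time.\<close>

definition strict_deriv ::
  "('a::real_normed_vector \<Rightarrow> 'b::real_normed_vector) \<Rightarrow> ('a \<Rightarrow> 'b) \<Rightarrow> 'a \<Rightarrow> bool" where
  "strict_deriv f L x \<longleftrightarrow> bounded_linear L \<and>
     (\<forall>e>0. \<exists>d>0. \<forall>y\<in>ball x d. \<forall>z\<in>ball x d. norm (f y - f z - L (y - z)) \<le> e * norm (y - z))"

lemma strict_derivD:
  assumes "strict_deriv f L x" "e > 0"
  shows "\<exists>d>0. \<forall>y\<in>ball x d. \<forall>z\<in>ball x d. norm (f y - f z - L (y - z)) \<le> e * norm (y - z)"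
  using assms unfolding strict_deriv_def by blast

lemma strict_deriv_bounded_linear: "strict_deriv f L x \<Longrightarrow> bounded_linear L"
  by (simp add: strict_deriv_def)

lemma strict_deriv_has_derivative:
  assumes "strict_deriv f L x"
  shows "(f has_derivative L) (at x)"
  unfolding has_derivative_at_alt
proof (intro conjI allI impI)
  show "bounded_linear L" by (rule strict_deriv_bounded_linear[OF assms])
  fix e :: real assume e: "e > 0"
  obtain d where "d > 0"
    "\<And>y z. y \<in> ball x d \<Longrightarrow> z \<in> ball x d \<Longrightarrow> norm (f y - f z - L (y - z)) \<le> e * norm (y - z)"
    using strict_derivD[OF assms e] by blast
  then show "\<exists>d>0. \<forall>y. norm (y - x) < d \<longrightarrow> norm (f y - f x - L (y - x)) \<le> e * norm (y - x)"
    by (intro exI[of _ d]) (auto simp: dist_norm norm_minus_commute)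
qed

lemma strict_deriv_isCont: "strict_deriv f L x \<Longrightarrow> isCont f x"
  by (rule has_derivative_continuous[OF strict_deriv_has_derivative])

lemma strict_deriv_lipschitz:
  assumes "strict_deriv f L x"
  shows "\<exists>C>0. \<exists>d>0. \<forall>y\<in>ball x d. \<forall>z\<in>ball x d. norm (f y - f z) \<le> C * norm (y - z)"
proof -
  obtain K where K: "K > 0" "\<And>v. norm (L v) \<le> norm v * K"
    using bounded_linear.pos_bounded[OF strict_deriv_bounded_linear[OF assms]] by blast
  obtain d where d: "d > 0"
    "\<And>y z. y \<in> ball x d \<Longrightarrow> z \<in> ball x d \<Longrightarrow> norm (f y - f z - L (y - z)) \<le> 1 * norm (y - z)"
    using strict_derivD[OF assms zero_less_one] by blast
  show ?thesis
  proof (rule exI[of _ "K + 1"], intro conjI exI[of _ d] ballI)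
    fix y z assume "y \<in> ball x d" "z \<in> ball x d"
    then have "norm (f y - f z - L (y - z)) \<le> norm (y - z)" using d by force
    moreover have "norm (f y - f z) \<le> norm (f y - f z - L (y - z)) + norm (L (y - z))"
      using norm_triangle_ineq[of "f y - f z - L (y - z)" "L (y - z)"] by simp
    ultimately show "norm (f y - f z) \<le> (K + 1) * norm (y - z)"
      using K(2)[of "y - z"] by (simp add: algebra_simps)
  qed (use d K in auto)
qed

lemma strict_deriv_transform:
  assumes f: "strict_deriv f L x" and "\<forall>\<^sub>F y in nhds x. f y = g y"
  shows "strict_deriv g L x"
  unfolding strict_deriv_def
proof (intro conjI allI impI)
  show "bounded_linear L" by (rule strict_deriv_bounded_linear[OF f])
  fix e :: real assume e: "e > 0"
  obtain d where d: "d > 0"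
    "\<And>y z. y \<in> ball x d \<Longrightarrow> z \<in> ball x d \<Longrightarrow> norm (f y - f z - L (y - z)) \<le> e * norm (y - z)"
    using strict_derivD[OF f e] by blast
  obtain d' where d': "d' > 0" "\<And>y. dist y x < d' \<Longrightarrow> f y = g y"
    using assms(2) unfolding eventually_nhds_metric by blast
  show "\<exists>d>0. \<forall>y\<in>ball x d. \<forall>z\<in>ball x d. norm (g y - g z - L (y - z)) \<le> e * norm (y - z)"
  proof (intro exI[of _ "min d d'"] conjI ballI)
    fix y z assume "y \<in> ball x (min d d')" "z \<in> ball x (min d d')"
    then show "norm (g y - g z - L (y - z)) \<le> e * norm (y - z)"
      using d(2)[of y z] d'(2)[of y] d'(2)[of z] by (simp add: dist_commute)
  qed (use d d' in simp)
qed

lemma strict_deriv_linear: "bounded_linear L \<Longrightarrow> strict_deriv L L x"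
  unfolding strict_deriv_def
  by (auto simp: linear_diff[OF bounded_linear.linear] intro!: exI[of _ 1])

lemma strict_deriv_compose:
  assumes f: "strict_deriv f L x" and g: "strict_deriv g K (f x)"
  shows "strict_deriv (\<lambda>y. g (f y)) (\<lambda>v. K (L v)) x"
  unfolding strict_deriv_def
proof (intro conjI allI impI)
  have blL: "bounded_linear L" and blK: "bounded_linear K"
    using f g strict_deriv_bounded_linear by auto
  show "bounded_linear (\<lambda>v. K (L v))" by (rule bounded_linear_compose[OF blK blL])
  fix e :: real assume e: "e > 0"
  obtain C d1 where C: "d1 > 0" "C > 0"
    "\<And>y z. y \<in> ball x d1 \<Longrightarrow> z \<in> ball x d1 \<Longrightarrow> norm (f y - f z) \<le> C * norm (y - z)"
    using strict_deriv_lipschitz[OF f] by blast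
  obtain B where B: "B > 0" "\<And>v. norm (K v) \<le> norm v * B"
    using bounded_linear.pos_bounded[OF blK] by blast
  \<comment> \<open>The error of the composition is the error of \<open>g\<close>, scaled by the
    Lipschitz constant \<open>C\<close> of \<open>f\<close>, plus the image under \<open>K\<close>
    of the error of \<open>f\<close>, scaled by the bound \<open>B\<close> of \<open>K\<close>. Each
    part gets half of \<open>e\<close>.\<close>
  have eC: "e / (2 * C) > 0" using e C by simp
  obtain d2 where d2: "d2 > 0" "\<And>y z. y \<in> ball (f x) d2 \<Longrightarrow> z \<in> ball (f x) d2 \<Longrightarrow>
      norm (g y - g z - K (y - z)) \<le> e / (2 * C) * norm (y - z)"
    using strict_derivD[OF g eC] by blast
  have eB: "e / (2 * B) > 0" using e B by simp
  obtain d3 where d3: "d3 > 0" "\<And>y z. y \<in> ball x d3 \<Longrightarrow> z \<in> ball x d3 \<Longrightarrow>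
      norm (f y - f z - L (y - z)) \<le> e / (2 * B) * norm (y - z)"
    using strict_derivD[OF f eB] by blast
  obtain d4 where d4: "d4 > 0" "\<And>y. dist y x < d4 \<Longrightarrow> dist (f y) (f x) < d2"
    using strict_deriv_isCont[OF f] d2(1) unfolding continuous_at_eps_delta by blast
  define d where "d = min d1 (min d3 d4)"
  show "\<exists>d>0. \<forall>y\<in>ball x d. \<forall>z\<in>ball x d.
      norm (g (f y) - g (f z) - K (L (y - z))) \<le> e * norm (y - z)"
  proof (intro exI[of _ d] conjI ballI)
    show "d > 0" using C d3 d4 by (simp add: d_def)
    fix y z assume y: "y \<in> ball x d" and z: "z \<in> ball x d"
    have fy: "f y \<in> ball (f x) d2" "f z \<in> ball (f x) d2"
      using d4(2)[of y] d4(2)[of z] y z by (auto simp: d_def dist_commute)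
    have 1: "norm (g (f y) - g (f z) - K (f y - f z)) \<le> e / (2 * C) * norm (f y - f z)"
      using d2(2) fy by blast
    have "norm (f y - f z) \<le> C * norm (y - z)" using C(3) y z by (simp add: d_def)
    then have "e / (2 * C) * norm (f y - f z) \<le> e / (2 * C) * (C * norm (y - z))"
      using \<open>e / (2 * C) > 0\<close> by (intro mult_left_mono) auto
    moreover have "e / (2 * C) * (C * norm (y - z)) = e / 2 * norm (y - z)"
      using C(2) by simp
    ultimately have 2: "norm (g (f y) - g (f z) - K (f y - f z)) \<le> e / 2 * norm (y - z)"
      using 1 by linarith
    have "norm (K (f y - f z - L (y - z))) \<le> norm (f y - f z - L (y - z)) * B" by (rule B)
    also have "\<dots> \<le> (e / (2 * B) * norm (y - z)) * B"
      using B(1) d3(2)[of y z] y z by (intro mult_right_mono) (auto simp: d_def)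
    finally have 3: "norm (K (f y - f z - L (y - z))) \<le> e / 2 * norm (y - z)" using B by simp
    have "g (f y) - g (f z) - K (L (y - z)) =
        (g (f y) - g (f z) - K (f y - f z)) + K (f y - f z - L (y - z))"
      by (simp add: linear_diff[OF bounded_linear.linear[OF blK]])
    then have "norm (g (f y) - g (f z) - K (L (y - z))) \<le>
        norm (g (f y) - g (f z) - K (f y - f z)) + norm (K (f y - f z - L (y - z)))"
      by (metis norm_triangle_ineq)
    then show "norm (g (f y) - g (f z) - K (L (y - z))) \<le> e * norm (y - z)"
      using 2 3 by simp
  qed
qed

lemma strict_deriv_unique:
  "strict_deriv f L x \<Longrightarrow> strict_deriv f K x \<Longrightarrow> L = K"
  using strict_deriv_has_derivative has_derivative_unique by blast

lemma bounded_linear_le_Basis: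
  fixes L :: "'a::euclidean_space \<Rightarrow> 'b::real_normed_vector"
  assumes "linear L"
  shows "norm (L v) \<le> (\<Sum>b\<in>Basis. norm (L b)) * norm v"
proof -
  have "L v = L (\<Sum>b\<in>Basis. (v \<bullet> b) *\<^sub>R b)" by (simp add: euclidean_representation)
  also have "\<dots> = (\<Sum>b\<in>Basis. (v \<bullet> b) *\<^sub>R L b)"
    by (simp add: linear_sum[OF assms] linear_scale[OF assms])
  finally have "norm (L v) \<le> (\<Sum>b\<in>Basis. norm ((v \<bullet> b) *\<^sub>R L b))" by (metis norm_sum)
  also have "\<dots> \<le> (\<Sum>b\<in>Basis. norm (L b) * norm v)"
    by (intro sum_mono) (simp add: Basis_le_norm mult.commute[of "norm (L _)"] mult_right_mono)
  finally show ?thesis by (simp add: sum_distrib_right)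
qed

text \<open>Continuity of the derivative is asked direction by direction, the form in which
  \<open>Ck_on\<close> provides it. In finite dimension this amounts to continuity in the operator
  norm.\<close>

definition C1_on :: "('a::real_normed_vector \<Rightarrow> 'b::real_normed_vector) \<Rightarrow> ('a \<Rightarrow> 'a \<Rightarrow> 'b) \<Rightarrow> 'a set \<Rightarrow> bool" where
  "C1_on f f' S \<longleftrightarrow> (\<forall>x\<in>S. (f has_derivative f' x) (at x)) \<and> (\<forall>v. continuous_on S (\<lambda>x. f' x v))"

lemma C1_on_has_derivative: "C1_on f f' S \<Longrightarrow> x \<in> S \<Longrightarrow> (f has_derivative f' x) (at x)"
  by (simp add: C1_on_def)

text \<open>Finite dimension enters here: the operator norm of \<open>f' y - f' x\<close> is at most
  the sum of the norms of its values on the basis, a continuous function of \<open>y\<close> that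
  vanishes at \<open>x\<close>.\<close>

lemma C1_on_small_oscillation:
  fixes f :: "'a::euclidean_space \<Rightarrow> 'b::real_normed_vector"
  assumes "C1_on f f' S" "open S" "x \<in> S" "e > 0"
  shows "\<exists>r>0. ball x r \<subseteq> S \<and> (\<forall>y\<in>ball x r. \<forall>v. norm (f' y v - f' x v) \<le> e * norm v)"
proof -
  define F where "F y = (\<Sum>b\<in>Basis. norm (f' y b - f' x b))" for y
  have "continuous_on S F"
    unfolding F_def using assms(1) by (intro continuous_intros) (auto simp: C1_on_def)
  then have "isCont F x" using assms by (simp add: continuous_on_eq_continuous_at)
  moreover have "F x = 0" by (simp add: F_def)
  ultimately obtain d where d: "d > 0" "\<And>y. dist y x < d \<Longrightarrow> \<bar>F y\<bar> < e"
    using \<open>e > 0\<close> unfolding continuous_at_eps_delta by (metis diff_zero dist_real_def)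
  obtain r0 where r0: "r0 > 0" "ball x r0 \<subseteq> S" using assms open_contains_ball by metis
  show ?thesis
  proof (intro exI[of _ "min d r0"] conjI ballI allI)
    show "min d r0 > 0" "ball x (min d r0) \<subseteq> S" using d r0 by auto
    fix y v assume y: "y \<in> ball x (min d r0)"
    then have "y \<in> S" using r0 by auto
    have "linear (f' y)" "linear (f' x)"
      using assms \<open>y \<in> S\<close> has_derivative_linear by (auto simp: C1_on_def)
    then have "linear (\<lambda>v. f' y v - f' x v)" by (rule linear_compose_sub)
    from bounded_linear_le_Basis[OF this, of v] have "norm (f' y v - f' x v) \<le> F y * norm v"
      by (simp add: F_def)
    also have "\<dots> \<le> e * norm v"
      using d(2)[of y] y by (intro mult_right_mono) (auto simp: dist_commute)
    finally show "norm (f' y v - f' x v) \<le> e * norm v" .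
  qed
qed

text \<open>The mean value inequality for \<open>f - L\<close>, whose derivative is bounded by
  \<open>e\<close>. Taking for \<open>L\<close> the derivative at one point turns small oscillation
  of \<open>f'\<close> into strict differentiability.\<close>

lemma mean_value_linearization:
  fixes f :: "'a::euclidean_space \<Rightarrow> 'b::real_normed_vector"
  assumes "convex S" and der: "\<And>x. x \<in> S \<Longrightarrow> (f has_derivative f' x) (at x)"
    and L: "bounded_linear L" and b: "\<And>x v. x \<in> S \<Longrightarrow> norm (f' x v - L v) \<le> e * norm v"
    and "x \<in> S" "y \<in> S"
  shows "norm (f x - f y - L (x - y)) \<le> e * norm (x - y)"
proof -
  have "norm ((f x - L x) - (f y - L y)) \<le> e * norm (x - y)"
  proof (rule differentiable_bound[OF \<open>convex S\<close>, where f = "\<lambda>x. f x - L x" and f' = "\<lambda>x v. f' x v - L v"])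
    fix z assume z: "z \<in> S"
    show "((\<lambda>x. f x - L x) has_derivative (\<lambda>v. f' z v - L v)) (at z within S)"
      using has_derivative_diff[OF der[OF z] bounded_linear_imp_has_derivative[OF L]]
      by (rule has_derivative_at_withinI)
    show "onorm (\<lambda>v. f' z v - L v) \<le> e"
      using onorm_le[of "\<lambda>v. f' z v - L v" e] b[OF z] by (simp add: mult.commute)
  qed (use assms in auto)
  then show ?thesis by (simp add: linear_diff[OF bounded_linear.linear[OF L]] algebra_simps)
qed

lemma C1_on_strict_deriv:
  fixes f :: "'a::euclidean_space \<Rightarrow> 'b::real_normed_vector"
  assumes "C1_on f f' S" "open S" "x \<in> S"
  shows "strict_deriv f (f' x) x"
  unfolding strict_deriv_def
proof (intro conjI allI impI)
  show bl: "bounded_linear (f' x)"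
    using C1_on_has_derivative[OF assms(1,3)] has_derivative_bounded_linear by blast
  fix e :: real assume e: "e > 0"
  obtain r where r: "r > 0" "ball x r \<subseteq> S"
    "\<And>y v. y \<in> ball x r \<Longrightarrow> norm (f' y v - f' x v) \<le> e * norm v"
    using C1_on_small_oscillation[OF assms e] by blast
  show "\<exists>d>0. \<forall>y\<in>ball x d. \<forall>z\<in>ball x d. norm (f y - f z - f' x (y - z)) \<le> e * norm (y - z)"
    using r(1)
  proof (intro exI[of _ r] conjI ballI)
    fix y z assume yz: "y \<in> ball x r" "z \<in> ball x r"
    show "norm (f y - f z - f' x (y - z)) \<le> e * norm (y - z)"
      by (rule mean_value_linearization[where S = "ball x r" and f' = f'])
        (use assms r yz bl in \<open>auto simp: C1_on_def\<close>)
  qed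
qed

text \<open>A Lebesgue number of the cover of \<open>K\<close> by balls of small oscillation makes
  the radius uniform. The oscillation is taken below \<open>e / 2\<close> because the derivatives at
  \<open>k\<close> and at a nearby point are compared through the centre \<open>a\<close> of a
  covering ball.\<close>

lemma C1_on_tube:
  fixes f :: "'a::euclidean_space \<Rightarrow> 'b::real_normed_vector"
  assumes C1: "C1_on f f' S" and "open S" and K: "compact K" "K \<subseteq> S" and e: "e > 0"
  shows "\<exists>d>0. \<forall>k\<in>K. ball k d \<subseteq> S \<and>
    (\<forall>x\<in>ball k d. \<forall>y\<in>ball k d. norm (f x - f y - f' k (x - y)) \<le> e * norm (x - y))"
proof -
  define G where "G = {ball x r | x r. x \<in> S \<and> ball x r \<subseteq> S \<and>
      (\<forall>y\<in>ball x r. \<forall>v. norm (f' y v - f' x v) \<le> e / 2 * norm v)}"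
  have "K \<subseteq> \<Union>G"
  proof
    fix x assume "x \<in> K"
    then have x: "x \<in> S" using K by auto
    have e2: "e / 2 > 0" using e by simp
    obtain r where "r > 0" "ball x r \<subseteq> S"
      "\<And>y v. y \<in> ball x r \<Longrightarrow> norm (f' y v - f' x v) \<le> e / 2 * norm v"
      using C1_on_small_oscillation[OF C1 \<open>open S\<close> x e2] by blast
    then have "ball x r \<in> G" "x \<in> ball x r" using \<open>x \<in> S\<close> unfolding G_def
      by (blast, simp)
    then show "x \<in> \<Union>G" by blast
  qed
  moreover have "open U" if "U \<in> G" for U using that by (auto simp: G_def)
  ultimately obtain d where d: "d > 0" "\<And>x. x \<in> K \<Longrightarrow> \<exists>U\<in>G. ball x d \<subseteq> U"
    using Heine_Borel_lemma[OF K(1), of G] by metis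
  show ?thesis
  proof (intro exI[of _ d] conjI ballI)
    show "d > 0" by (rule d)
    fix k assume k: "k \<in> K"
    then obtain a r where ar: "ball k d \<subseteq> ball a r" "a \<in> S" "ball a r \<subseteq> S"
      "\<And>y v. y \<in> ball a r \<Longrightarrow> norm (f' y v - f' a v) \<le> e / 2 * norm v"
      using d(2)[OF k] unfolding G_def by blast
    then show "ball k d \<subseteq> S" by blast
    fix x y assume xy: "x \<in> ball k d" "y \<in> ball k d"
    have ka: "k \<in> ball a r" using ar d(1) by (metis centre_in_ball subsetD)
    show "norm (f x - f y - f' k (x - y)) \<le> e * norm (x - y)"
    proof (rule mean_value_linearization[where S = "ball a r" and f' = f'])
      show "bounded_linear (f' k)"
        using C1 ka ar has_derivative_bounded_linear unfolding C1_on_def by blast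
      fix z v assume z: "z \<in> ball a r"
      have "norm (f' z v - f' k v) \<le> norm (f' z v - f' a v) + norm (f' k v - f' a v)"
        using norm_triangle_ineq4[of "f' z v - f' a v" "f' k v - f' a v"] by simp
      then show "norm (f' z v - f' k v) \<le> e * norm v"
        using ar(4)[OF z, of v] ar(4)[OF ka, of v] by simp
    next
      show "\<And>x. x \<in> ball a r \<Longrightarrow> (f has_derivative f' x) (at x)"
        using C1 ar by (auto simp: C1_on_def)
    qed (use xy ar in auto)
  qed
qed

section \<open>A quantitative inverse function theorem\<close>

text \<open>With \<open>P\<close> the inverse of \<open>L\<close>, the map
  \<open>x - P (f x)\<close> contracts distances by 1/2 near \<open>u\<close>. This bounds
  differences of \<open>f\<close> from below, and makes \<open>f z = y\<close> solvable by a fixed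
  point argument. The covering statement is for all balls inside \<open>ball u d\<close>, not only
  for those centred at \<open>u\<close>, since sections are later continued from varying
  points.\<close>

lemma strict_deriv_local_inverse:
  fixes f :: "'a::euclidean_space \<Rightarrow> 'a"
  assumes f: "strict_deriv f L u" and inj: "inj L"
  shows "\<exists>d>0. \<exists>m>0.
    (\<forall>x\<in>ball u d. \<forall>y\<in>ball u d. m * norm (x - y) \<le> norm (f x - f y)) \<and>
    (\<forall>x. \<forall>r>0. ball x r \<subseteq> ball u d \<longrightarrow> ball (f x) (m * r) \<subseteq> f ` ball x r)"
proof -
  have bl: "bounded_linear L" using f by (rule strict_deriv_bounded_linear)
  then have lin: "linear L" by (rule bounded_linear.linear)
  obtain P where P: "linear P" "\<And>v. P (L v) = v" "\<And>v. L (P v) = v"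
    using linear_injective_isomorphism[OF lin inj] by blast
  have "bounded_linear P" using P(1) by (simp add: linear_conv_bounded_linear)
  then obtain C where C: "C > 0" "\<And>v. norm (P v) \<le> norm v * C"
    using bounded_linear.pos_bounded by blast
  have C2: "1 / (2 * C) > 0" using C by simp
  obtain d where d: "d > 0" "\<And>y z. y \<in> ball u d \<Longrightarrow> z \<in> ball u d \<Longrightarrow>
      norm (f y - f z - L (y - z)) \<le> 1 / (2 * C) * norm (y - z)"
    using strict_derivD[OF f C2] by blast
  \<comment> \<open>The lower bound alone would allow \<open>1 / (2 * C)\<close>. The further factor
    2 makes the first step of the iteration \<open>T\<close> below at most \<open>q / 2\<close>, so
    that \<open>T\<close> maps \<open>cball x q\<close> into itself.\<close>
  define m where "m = 1 / (4 * C)"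
  have m: "m > 0" using C by (simp add: m_def)
  have contr: "norm ((y - P (f y)) - (z - P (f z))) \<le> norm (y - z) / 2"
    if "y \<in> ball u d" "z \<in> ball u d" for y z
  proof -
    have "(y - P (f y)) - (z - P (f z)) = - P (f y - f z - L (y - z))"
      by (simp add: linear_diff[OF P(1)] P(2))
    then have "norm ((y - P (f y)) - (z - P (f z))) \<le> norm (f y - f z - L (y - z)) * C"
      using C(2) by simp
    also have "\<dots> \<le> (1 / (2 * C) * norm (y - z)) * C"
      using C d(2) that by (intro mult_right_mono) auto
    finally show ?thesis using C by simp
  qed
  have low: "m * norm (x - y) \<le> norm (f x - f y)" if "x \<in> ball u d" "y \<in> ball u d" for x y
  proof -
    have "norm (x - y) \<le> norm ((x - P (f x)) - (y - P (f y))) + norm (P (f x - f y))"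
      using norm_triangle_ineq[of "(x - P (f x)) - (y - P (f y))" "P (f x - f y)"]
      by (simp add: linear_diff[OF P(1)])
    then have "norm (x - y) \<le> 2 * norm (P (f x - f y))" using contr[OF that] by simp
    also have "\<dots> \<le> 2 * (norm (f x - f y) * C)" using C(2) by simp
    finally have "norm (x - y) \<le> 2 * C * norm (f x - f y)" by (simp add: mult_ac)
    then have "norm (x - y) * m \<le> 2 * C * norm (f x - f y) * m" using m by (simp add: mult_right_mono)
    also have "\<dots> = norm (f x - f y) / 2" using C by (simp add: m_def field_simps)
    also have "\<dots> \<le> norm (f x - f y)" by simp
    finally show ?thesis by (simp add: mult.commute)
  qed
  have sur: "ball (f x) (m * r) \<subseteq> f ` ball x r" if sub: "ball x r \<subseteq> ball u d" and r: "r > 0" for x r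
  proof
    fix y assume y: "y \<in> ball (f x) (m * r)"
    \<comment> \<open>A closed ball inside the open one, since Banach's theorem needs a complete
      set.\<close>
    define q where "q = r / 2"
    have q: "q > 0" "cball x q \<subseteq> ball x r" using r by (auto simp: q_def)
    \<comment> \<open>Newton's iteration with the derivative frozen at \<open>u\<close>; as
      \<open>P\<close> is injective, its fixed points are the solutions of
      \<open>f z = y\<close>.\<close>
    define T where "T z = z - P (f z - y)" for z
    have Tdiff: "T a - T b = (a - P (f a)) - (b - P (f b))" for a b
      by (simp add: T_def linear_diff[OF P(1)])
    have "\<exists>!z. z \<in> cball x q \<and> T z = z"
    proof (rule Banach_fix[where c = "1/2"])
      show "T ` cball x q \<subseteq> cball x q"
      proof clarify
        fix z assume z: "z \<in> cball x q"
        then have "z \<in> ball u d" "x \<in> ball u d" using q sub r by (blast, meson centre_in_ball subsetD)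
        then have "norm (T z - T x) \<le> norm (z - x) / 2" using contr Tdiff by simp
        also have "\<dots> \<le> q / 2" using z by (simp add: dist_norm norm_minus_commute)
        finally have 1: "norm (T z - T x) \<le> q / 2" .
        have "norm (T x - x) \<le> norm (f x - y) * C" using C(2)[of "f x - y"] by (simp add: T_def)
        also have "\<dots> \<le> m * r * C" using y C by (intro mult_right_mono) (auto simp: dist_norm)
        also have "\<dots> = q / 2" using C by (simp add: m_def q_def)
        finally show "T z \<in> cball x q"
          using 1 norm_triangle_ineq[of "T z - T x" "T x - x"]
          by (simp add: dist_norm norm_minus_commute)
      qed
      fix a b assume "a \<in> cball x q" "b \<in> cball x q"
      then have "a \<in> ball u d" "b \<in> ball u d" using q sub by blast+
      then show "dist (T a) (T b) \<le> 1 / 2 * dist a b" using contr Tdiff by (simp add: dist_norm)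
    qed (use q in \<open>auto intro: compact_imp_complete\<close>)
    then obtain z where z: "z \<in> cball x q" "T z = z" by blast
    then have "P (f z - y) = 0" by (simp add: T_def)
    then have "f z = y" by (metis P(3) linear_0[OF lin] right_minus_eq)
    then show "y \<in> f ` ball x r" using z q by blast
  qed
  show ?thesis
    using d(1) m low sur by blast
qed

section \<open>Ordinary differential equations\<close>

text \<open>At the supremum of the times up to which \<open>P\<close> holds, \<open>left\<close>
  gives \<open>P\<close> itself, and \<open>right\<close> would lead beyond it unless it is
  \<open>b\<close>. This induction propagates properties along solutions and geodesics.\<close>

lemma real_interval_induct [consumes 1, case_names base right left]:
  fixes a b :: real
  assumes "a \<le> b" and base: "P a"
    and right: "\<And>t. a \<le> t \<Longrightarrow> t < b \<Longrightarrow> (\<And>s. a \<le> s \<Longrightarrow> s \<le> t \<Longrightarrow> P s) \<Longrightarrow>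
      \<exists>u>t. \<forall>s. t < s \<and> s \<le> u \<and> s \<le> b \<longrightarrow> P s"
    and left: "\<And>t. a < t \<Longrightarrow> t \<le> b \<Longrightarrow> (\<And>s. a \<le> s \<Longrightarrow> s < t \<Longrightarrow> P s) \<Longrightarrow> P t"
  shows "\<forall>t\<in>{a..b}. P t"
proof -
  define T where "T = {t \<in> {a..b}. \<forall>s. a \<le> s \<and> s \<le> t \<longrightarrow> P s}"
  have aT: "a \<in> T" using assms by (auto simp: T_def)
  have bdd: "bdd_above T" by (rule bdd_aboveI[of _ b]) (auto simp: T_def)
  define t where "t = Sup T"
  have at: "a \<le> t" unfolding t_def by (rule cSup_upper[OF aT bdd])
  have tb: "t \<le> b" unfolding t_def by (rule cSup_least) (use aT in \<open>auto simp: T_def\<close>)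
  have below: "P s" if "a \<le> s" "s < t" for s
  proof -
    have "s < Sup T" using that t_def by simp
    then obtain r where "r \<in> T" "s < r"
      using less_cSup_iff[OF _ bdd, of s] aT by blast
    then show ?thesis using that by (auto simp: T_def)
  qed
  have "P t"
    using base left[of t] below at tb by (cases "a = t") auto
  then have upto: "P s" if "a \<le> s" "s \<le> t" for s
    using below that by (cases "s = t") auto
  have "t = b"
  proof (rule ccontr)
    assume "t \<noteq> b"
    then have "t < b" using tb by simp
    then obtain u where u: "u > t" "\<forall>s. t < s \<and> s \<le> u \<and> s \<le> b \<longrightarrow> P s"
      using right[OF at] upto by blast
    then have "min u b \<in> T" using upto at \<open>t < b\<close> by (auto simp: T_def) (metis linorder_not_le)
    then have "min u b \<le> t" unfolding t_def by (rule cSup_upper[OF _ bdd])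
    then show False using u \<open>t < b\<close> by auto
  qed
  then show ?thesis using upto by auto
qed

text \<open>The norm is not differentiable at 0. It is replaced by
  \<open>sqrt (D s \<bullet> D s + d\<^sup>2)\<close>, which is smooth in the squared norm and
  satisfies the same growth bound; \<open>d\<close> is then absorbed into an arbitrary
  \<open>e\<close>.\<close>

lemma gronwall:
  fixes D :: "real \<Rightarrow> 'b::real_inner"
  assumes ab: "a \<le> b"
    and der: "\<And>t. t \<in> {a..b} \<Longrightarrow> (D has_vector_derivative D' t) (at t within {a..b})"
    and bound: "\<And>t. t \<in> {a..b} \<Longrightarrow> norm (D' t) \<le> K * norm (D t) + E"
    and K: "K \<ge> 0" and E: "E \<ge> 0" and t: "t \<in> {a..b}"
  shows "norm (D t) \<le> (norm (D a) + E * (b - a)) * exp (K * (b - a))"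
proof (rule field_le_epsilon)
  fix e :: real assume e: "e > 0"
  \<comment> \<open>Regularising raises the initial value by at most \<open>d\<close>, hence the
    final bound by at most \<open>e\<close>.\<close>
  define d where "d = e / exp (K * (b - a))"
  have d: "d > 0" using e by (simp add: d_def)
  define v where "v s = sqrt (D s \<bullet> D s + d\<^sup>2)" for s
  have pos: "D s \<bullet> D s + d\<^sup>2 > 0" for s using d by (simp add: add_nonneg_pos)
  then have vpos: "v s > 0" for s by (simp add: v_def)
  have vge: "norm (D s) \<le> v s" for s
    unfolding v_def norm_eq_sqrt_inner by (rule real_sqrt_le_mono) simp
  \<comment> \<open>Integrating factor: \<open>w\<close> is nonincreasing, and
    \<open>w t \<le> w a\<close> is the claim up to rearrangement.\<close>
  define w where "w s = v s * exp (- K * (s - a)) - E * (s - a)" for s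
  define w' where "w' s = (D s \<bullet> D' s / v s) * exp (- K * (s - a)) + v s * (- K * exp (- K * (s - a))) - E" for s
  have dw: "(w has_real_derivative w' s) (at s within {a..b})" if s: "s \<in> {a..b}" for s
  proof -
    have dI: "((\<lambda>s. D s \<bullet> D s + d\<^sup>2) has_real_derivative 2 * (D s \<bullet> D' s)) (at s within {a..b})"
      using der[OF s] unfolding has_real_derivative_iff_has_vector_derivative has_vector_derivative_def
      by (auto intro!: derivative_eq_intros simp: inner_commute)
    have "(v has_real_derivative inverse (sqrt (D s \<bullet> D s + d\<^sup>2)) / 2 * (2 * (D s \<bullet> D' s))) (at s within {a..b})"
      unfolding v_def by (rule DERIV_chain2[OF DERIV_real_sqrt[OF pos] dI])
    then have dv: "(v has_real_derivative D s \<bullet> D' s / v s) (at s within {a..b})"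
      by (simp add: v_def field_simps)
    show ?thesis unfolding w_def w'_def
      by (rule derivative_eq_intros dv refl | simp)+
  qed
  have w'le: "w' s \<le> 0" if s: "s \<in> {a..b}" for s
  proof -
    have "D s \<bullet> D' s \<le> norm (D s) * norm (D' s)" by (rule norm_cauchy_schwarz)
    also have "\<dots> \<le> v s * (K * v s + E)"
    proof (rule mult_mono)
      have "K * norm (D s) \<le> K * v s" by (rule mult_left_mono[OF vge K])
      then show "norm (D' s) \<le> K * v s + E" using bound[OF s] by simp
    qed (use vge vpos[of s] in auto)
    finally have q: "D s \<bullet> D' s / v s \<le> K * v s + E" using vpos[of s] by (simp add: field_simps)
    have e1: "exp (- K * (s - a)) \<le> 1" using K s by simp
    have "(D s \<bullet> D' s / v s) * exp (- K * (s - a)) \<le> (K * v s + E) * exp (- K * (s - a))"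
      using q by (intro mult_right_mono) auto
    moreover have "E * exp (- K * (s - a)) \<le> E * 1" by (rule mult_left_mono[OF e1 E])
    ultimately show ?thesis unfolding w'_def by (simp add: algebra_simps)
  qed
  have "\<exists>y. (w has_real_derivative y) (at s) \<and> y \<le> 0" if "a < s" "s < t" for s
    using dw[of s] w'le[of s] t that at_within_Icc_at[of a s b] by auto
  moreover have "continuous_on {a..t} w"
    by (rule continuous_on_subset[OF DERIV_continuous_on[OF dw]]) (use t in auto)
  ultimately have "w t \<le> w a"
    using DERIV_nonpos_imp_decreasing_open[of a t w] t by auto
  then have "v t * exp (- K * (t - a)) \<le> v a + E * (t - a)" by (simp add: w_def)
  also have "\<dots> \<le> v a + E * (b - a)" using E t by (auto intro: mult_left_mono)
  finally have "v t * exp (- K * (t - a)) * exp (K * (t - a)) \<le> (v a + E * (b - a)) * exp (K * (t - a))"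
    by (intro mult_right_mono) auto
  also have "\<dots> \<le> (v a + E * (b - a)) * exp (K * (b - a))"
    using K t E vpos[of a] ab by (intro mult_left_mono) (auto intro!: add_nonneg_nonneg mult_left_mono)
  finally have "v t \<le> (v a + E * (b - a)) * exp (K * (b - a))"
    by (simp add: mult.assoc flip: exp_add)
  also have "v a \<le> norm (D a) + d"
    unfolding v_def by (rule real_le_lsqrt) (use d in \<open>auto simp: power2_norm_eq_inner[symmetric] power2_sum\<close>)
  finally have "v t \<le> (norm (D a) + d + E * (b - a)) * exp (K * (b - a))" by simp
  then show "norm (D t) \<le> (norm (D a) + E * (b - a)) * exp (K * (b - a)) + e"
    using vge[of t] by (simp add: d_def algebra_simps)
qed

text \<open>The fundamental matrix as a series: \<open>P n\<close> is the n-th increment of Picard's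
  iteration, an n-fold iterated integral of norm at most \<open>(K * (t - a)) ^ n / fact n\<close>.
  The series therefore converges uniformly on the whole interval, and no gluing of short-time
  solutions occurs.\<close>

lemma linear_ode_solution:
  fixes A :: "real \<Rightarrow> 'f::euclidean_space \<Rightarrow>\<^sub>L 'f"
  assumes ab: "a \<le> b" and A: "continuous_on {a..b} A"
  shows "\<exists>M :: real \<Rightarrow> 'f \<Rightarrow>\<^sub>L 'f. M a = id_blinfun \<and>
    (\<forall>t\<in>{a..b}. (M has_vector_derivative A t o\<^sub>L M t) (at t within {a..b}))"
proof -
  obtain K where K: "K \<ge> 0" "\<And>t. t \<in> {a..b} \<Longrightarrow> norm (A t) \<le> K"
  proof -
    have "bounded (A ` {a..b})" by (intro compact_imp_bounded compact_continuous_image A) simp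
    then obtain B where "\<And>t. t \<in> {a..b} \<Longrightarrow> norm (A t) \<le> B" unfolding bounded_iff by blast
    then show thesis by (intro that[of "max 0 B"]) force+
  qed
  define P where "P = rec_nat (\<lambda>t. id_blinfun) (\<lambda>n Q t. integral {a..t} (\<lambda>s. A s o\<^sub>L Q s))"
  have P0: "P 0 t = id_blinfun" and PS: "P (Suc n) t = integral {a..t} (\<lambda>s. A s o\<^sub>L P n s)" for n t
    by (simp_all add: P_def)
  have cont: "continuous_on {a..b} (P n)" for n
  proof (induction n)
    case (Suc n)
    then show ?case unfolding PS
      by (intro indefinite_integral_continuous_1 integrable_continuous_real continuous_intros A)
  qed (simp add: P0 cong: continuous_on_cong)
  have contA: "continuous_on {a..b} (\<lambda>s. A s o\<^sub>L P n s)" for n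
    by (intro continuous_intros A cont)
  have der: "(P (Suc n) has_vector_derivative A t o\<^sub>L P n t) (at t within {a..b})" if "t \<in> {a..b}" for n t
    unfolding PS by (rule integral_has_vector_derivative[OF contA that])
  have bnd: "norm (P n t) \<le> (K * (t - a)) ^ n / fact n" if "t \<in> {a..b}" for n t
    using that
  proof (induction n arbitrary: t)
    case 0
    then show ?case by (simp add: P0 norm_blinfun_id_le)
  next
    case (Suc n)
    have der2: "((\<lambda>t. (K * (t - a)) ^ Suc n / fact (Suc n)) has_vector_derivative
        K * ((K * (t - a)) ^ n / fact n)) (at t within {a..t'})" for t t'
    proof -
      have "((\<lambda>t. K * (t - a)) has_real_derivative K) (at t within {a..t'})"
        by (auto intro!: derivative_eq_intros)
      from DERIV_cdivide[OF DERIV_power[OF this, of "Suc n"], of "fact (Suc n)"]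
      have "((\<lambda>t. (K * (t - a)) ^ Suc n / fact (Suc n)) has_real_derivative
        real (Suc n) * (K * (K * (t - a)) ^ n) / fact (Suc n)) (at t within {a..t'})"
        by simp
      moreover have "real (Suc n) * (K * (K * (t - a)) ^ n) / fact (Suc n) = K * ((K * (t - a)) ^ n / fact n)"
        unfolding fact_Suc by (simp del: of_nat_Suc)
      ultimately show ?thesis by (simp add: has_real_derivative_iff_has_vector_derivative)
    qed
    have "norm (P (Suc n) t) \<le> integral {a..t} (\<lambda>s. K * ((K * (s - a)) ^ n / fact n))"
      unfolding PS
    proof (rule integral_norm_bound_integral)
      show "(\<lambda>s. A s o\<^sub>L P n s) integrable_on {a..t}"
        by (rule integrable_continuous_real[OF continuous_on_subset[OF contA]]) (use Suc in auto)
      show "(\<lambda>s. K * ((K * (s - a)) ^ n / fact n)) integrable_on {a..t}"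
        by (intro integrable_continuous_real continuous_intros) auto
      fix s assume "s \<in> {a..t}"
      then have s: "s \<in> {a..b}" using Suc.prems by auto
      have "norm (A s o\<^sub>L P n s) \<le> norm (A s) * norm (P n s)" by (rule norm_blinfun_compose)
      also have "\<dots> \<le> K * ((K * (s - a)) ^ n / fact n)"
        using K Suc.IH[OF s] s by (intro mult_mono) auto
      finally show "norm (A s o\<^sub>L P n s) \<le> K * ((K * (s - a)) ^ n / fact n)" .
    qed
    also have "\<dots> = (K * (t - a)) ^ Suc n / fact (Suc n) - (K * (a - a)) ^ Suc n / fact (Suc n)"
      by (rule integral_unique[OF fundamental_theorem_of_calculus[OF _ der2]]) (use Suc.prems in simp)
    finally show ?case by simp
  qed
  define C where "C = K * (b - a)"
  have bC: "norm (P n t) \<le> C ^ n / fact n" if "t \<in> {a..b}" for n t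
  proof -
    have "(K * (t - a)) ^ n \<le> C ^ n" unfolding C_def
      using K that by (intro power_mono mult_left_mono mult_nonneg_nonneg) auto
    then show ?thesis using bnd[OF that, of n] by (meson divide_right_mono fact_ge_zero order_trans)
  qed
  have sumC: "summable (\<lambda>n. C ^ n / fact n)"
    using summable_exp[of C] by (simp add: field_simps)
  define M where "M t = (\<Sum>n. P n t)" for t
  have ul: "uniform_limit {a..b} (\<lambda>N t. \<Sum>n<N. P n t) M sequentially"
    unfolding M_def by (rule Weierstrass_m_test[OF bC sumC])
  have contM: "continuous_on {a..b} M"
    by (rule uniform_limit_theorem[OF _ ul]) (auto intro!: continuous_intros cont eventuallyI)
  have contAM: "continuous_on {a..b} (\<lambda>s. A s o\<^sub>L M s)" by (intro continuous_intros A contM)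
  \<comment> \<open>Uniform convergence allows integration term by term, and the integral of the
    n-th term is the term with index n + 1.\<close>
  have eq: "M t = id_blinfun + integral {a..t} (\<lambda>s. A s o\<^sub>L M s)" if t: "t \<in> {a..b}" for t
  proof -
    have ul2: "uniform_limit {a..t} (\<lambda>N s. A s o\<^sub>L (\<Sum>n<N. P n s)) (\<lambda>s. A s o\<^sub>L M s) sequentially"
    proof (rule uniform_limitI)
      fix e :: real assume e: "e > 0"
      then have "e / (K + 1) > 0" using K by simp
      from uniform_limitD[OF ul this]
      show "\<forall>\<^sub>F N in sequentially. \<forall>s\<in>{a..t}. dist (A s o\<^sub>L (\<Sum>n<N. P n s)) (A s o\<^sub>L M s) < e"
      proof eventually_elim
        case (elim N)
        show ?case
        proof
          fix s assume "s \<in> {a..t}"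
          then have s: "s \<in> {a..b}" using t by auto
          have "dist (A s o\<^sub>L (\<Sum>n<N. P n s)) (A s o\<^sub>L M s) = norm (A s o\<^sub>L ((\<Sum>n<N. P n s) - M s))"
            by (simp add: dist_norm bounded_bilinear.diff_right[OF bounded_bilinear_blinfun_compose])
          also have "\<dots> \<le> norm (A s) * norm ((\<Sum>n<N. P n s) - M s)" by (rule norm_blinfun_compose)
          also have "\<dots> \<le> K * (e / (K + 1))"
            using elim s K by (intro mult_mono) (auto simp: dist_norm less_imp_le)
          also have "\<dots> < e" using e K by (simp add: field_simps)
          finally show "dist (A s o\<^sub>L (\<Sum>n<N. P n s)) (A s o\<^sub>L M s) < e" .
        qed
      qed
    qed
    have cN: "continuous_on {a..t} (\<lambda>s. A s o\<^sub>L (\<Sum>n<N. P n s))" for N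
      by (rule continuous_on_subset[of "{a..b}"]) (use t in \<open>auto intro!: continuous_intros A cont\<close>)
    obtain I J where IJ: "\<And>N. ((\<lambda>s. A s o\<^sub>L (\<Sum>n<N. P n s)) has_integral I N) {a..t}"
      "((\<lambda>s. A s o\<^sub>L M s) has_integral J) {a..t}" "I \<longlonglongrightarrow> J"
      by (rule uniform_limit_integral[OF ul2 cN]) (auto simp: trivial_limit_sequentially)
    have "I = (\<lambda>N. \<Sum>n<N. P (Suc n) t)"
    proof
      fix N
      have "((\<lambda>s. \<Sum>n<N. A s o\<^sub>L P n s) has_integral (\<Sum>n<N. P (Suc n) t)) {a..t}"
        unfolding PS
        by (intro has_integral_sum integrable_integral integrable_continuous_real
            continuous_on_subset[OF contA]) (use t in auto)
      then show "I N = (\<Sum>n<N. P (Suc n) t)" using IJ(1)[of N]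
        by (simp add: bounded_bilinear.sum_right[OF bounded_bilinear_blinfun_compose] has_integral_unique)
    qed
    then have "(\<lambda>n. P (Suc n) t) sums J" using IJ(3) by (simp add: sums_def)
    then have "(\<lambda>n. P n t) sums (J + P 0 t)" by (rule sums_Suc)
    then have "M t = J + P 0 t" by (simp add: M_def sums_unique[symmetric])
    moreover have "integral {a..t} (\<lambda>s. A s o\<^sub>L M s) = J" using IJ(2) by (rule integral_unique)
    ultimately show ?thesis by (simp add: P0)
  qed
  have "(M has_vector_derivative A t o\<^sub>L M t) (at t within {a..b})" if t: "t \<in> {a..b}" for t
  proof -
    have "((\<lambda>t. integral {a..t} (\<lambda>s. A s o\<^sub>L M s)) has_vector_derivative A t o\<^sub>L M t) (at t within {a..b})"
      by (rule integral_has_vector_derivative[OF contAM t])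
    then have "((\<lambda>t. id_blinfun + integral {a..t} (\<lambda>s. A s o\<^sub>L M s)) has_vector_derivative A t o\<^sub>L M t) (at t within {a..b})"
      by (auto intro!: derivative_eq_intros)
    from has_vector_derivative_transform[OF t _ this, of M] eq show ?thesis by blast
  qed
  moreover have "M a = id_blinfun" using eq[of a] ab by simp
  ultimately show ?thesis by blast
qed

text \<open>\<open>In v t\<close> says that the solution with parameter \<open>v\<close> is still in the domain of the vector
  field at time \<open>t\<close>; it may leave the domain, but not from within a compact subset.\<close>

lemma ode_strict_deriv_parameter:
  fixes x :: "'v::real_normed_vector \<Rightarrow> real \<Rightarrow> 'f::euclidean_space"
  assumes G: "C1_on G G' \<Omega>" and open_\<Omega>: "open \<Omega>" and ab: "a \<le> b"
    and In0: "\<And>t. t \<in> {a..b} \<Longrightarrow> In v0 t"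
    and sol: "\<And>v t. t \<in> {a..b} \<Longrightarrow> In v t \<Longrightarrow>
      x v t \<in> \<Omega> \<and> (x v has_vector_derivative G (x v t)) (at t within {a..b})"
    and opn: "\<And>v t. t \<in> {a..b} \<Longrightarrow> In v t \<Longrightarrow> \<exists>e>0. \<forall>s\<in>{a..b}. \<bar>s - t\<bar> < e \<longrightarrow> In v s"
    and cls: "\<And>v t K. a < t \<Longrightarrow> t \<le> b \<Longrightarrow> compact K \<Longrightarrow> K \<subseteq> \<Omega> \<Longrightarrow>
      (\<And>s. a \<le> s \<Longrightarrow> s < t \<Longrightarrow> In v s \<and> x v s \<in> K) \<Longrightarrow> In v t"
    and In_a: "\<forall>\<^sub>F v in nhds v0. In v a"
    and init: "strict_deriv (\<lambda>v. x v a) L v0"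
  shows "\<exists>L'. L' a = L \<and>
    (\<forall>t\<in>{a..b}. (\<forall>\<^sub>F v in nhds v0. In v t) \<and> strict_deriv (\<lambda>v. x v t) (L' t) v0) \<and>
    (\<forall>t\<in>{a..b}. \<forall>\<xi>. ((\<lambda>t. L' t \<xi>) has_vector_derivative G' (x v0 t) (L' t \<xi>)) (at t within {a..b}))"
proof -
  define K0 where "K0 = x v0 ` {a..b}"
  have cont: "continuous (at t within {a..b}) (x v)" if "t \<in> {a..b}" "In v t" for v t
    using sol[OF that] by (blast intro: has_vector_derivative_continuous)
  then have cont0: "continuous_on {a..b} (x v0)"
    using In0 by (simp add: continuous_on_eq_continuous_within)
  have K0: "compact K0" "K0 \<subseteq> \<Omega>"
    unfolding K0_def using cont0 sol[OF _ In0] by (auto intro: compact_continuous_image)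
  have bl: "bounded_linear (G' (x v0 t))" if "t \<in> {a..b}" for t
    using C1_on_has_derivative[OF G] sol[OF that In0[OF that]] has_derivative_bounded_linear by blast
  define A where "A t = Blinfun (G' (x v0 t))" for t
  have A: "blinfun_apply (A t) = G' (x v0 t)" if "t \<in> {a..b}" for t
    unfolding A_def by (rule bounded_linear_Blinfun_apply[OF bl[OF that]])
  have contA: "continuous_on {a..b} A"
  proof (rule continuous_on_blinfun_componentwise)
    fix i :: 'f
    have "continuous_on \<Omega> (\<lambda>y. G' y i)" using G by (simp add: C1_on_def)
    then have "continuous_on {a..b} (\<lambda>t. G' (x v0 t) i)"
      by (rule continuous_on_compose2[OF _ cont0]) (use K0 in \<open>auto simp: K0_def\<close>)
    then show "continuous_on {a..b} (\<lambda>t. blinfun_apply (A t) i)"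
      by (rule continuous_on_eq) (simp add: A)
  qed
  obtain K where K: "K \<ge> 0" "\<And>t. t \<in> {a..b} \<Longrightarrow> norm (A t) \<le> K"
  proof -
    have "bounded (A ` {a..b})" by (intro compact_imp_bounded compact_continuous_image contA) simp
    then obtain B where "\<And>t. t \<in> {a..b} \<Longrightarrow> norm (A t) \<le> B" unfolding bounded_iff by blast
    then show thesis by (intro that[of "max 0 B"]) force+
  qed
  \<comment> \<open>A tube of radius \<open>d1\<close> around the compact reference trajectory. On
    each of its balls \<open>G\<close> is Lipschitz with the common constant \<open>B\<close>
    defined below.\<close>
  obtain d1 where d1: "d1 > 0" "\<And>k. k \<in> K0 \<Longrightarrow> ball k d1 \<subseteq> \<Omega>"
    "\<And>k y z. k \<in> K0 \<Longrightarrow> y \<in> ball k d1 \<Longrightarrow> z \<in> ball k d1 \<Longrightarrow>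
      norm (G y - G z - G' k (y - z)) \<le> 1 * norm (y - z)"
    using C1_on_tube[OF G open_\<Omega> K0 zero_less_one] by blast
  define B where "B = K + 1"
  have B: "B \<ge> 0" using K by (simp add: B_def)
  have lipG: "norm (G y - G z) \<le> B * norm (y - z)"
    if "t \<in> {a..b}" "norm (y - x v0 t) < d1" "norm (z - x v0 t) < d1" for t y z
  proof -
    have "norm (G y - G z - G' (x v0 t) (y - z)) \<le> norm (y - z)"
      using d1(3)[of "x v0 t" y z] that by (auto simp: K0_def dist_norm norm_minus_commute)
    moreover have "norm (G' (x v0 t) (y - z)) \<le> K * norm (y - z)"
      using norm_blinfun[of "A t" "y - z"] K(2)[OF that(1)] A[OF that(1)]
      by (metis mult_right_mono norm_ge_zero order_trans)
    ultimately show ?thesis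
      using norm_triangle_ineq[of "G y - G z - G' (x v0 t) (y - z)" "G' (x v0 t) (y - z)"]
      by (simp add: B_def algebra_simps)
  qed
  define C where "C = exp (B * (b - a))"
  have C: "C \<ge> 1" using B ab by (simp add: C_def)
  \<comment> \<open>Gronwall without forcing term, valid as long as both solutions stay in the
    tube.\<close>
  have lipx: "norm (x v t - x u t) \<le> norm (x v a - x u a) * C"
    if t: "t \<in> {a..b}" and st: "\<And>s. s \<in> {a..t} \<Longrightarrow> In v s \<and> In u s \<and> norm (x v s - x v0 s) < d1 \<and> norm (x u s - x v0 s) < d1" for v u t
  proof -
    have "norm (x v t - x u t) \<le> (norm (x v a - x u a) + 0 * (t - a)) * exp (B * (t - a))"
    proof (rule gronwall[where D = "\<lambda>t. x v t - x u t" and D' = "\<lambda>t. G (x v t) - G (x u t)" and b = t])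
      fix s assume s: "s \<in> {a..t}"
      then have s': "s \<in> {a..b}" using t by auto
      have sub: "{a..t} \<subseteq> {a..b}" using t by auto
      show "((\<lambda>t. x v t - x u t) has_vector_derivative G (x v s) - G (x u s)) (at s within {a..t})"
        using sol[OF s', of v] sol[OF s', of u] st[OF s]
        by (intro has_vector_derivative_diff) (blast intro: has_vector_derivative_within_subset[OF _ sub])+
      show "norm (G (x v s) - G (x u s)) \<le> B * norm (x v s - x u s) + 0"
        using lipG[OF s'] st[OF s] by simp
    qed (use t B in auto)
    also have "\<dots> \<le> norm (x v a - x u a) * C"
      unfolding C_def using t B by (auto intro!: mult_left_mono)
    finally show ?thesis .
  qed
  \<comment> \<open>A bootstrap: as long as the distance to the reference solution is below
    \<open>d\<close>, Gronwall improves it to \<open>d / 2\<close>, a bound that survives the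
    passage to the limit. The closed \<open>d / 2\<close>-neighbourhood of the trajectory is the
    compact set to which \<open>cls\<close> is applied.\<close>
  have stay: "\<forall>t\<in>{a..b}. In v t \<and> norm (x v t - x v0 t) < d"
    if d: "0 < d" "d \<le> d1" and v: "In v a" "norm (x v a - x v0 a) * C < d / 2" for v d
  proof (induction rule: real_interval_induct[OF ab])
    case 1
    have "norm (x v a - x v0 a) * 1 \<le> norm (x v a - x v0 a) * C" using C by (intro mult_left_mono) auto
    then show ?case using v d by simp
  next
    case (2 t)
    have t: "t \<in> {a..b}" and Inv: "In v t" "norm (x v t - x v0 t) < d" using 2 by auto
    obtain e where e: "e > 0" "\<forall>s\<in>{a..b}. \<bar>s - t\<bar> < e \<longrightarrow> In v s" using opn[OF t Inv(1)] by blast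
    have "continuous (at t within {a..b}) (\<lambda>s. norm (x v s - x v0 s))"
      by (intro continuous_intros cont t Inv In0)
    then have "\<forall>\<^sub>F s in at t within {a..b}. norm (x v s - x v0 s) < d"
      using Inv(2) by (simp add: continuous_within order_tendsto_iff)
    then obtain r where r: "r > 0" "\<forall>s\<in>{a..b}. s \<noteq> t \<and> dist s t < r \<longrightarrow> norm (x v s - x v0 s) < d"
      unfolding eventually_at by blast
    show ?case
      by (rule exI[of _ "t + min e r / 2"]) (use e r 2 in \<open>auto simp: dist_real_def\<close>)
  next
    case (3 t)
    have t: "t \<in> {a..b}" using 3 by auto
    have ind: "In v s \<and> norm (x v s - x v0 s) < d1" if "a \<le> s" "s < t" for s
      using 3(3)[OF that] d by simp
    have half: "norm (x v s - x v0 s) < d / 2" if "a \<le> s" "s < t" for s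
    proof -
      have "norm (x v s - x v0 s) \<le> norm (x v a - x v0 a) * C"
        by (rule lipx) (use that 3(1,2) ind In0 d in auto)
      then show ?thesis using v by simp
    qed
    define K1 where "K1 = {k + z | k z. k \<in> K0 \<and> z \<in> cball 0 (d/2)}"
    have "compact K1" unfolding K1_def by (rule compact_sums[OF K0(1)]) simp
    moreover have "K1 \<subseteq> \<Omega>"
    proof
      fix y assume "y \<in> K1"
      then obtain k z where "k \<in> K0" "y = k + z" "norm z \<le> d / 2" by (auto simp: K1_def)
      then show "y \<in> \<Omega>" using d1(2)[of k] d by (auto simp: dist_norm)
    qed
    moreover have "In v s \<and> x v s \<in> K1" if "a \<le> s" "s < t" for s
    proof -
      have "x v s = x v0 s + (x v s - x v0 s)" by simp
      moreover have "x v0 s \<in> K0" using that t by (auto simp: K0_def)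
      moreover have "x v s - x v0 s \<in> cball 0 (d/2)" using half[OF that] by simp
      ultimately have "x v s \<in> K1" unfolding K1_def by blast
      then show ?thesis using 3 that by blast
    qed
    ultimately have Inv: "In v t" by (rule cls[OF 3(1,2)])
    have "continuous (at t within {a..b}) (\<lambda>s. norm (x v s - x v0 s))"
      by (intro continuous_intros cont t Inv In0)
    then have "((\<lambda>s. norm (x v s - x v0 s)) \<longlongrightarrow> norm (x v t - x v0 t)) (at t within {a..b})"
      by (simp add: continuous_within)
    then have "((\<lambda>s. norm (x v s - x v0 s)) \<longlongrightarrow> norm (x v t - x v0 t)) (at t within {a..<t})"
      by (rule tendsto_within_subset) (use t in auto)
    moreover have "at t within {a..<t} \<noteq> bot"
      using 3(1) by (simp add: trivial_limit_within islimpt_Ico)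
    moreover have "\<forall>\<^sub>F s in at t within {a..<t}. norm (x v s - x v0 s) \<le> d / 2"
      using half by (auto simp: eventually_at_filter less_imp_le intro!: always_eventually)
    ultimately have "norm (x v t - x v0 t) \<le> d / 2" using tendsto_upperbound by blast
    then show ?case using Inv d by simp
  qed
  have near: "\<forall>\<^sub>F v in nhds v0. \<forall>t\<in>{a..b}. In v t \<and> norm (x v t - x v0 t) < d" if d: "0 < d" "d \<le> d1" for d
  proof -
    have "((\<lambda>v. x v a) \<longlongrightarrow> x v0 a) (nhds v0)"
      using strict_deriv_isCont[OF init] tendsto_at_iff_tendsto_nhds[of "\<lambda>v. x v a" v0]
      by (simp add: isCont_def)
    then have "((\<lambda>v. norm (x v a - x v0 a) * C) \<longlongrightarrow> norm (x v0 a - x v0 a) * C) (nhds v0)"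
      by (intro tendsto_intros)
    then have "\<forall>\<^sub>F v in nhds v0. norm (x v a - x v0 a) * C < d / 2"
      by (rule order_tendstoD) (use d in simp)
    with In_a show ?thesis by eventually_elim (rule stay[OF d])
  qed
  \<comment> \<open>\<open>M\<close> solves the equation linearised along the reference solution.
    The derivative of the solution in the parameter is \<open>M t\<close> after
    \<open>L\<close>.\<close>
  obtain M where M: "M a = id_blinfun"
    "\<And>t. t \<in> {a..b} \<Longrightarrow> (M has_vector_derivative A t o\<^sub>L M t) (at t within {a..b})"
    using linear_ode_solution[OF ab contA] by blast
  have M': "((\<lambda>t. M t \<xi>) has_vector_derivative G' (x v0 t) (M t \<xi>)) (at t within {a..b})"
    if "t \<in> {a..b}" for t \<xi>
    using bounded_linear.has_vector_derivative[OF bounded_linear_blinfun_apply M(2)[OF that]]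
      A[OF that] bounded_linear.has_vector_derivative[OF blinfun.bounded_linear_left M(2)[OF that], of \<xi>]
    by simp
  have blL: "bounded_linear L" using init by (rule strict_deriv_bounded_linear)
  have strict: "strict_deriv (\<lambda>v. x v t) (\<lambda>\<xi>. M t (L \<xi>)) v0" if t: "t \<in> {a..b}" for t
    unfolding strict_deriv_def
  proof (intro conjI allI impI)
    show "bounded_linear (\<lambda>\<xi>. blinfun_apply (M t) (L \<xi>))"
      by (rule bounded_linear_compose[OF blinfun.bounded_linear_right blL])
    fix e :: real assume e: "e > 0"
    obtain C1 r1 where C1: "C1 > 0" "r1 > 0"
      "\<And>v u. v \<in> ball v0 r1 \<Longrightarrow> u \<in> ball v0 r1 \<Longrightarrow> norm (x v a - x u a) \<le> C1 * norm (v - u)"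
      using strict_deriv_lipschitz[OF init] by blast
    define e1 where "e1 = e / (2 * (norm (M t) + 1))"
    have e1: "e1 > 0" "norm (M t) * e1 \<le> e / 2"
      using e by (auto simp: e1_def field_simps add_pos_nonneg)
    obtain r2 where r2: "r2 > 0"
      "\<And>v u. v \<in> ball v0 r2 \<Longrightarrow> u \<in> ball v0 r2 \<Longrightarrow> norm (x v a - x u a - L (v - u)) \<le> e1 * norm (v - u)"
      using strict_derivD[OF init e1(1)] by blast
    \<comment> \<open>The factors of the final estimate: \<open>C1\<close> is the Lipschitz constant
      of the initial value in the parameter, one \<open>C\<close> comes from \<open>lipx\<close>,
      the other from Gronwall applied to \<open>z\<close>, and \<open>b - a\<close> from the forcing
      term.\<close>
    define Q where "Q = C1 * C * C * (b - a)"
    have Q: "Q \<ge> 0" using C C1 ab by (simp add: Q_def)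
    define h where "h = e / (2 * (Q + 1))"
    have h: "h > 0" "h * Q \<le> e / 2" using e Q by (auto simp: h_def field_simps)
    obtain d2 where d2: "d2 > 0"
      "\<And>k y z. k \<in> K0 \<Longrightarrow> y \<in> ball k d2 \<Longrightarrow> z \<in> ball k d2 \<Longrightarrow>
        norm (G y - G z - G' k (y - z)) \<le> h * norm (y - z)"
      using C1_on_tube[OF G open_\<Omega> K0 h(1)] by blast
    define d where "d = min d1 d2"
    have d: "0 < d" "d \<le> d1" "d \<le> d2" using d1 d2 by (auto simp: d_def)
    obtain r3 where r3: "r3 > 0"
      "\<And>v s. dist v v0 < r3 \<Longrightarrow> s \<in> {a..b} \<Longrightarrow> In v s \<and> norm (x v s - x v0 s) < d"
      using near[OF d(1,2)] unfolding eventually_nhds_metric by blast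
    define r where "r = min r1 (min r2 r3)"
    show "\<exists>d>0. \<forall>y\<in>ball v0 d. \<forall>z\<in>ball v0 d. norm (x y t - x z t - M t (L (y - z))) \<le> e * norm (y - z)"
    proof (intro exI[of _ r] conjI ballI)
      show "r > 0" using C1 r2 r3 by (simp add: r_def)
      fix v u assume v: "v \<in> ball v0 r" and u: "u \<in> ball v0 r"
      have vs: "In v s" "norm (x v s - x v0 s) < d" and us: "In u s" "norm (x u s - x v0 s) < d"
        if "s \<in> {a..b}" for s
        using r3(2)[OF _ that, of v] r3(2)[OF _ that, of u] v u by (auto simp: r_def dist_commute)
      define E where "E = h * (norm (x v a - x u a) * C)"
      have E: "E \<ge> 0" using h C by (simp add: E_def)
      \<comment> \<open>The difference of the two solutions minus the linear evolution of their
        initial difference. It vanishes at \<open>a\<close> and solves the linearised equation up to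
        an error bounded by \<open>E\<close>, which is \<open>h\<close> times a multiple of the
        initial difference.\<close>
      define z where "z s = x v s - x u s - M s (x v a - x u a)" for s
      have za: "z a = 0" by (simp add: z_def M)
      have "norm (z t) \<le> (norm (z a) + E * (b - a)) * exp (B * (b - a))"
      proof (rule gronwall[where D' = "\<lambda>s. G (x v s) - G (x u s) - G' (x v0 s) (M s (x v a - x u a))"])
        fix s assume s: "s \<in> {a..b}"
        show "(z has_vector_derivative G (x v s) - G (x u s) - G' (x v0 s) (M s (x v a - x u a))) (at s within {a..b})"
          unfolding z_def
          using sol[OF s vs(1)[OF s]] sol[OF s us(1)[OF s]] M'[OF s]
          by (intro has_vector_derivative_diff) auto
        have eq: "G (x v s) - G (x u s) - G' (x v0 s) (M s (x v a - x u a)) =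
          (G (x v s) - G (x u s) - G' (x v0 s) (x v s - x u s)) + A s (z s)"
          unfolding z_def A[OF s]
          by (simp add: linear_diff[OF bounded_linear.linear[OF bl[OF s]]])
        have "norm (G (x v s) - G (x u s) - G' (x v0 s) (x v s - x u s)) \<le> h * norm (x v s - x u s)"
          using vs(2)[OF s] us(2)[OF s] d(3) s
          by (intro d2(2)) (auto simp: K0_def dist_norm norm_minus_commute)
        also have "\<dots> \<le> h * (norm (x v a - x u a) * C)"
        proof (intro mult_left_mono lipx s)
          fix q assume "q \<in> {a..s}"
          then have "q \<in> {a..b}" using s by auto
          then show "In v q \<and> In u q \<and> norm (x v q - x v0 q) < d1 \<and> norm (x u q - x v0 q) < d1"
            using vs[of q] us[of q] d by auto
        qed (use h in auto)
        finally have "norm (G (x v s) - G (x u s) - G' (x v0 s) (x v s - x u s)) \<le> E" by (simp add: E_def)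
        moreover have "norm (A s (z s)) \<le> B * norm (z s)"
          using norm_blinfun[of "A s" "z s"] K(2)[OF s] mult_right_mono[of "norm (A s)" B "norm (z s)"]
          by (simp add: B_def)
        ultimately show "norm (G (x v s) - G (x u s) - G' (x v0 s) (M s (x v a - x u a))) \<le> B * norm (z s) + E"
          unfolding eq by (rule order_trans[OF norm_triangle_ineq, OF order_trans[OF add_mono]]) simp
      qed (use ab B E t in auto)
      then have "norm (z t) \<le> h * (norm (x v a - x u a) * C * C * (b - a))"
        by (simp add: za E_def C_def mult_ac)
      also have "\<dots> \<le> h * (C1 * norm (v - u) * C * C * (b - a))"
        using C1(3)[of v u] v u h C ab by (intro mult_left_mono mult_right_mono) (auto simp: r_def)
      also have "\<dots> = (h * Q) * norm (v - u)" by (simp add: Q_def mult_ac)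
      also have "\<dots> \<le> e / 2 * norm (v - u)" using h by (intro mult_right_mono) auto
      finally have 1: "norm (z t) \<le> e / 2 * norm (v - u)" .
      have "norm (x v a - x u a - L (v - u)) \<le> e1 * norm (v - u)"
        by (rule r2(2)) (use v u in \<open>auto simp: r_def\<close>)
      then have "norm (M t (x v a - x u a - L (v - u))) \<le> norm (M t) * (e1 * norm (v - u))"
        by (intro order_trans[OF norm_blinfun] mult_left_mono) auto
      also have "\<dots> \<le> e / 2 * norm (v - u)"
        using mult_right_mono[OF e1(2), of "norm (v - u)"] by (simp add: mult.assoc)
      finally have 2: "norm (M t (x v a - x u a - L (v - u))) \<le> e / 2 * norm (v - u)" .
      have "x v t - x u t - M t (L (v - u)) = z t + M t (x v a - x u a - L (v - u))"
        by (simp add: z_def blinfun.diff_right)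
      then show "norm (x v t - x u t - M t (L (v - u))) \<le> e * norm (v - u)"
        using norm_triangle_ineq[of "z t" "M t (x v a - x u a - L (v - u))"] 1 2 by simp
    qed
  qed
  show ?thesis
  proof (intro exI[of _ "\<lambda>t \<xi>. M t (L \<xi>)"] conjI ballI allI)
    show "(\<lambda>\<xi>. blinfun_apply (M a) (L \<xi>)) = L" by (simp add: M)
    fix t assume t: "t \<in> {a..b}"
    show "\<forall>\<^sub>F v in nhds v0. In v t"
      using near[OF d1(1) order_refl] by eventually_elim (use t in blast)
    show "strict_deriv (\<lambda>v. x v t) (\<lambda>\<xi>. M t (L \<xi>)) v0" by (rule strict[OF t])
    show "((\<lambda>t. M t (L \<xi>)) has_vector_derivative G' (x v0 t) (M t (L \<xi>))) (at t within {a..b})" for \<xi>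
      by (rule M'[OF t])
  qed
qed

section \<open>Continuously differentiable maps\<close>

lemma C1_on_add:
  "C1_on f f' S \<Longrightarrow> C1_on g g' S \<Longrightarrow> C1_on (\<lambda>x. f x + g x) (\<lambda>x v. f' x v + g' x v) S"
  by (auto simp: C1_on_def intro!: has_derivative_add continuous_intros)

lemma C1_on_diff:
  "C1_on f f' S \<Longrightarrow> C1_on g g' S \<Longrightarrow> C1_on (\<lambda>x. f x - g x) (\<lambda>x v. f' x v - g' x v) S"
  by (auto simp: C1_on_def intro!: has_derivative_diff continuous_intros)

lemma C1_on_sum:
  "(\<And>i. i \<in> I \<Longrightarrow> C1_on (f i) (f' i) S) \<Longrightarrow>
   C1_on (\<lambda>x. \<Sum>i\<in>I. f i x) (\<lambda>x v. \<Sum>i\<in>I. f' i x v) S"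
  by (auto simp: C1_on_def intro!: has_derivative_sum continuous_intros)

lemma C1_on_scaleR_left: "C1_on f f' S \<Longrightarrow> C1_on (\<lambda>x. f x *\<^sub>R c) (\<lambda>x v. f' x v *\<^sub>R c) S"
  by (auto simp: C1_on_def intro!: has_derivative_scaleR_left continuous_intros)

lemma C1_on_divide: "C1_on f f' S \<Longrightarrow> C1_on (\<lambda>x. f x / c) (\<lambda>x v. f' x v / c) S"
  for f :: "'a::real_normed_vector \<Rightarrow> real"
  unfolding divide_inverse
  by (auto simp: C1_on_def intro!: has_derivative_mult_left continuous_intros)

lemma C1_on_continuous_on: "C1_on f f' S \<Longrightarrow> continuous_on S f"
  by (meson C1_on_def continuous_at_imp_continuous_on has_derivative_continuous)

lemma Ck_on_C1_on:
  assumes "Ck_on (Suc 0) f S" "open S"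
  shows "C1_on f (\<lambda>x. frechet_derivative f (at x)) S"
proof -
  have "f differentiable at x" if "x \<in> S" for x
    using assms that by (simp add: differentiable_on_eq_differentiable_at)
  then show ?thesis
    using assms by (auto simp: C1_on_def frechet_derivative_works)
qed

lemma smooth_on_C1_on:
  assumes "smooth_on f S" "open S"
  shows "C1_on f (\<lambda>x. frechet_derivative f (at x)) S"
  using assms Ck_on_C1_on unfolding smooth_on_def by blast

lemma smooth_on_C1_on_deriv:
  assumes "smooth_on f S" "open S"
  shows "C1_on (\<lambda>x. frechet_derivative f (at x) v)
    (\<lambda>x. frechet_derivative (\<lambda>x. frechet_derivative f (at x) v) (at x)) S"
proof -
  have "Ck_on (Suc (Suc 0)) f S" using assms unfolding smooth_on_def by blast
  then have "Ck_on (Suc 0) (\<lambda>x. frechet_derivative f (at x) v) S" unfolding Ck_on.simps(2)[of "Suc 0"] by blast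
  then show ?thesis using Ck_on_C1_on assms by blast
qed

text \<open>A product rule in which one factor is merely continuous: since \<open>f\<close> vanishes
  at \<open>x\<close>, the term with \<open>g y - g x\<close> is of smaller order than
  \<open>y - x\<close>. It serves for coefficients of a solution whose differentiability is still to
  be shown.\<close>

lemma has_derivative_scaleR_vanishing:
  fixes g :: "'a::real_normed_vector \<Rightarrow> real"
  assumes f: "(f has_derivative f') (at x)" and "f x = 0" and g: "isCont g x"
  shows "((\<lambda>y. g y *\<^sub>R f y) has_derivative (\<lambda>h. g x *\<^sub>R f' h)) (at x)"
proof -
  have "((\<lambda>y. (g y - g x) *\<^sub>R f y) has_derivative (\<lambda>h. 0)) (at x)"
    unfolding has_derivative_at_alt
  proof (intro conjI allI impI)
    fix e :: real assume e: "e > 0"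
    obtain K where K: "K > 0" "\<And>v. norm (f' v) \<le> norm v * K"
      using bounded_linear.pos_bounded[OF has_derivative_bounded_linear[OF f]] by blast
    obtain d1 where d1: "d1 > 0" "\<And>y. norm (y - x) < d1 \<Longrightarrow> norm (f y - f x - f' (y - x)) \<le> 1 * norm (y - x)"
      using f zero_less_one unfolding has_derivative_at_alt by blast
    have "e / (K + 1) > 0" using e K by simp
    then obtain d2 where d2: "d2 > 0" "\<And>y. dist y x < d2 \<Longrightarrow> dist (g y) (g x) < e / (K + 1)"
      using g unfolding continuous_at_eps_delta by blast
    show "\<exists>d>0. \<forall>y. norm (y - x) < d \<longrightarrow>
      norm ((g y - g x) *\<^sub>R f y - (g x - g x) *\<^sub>R f x - 0) \<le> e * norm (y - x)"
    proof (intro exI[of _ "min d1 d2"] conjI allI impI)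
      fix y assume y: "norm (y - x) < min d1 d2"
      have "norm (f y) \<le> norm (f y - f x - f' (y - x)) + norm (f' (y - x))"
        using norm_triangle_ineq[of "f y - f x - f' (y - x)" "f' (y - x)"] assms by simp
      also have "\<dots> \<le> (K + 1) * norm (y - x)"
        using d1(2)[of y] y K(2)[of "y - x"] by (simp add: algebra_simps)
      finally have "norm (f y) \<le> (K + 1) * norm (y - x)" .
      moreover have "\<bar>g y - g x\<bar> \<le> e / (K + 1)"
        using d2(2)[of y] y by (simp add: dist_norm)
      ultimately have "\<bar>g y - g x\<bar> * norm (f y) \<le> e / (K + 1) * ((K + 1) * norm (y - x))"
        using e K by (intro mult_mono) auto
      then show "norm ((g y - g x) *\<^sub>R f y - (g x - g x) *\<^sub>R f x - 0) \<le> e * norm (y - x)"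
        using K by simp
    qed (use d1 d2 in simp)
  qed simp
  moreover have "((\<lambda>y. g x *\<^sub>R f y) has_derivative (\<lambda>h. g x *\<^sub>R f' h)) (at x)"
    by (rule has_derivative_scaleR_right[OF f])
  ultimately have "((\<lambda>y. (g y - g x) *\<^sub>R f y + g x *\<^sub>R f y) has_derivative (\<lambda>h. 0 + g x *\<^sub>R f' h)) (at x)"
    by (rule has_derivative_add)
  then show ?thesis by (simp flip: scaleR_add_left)
qed

section \<open>Positive definite bilinear forms\<close>

lemma bilinear_expand:
  fixes B :: "'e::euclidean_space \<Rightarrow> 'e \<Rightarrow> 'c::real_vector"
  assumes "bilinear B"
  shows "B u v = (\<Sum>i\<in>Basis. \<Sum>j\<in>Basis. ((u \<bullet> i) * (v \<bullet> j)) *\<^sub>R B i j)"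
proof -
  have "B u v = B (\<Sum>i\<in>Basis. (u \<bullet> i) *\<^sub>R i) (\<Sum>j\<in>Basis. (v \<bullet> j) *\<^sub>R j)"
    by (simp add: euclidean_representation)
  also have "\<dots> = (\<Sum>i\<in>Basis. \<Sum>j\<in>Basis. B ((u \<bullet> i) *\<^sub>R i) ((v \<bullet> j) *\<^sub>R j))"
    by (simp add: bilinear_sum[OF assms] sum.cartesian_product)
  finally show ?thesis
    by (simp add: bilinear_lmul[OF assms] bilinear_rmul[OF assms] mult.commute)
qed

text \<open>The vector that represents \<open>B u\<close> in the inner product of the type. The
  condition \<open>B w z = k z\<close> for all \<open>z\<close> thereby becomes a linear system for
  \<open>w\<close>.\<close>

definition gram :: "('e::euclidean_space \<Rightarrow> 'e \<Rightarrow> real) \<Rightarrow> 'e \<Rightarrow> 'e" where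
  "gram B u = (\<Sum>b\<in>Basis. B u b *\<^sub>R b)"

lemma inner_gram:
  assumes "bilinear B"
  shows "gram B u \<bullet> z = B u z"
proof -
  have lin: "linear (B u)" using assms by (simp add: bilinear_def)
  have "B u z = B u (\<Sum>b\<in>Basis. (z \<bullet> b) *\<^sub>R b)" by (simp add: euclidean_representation)
  also have "\<dots> = (\<Sum>b\<in>Basis. (z \<bullet> b) * B u b)"
    by (simp add: linear_sum[OF lin] linear_scale[OF lin])
  finally show ?thesis
    by (simp add: gram_def inner_sum_left inner_commute[of z] mult.commute)
qed

lemma linear_gram: assumes "bilinear B" shows "linear (gram B)"
  unfolding gram_def using assms
  by (intro linearI) (simp_all add: bilinear_ladd bilinear_lmul scaleR_add_left sum.distrib scaleR_sum_right)

lemma inj_gram: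
  assumes B: "bilinear B" and pos: "\<And>u. u \<noteq> 0 \<Longrightarrow> B u u > 0"
  shows "inj (gram B)"
proof -
  have "u = 0" if "gram B u = 0" for u
    using inner_gram[OF B, of u u] pos[of u] that by fastforce
  then show ?thesis using linear_injective_0[OF linear_gram[OF B]] by blast
qed

lemma gram_inverse:
  assumes B: "bilinear B" and pos: "\<And>u. u \<noteq> 0 \<Longrightarrow> B u u > 0"
  obtains P where "linear P" "\<And>v. P (gram B v) = v" "\<And>v. gram B (P v) = v"
proof -
  from linear_injective_isomorphism[OF linear_gram[OF B] inj_gram[OF B pos]]
  obtain P where "linear P" "\<forall>v. P (gram B v) = v" "\<forall>v. gram B (P v) = v" by blast
  then show thesis using that by blast
qed

text \<open>Makes the definite description in \<open>christoffel\<close> meaningful.\<close>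

lemma riesz_bilinear:
  fixes B :: "'e::euclidean_space \<Rightarrow> 'e \<Rightarrow> real"
  assumes B: "bilinear B" and pos: "\<And>u. u \<noteq> 0 \<Longrightarrow> B u u > 0" and k: "linear k"
  shows "\<exists>!w. \<forall>z. B w z = k z"
proof -
  from gram_inverse[of B, OF B pos] obtain P where P: "linear P" "\<And>v. P (gram B v) = v" "\<And>v. gram B (P v) = v"
    by metis
  define \<kappa> where "\<kappa> = (\<Sum>b\<in>Basis. k b *\<^sub>R b)"
  have \<kappa>: "\<kappa> \<bullet> z = k z" for z
  proof -
    have "k z = k (\<Sum>b\<in>Basis. (z \<bullet> b) *\<^sub>R b)" by (simp add: euclidean_representation)
    also have "\<dots> = (\<Sum>b\<in>Basis. (z \<bullet> b) * k b)" by (simp add: linear_sum[OF k] linear_scale[OF k])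
    finally show ?thesis by (simp add: \<kappa>_def inner_sum_left inner_commute[of z] mult.commute)
  qed
  show ?thesis
  proof
    show "\<forall>z. B (P \<kappa>) z = k z" using inner_gram[OF B, of "P \<kappa>"] P \<kappa> by simp
    fix w assume "\<forall>z. B w z = k z"
    then have "gram B w \<bullet> z = \<kappa> \<bullet> z" for z using inner_gram[OF B] \<kappa> by simp
    then have "gram B w = \<kappa>" using vector_eq_rdot by blast
    then show "w = P \<kappa>" using P by metis
  qed
qed

section \<open>Solutions of positive definite linear systems that depend on a point\<close>

locale posdef_family =
  fixes B :: "'a::euclidean_space \<Rightarrow> 'e::euclidean_space \<Rightarrow> 'e \<Rightarrow> real" and S :: "'a set"
  assumes open_S: "open S" and bil: "\<And>y. y \<in> S \<Longrightarrow> bilinear (B y)"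
    and pos: "\<And>y u. y \<in> S \<Longrightarrow> u \<noteq> 0 \<Longrightarrow> B y u u > 0"
begin

text \<open>Only the inverse \<open>P\<close> at the fixed point \<open>x\<close> is used:
  \<open>P\<close> applied to the difference of the two systems gives \<open>w y - w x\<close>. On
  the right \<open>norm (w y - w x)\<close> reappears with a factor that is at most 1/2 near
  \<open>x\<close>, and is absorbed.\<close>

lemma solution_continuous:
  assumes contB: "\<And>u v. continuous_on S (\<lambda>y. B y u v)"
    and contk: "continuous_on S k" and w: "\<And>y. y \<in> S \<Longrightarrow> gram (B y) (w y) = k y"
  shows "continuous_on S w"
  unfolding continuous_on_eq_continuous_at[OF open_S]
proof
  fix x assume x: "x \<in> S"
  obtain P where P: "linear P" "\<And>v. P (gram (B x) v) = v" "\<And>v. gram (B x) (P v) = v"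
    using gram_inverse[OF bil[OF x] pos[OF x]] by metis
  have "bounded_linear P" using P(1) by (simp add: linear_conv_bounded_linear)
  then obtain C where C: "C > 0" "\<And>v. norm (P v) \<le> norm v * C" using bounded_linear.pos_bounded by blast
  define \<epsilon> where "\<epsilon> y = (\<Sum>b\<in>Basis. norm (gram (B y) b - gram (B x) b))" for y
  have "continuous_on S (\<lambda>y. gram (B y) b)" for b
    unfolding gram_def by (intro continuous_intros contB)
  then have "continuous_on S \<epsilon>" unfolding \<epsilon>_def by (intro continuous_intros)
  then have "isCont \<epsilon> x" using x open_S by (simp add: continuous_on_eq_continuous_at)
  then have \<epsilon>0: "\<epsilon> \<midarrow>x\<rightarrow> 0" by (simp add: isCont_def \<epsilon>_def)
  have "isCont k x" using contk x open_S by (simp add: continuous_on_eq_continuous_at)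
  then have k0: "(\<lambda>y. norm (k y - k x)) \<midarrow>x\<rightarrow> 0"
    unfolding isCont_def by (intro tendsto_norm_zero) (simp add: LIM_zero)
  have "((\<lambda>y. 2 * C * (norm (k y - k x) + \<epsilon> y * norm (w x))) \<longlongrightarrow> 2 * C * (0 + 0 * norm (w x))) (at x)"
    by (intro tendsto_intros k0 \<epsilon>0)
  then have lim: "((\<lambda>y. 2 * C * (norm (k y - k x) + \<epsilon> y * norm (w x))) \<longlongrightarrow> 0) (at x)" by simp
  have "\<forall>\<^sub>F y in at x. \<epsilon> y < 1 / (2 * C)" using order_tendstoD(2)[OF \<epsilon>0] C by simp
  moreover have "\<forall>\<^sub>F y in at x. y \<in> S"
    using open_S x by (simp add: eventually_at_topological) blast
  ultimately have "\<forall>\<^sub>F y in at x. norm (w y - w x) \<le> 2 * C * (norm (k y - k x) + \<epsilon> y * norm (w x))"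
  proof eventually_elim
    case (elim y)
    have lin: "linear (\<lambda>u. gram (B y) u - gram (B x) u)"
      using elim x by (intro linear_compose_sub linear_gram bil)
    have b: "norm (gram (B y) u - gram (B x) u) \<le> \<epsilon> y * norm u" for u
      using bounded_linear_le_Basis[OF lin] by (simp add: \<epsilon>_def)
    have eq: "w y - w x = P (k y - k x - (gram (B y) (w y) - gram (B x) (w y)))"
      using w[OF x] w[OF elim(2)] P(2)
      by (simp add: linear_diff[OF P(1)]) (metis P(2))
    have "norm (w y - w x) \<le> norm (k y - k x - (gram (B y) (w y) - gram (B x) (w y))) * C"
      unfolding eq by (rule C)
    also have "\<dots> \<le> (norm (k y - k x) + \<epsilon> y * norm (w y)) * C"
      using C b[of "w y"] norm_triangle_ineq4[of "k y - k x" "gram (B y) (w y) - gram (B x) (w y)"]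
      by (intro mult_right_mono) auto
    also have "\<dots> \<le> (norm (k y - k x) + \<epsilon> y * (norm (w x) + norm (w y - w x))) * C"
      using C norm_triangle_ineq[of "w x" "w y - w x"]
      by (intro mult_right_mono add_left_mono mult_left_mono) (auto simp: \<epsilon>_def sum_nonneg)
    finally have "norm (w y - w x) \<le> (norm (k y - k x) + \<epsilon> y * norm (w x)) * C + (C * \<epsilon> y) * norm (w y - w x)"
      by (simp add: algebra_simps)
    moreover have "(C * \<epsilon> y) * norm (w y - w x) \<le> 1 / 2 * norm (w y - w x)"
      using elim(1) C by (intro mult_right_mono) (auto simp: field_simps)
    ultimately show ?case by (simp add: algebra_simps)
  qed
  then have "((\<lambda>y. norm (w y - w x)) \<longlongrightarrow> 0) (at x)"
    by (intro tendsto_sandwich[OF _ _ tendsto_const lim]) auto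
  then show "isCont w x"
    unfolding isCont_def by (intro LIM_zero_cancel[where f = w]) (rule tendsto_norm_zero_cancel)
qed

text \<open>The inverse matrix is not differentiated. With the inverse \<open>P x\<close> frozen at
  \<open>x\<close>, the solution \<open>w y\<close> is \<open>P x\<close> applied to
  \<open>k y\<close> minus a sum of terms \<open>gram (B y) i - gram (B x) i\<close> with
  coefficients \<open>w y \<bullet> i\<close>. These terms vanish at \<open>x\<close>, so continuity
  of \<open>w\<close> is enough to differentiate.\<close>

lemma solution_C1:
  assumes C1B: "\<And>u v. \<exists>B'. C1_on (\<lambda>y. B y u v) B' S"
    and C1k: "C1_on k k' S" and w: "\<And>y. y \<in> S \<Longrightarrow> gram (B y) (w y) = k y"
  shows "\<exists>w'. C1_on w w' S"
proof -
  obtain B' where B': "\<And>u v. C1_on (\<lambda>y. B y u v) (B' u v) S" using C1B by metis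
  define T' where "T' u y h = (\<Sum>b\<in>Basis. B' u b y h *\<^sub>R b)" for u y h
  have C1T: "C1_on (\<lambda>y. gram (B y) u) (T' u) S" for u
    unfolding gram_def T'_def by (intro C1_on_sum C1_on_scaleR_left B')
  have contw: "continuous_on S w"
    by (rule solution_continuous[OF _ C1_on_continuous_on[OF C1k] w]) (auto intro: C1_on_continuous_on B')
  \<comment> \<open>Right-hand side of the differentiated system: \<open>gram (B y)\<close> applied
    to the derivative of \<open>w\<close> equals \<open>k'\<close> minus the derivative of the
    matrix applied to \<open>w\<close>.\<close>
  define r where "r y h = k' y h - (\<Sum>i\<in>Basis. (w y \<bullet> i) *\<^sub>R T' i y h)" for y h
  have "\<exists>P. linear P \<and> (\<forall>v. P (gram (B y) v) = v) \<and> (\<forall>v. gram (B y) (P v) = v)" if "y \<in> S" for y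
    using gram_inverse[OF bil[OF that] pos[OF that]] by metis
  then obtain P where P: "\<And>y. y \<in> S \<Longrightarrow> linear (P y)" "\<And>y v. y \<in> S \<Longrightarrow> P y (gram (B y) v) = v"
    "\<And>y v. y \<in> S \<Longrightarrow> gram (B y) (P y v) = v" by metis
  have "(w has_derivative (\<lambda>h. P x (r x h))) (at x)" if x: "x \<in> S" for x
  proof -
    have wx: "isCont w x" using contw x open_S by (simp add: continuous_on_eq_continuous_at)
    have "((\<lambda>y. (w y \<bullet> i) *\<^sub>R (gram (B y) i - gram (B x) i)) has_derivative (\<lambda>h. (w x \<bullet> i) *\<^sub>R T' i x h)) (at x)" for i
    proof (rule has_derivative_scaleR_vanishing)
      show "((\<lambda>y. gram (B y) i - gram (B x) i) has_derivative T' i x) (at x)"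
        using has_derivative_diff[OF C1_on_has_derivative[OF C1T x] has_derivative_const] by simp
    qed (use wx in \<open>auto intro!: continuous_intros\<close>)
    then have d: "((\<lambda>y. k y - (\<Sum>i\<in>Basis. (w y \<bullet> i) *\<^sub>R (gram (B y) i - gram (B x) i))) has_derivative r x) (at x)"
      unfolding r_def by (intro has_derivative_diff has_derivative_sum C1_on_has_derivative[OF C1k x])
    have blP: "bounded_linear (P x)" using P(1)[OF x] by (simp add: linear_conv_bounded_linear)
    have "((\<lambda>y. P x (k y - (\<Sum>i\<in>Basis. (w y \<bullet> i) *\<^sub>R (gram (B y) i - gram (B x) i)))) has_derivative (\<lambda>h. P x (r x h))) (at x)"
      by (rule bounded_linear.has_derivative[OF blP d])
    then show ?thesis
    proof (rule has_derivative_transform_within_open[OF _ open_S x])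
      fix y assume y: "y \<in> S"
      have rep: "gram (B z) (w y) = (\<Sum>i\<in>Basis. (w y \<bullet> i) *\<^sub>R gram (B z) i)" if "z \<in> S" for z
      proof -
        have "gram (B z) (w y) = gram (B z) (\<Sum>i\<in>Basis. (w y \<bullet> i) *\<^sub>R i)" by (simp add: euclidean_representation)
        then show ?thesis
          by (simp add: linear_sum[OF linear_gram[OF bil[OF that]]] linear_scale[OF linear_gram[OF bil[OF that]]])
      qed
      have "k y - (\<Sum>i\<in>Basis. (w y \<bullet> i) *\<^sub>R (gram (B y) i - gram (B x) i)) = gram (B x) (w y)"
        using w[OF y] rep[OF x] rep[OF y] by (simp add: scaleR_diff_right sum_subtractf)
      then show "P x (k y - (\<Sum>i\<in>Basis. (w y \<bullet> i) *\<^sub>R (gram (B y) i - gram (B x) i))) = w y"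
        using P(2)[OF x] by simp
    qed
  qed
  \<comment> \<open>The derivative solves a system with the same matrix and a continuous right-hand
    side, so \<open>solution_continuous\<close> applies again.\<close>
  moreover have "continuous_on S (\<lambda>y. P y (r y h))" for h
  proof (rule solution_continuous)
    show "continuous_on S (\<lambda>y. r y h)"
      unfolding r_def using C1k C1T contw by (auto simp: C1_on_def intro!: continuous_intros)
  qed (auto intro: C1_on_continuous_on[OF B'] simp: P(3))
  ultimately have "C1_on w (\<lambda>y h. P y (r y h)) S" by (simp add: C1_on_def)
  then show ?thesis by blast
qed

end

section \<open>Bilinear maps that depend on a point\<close>

lemma bilinear_family_continuous:
  fixes B :: "'a::topological_space \<Rightarrow> 'e::euclidean_space \<Rightarrow> 'e \<Rightarrow> 'c::real_normed_vector"
  assumes bil: "\<And>y. y \<in> S \<Longrightarrow> bilinear (B y)"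
    and cont: "\<And>u v. continuous_on S (\<lambda>y. B y u v)"
    and f: "continuous_on T f" "f ` T \<subseteq> S" and u: "continuous_on T u" and v: "continuous_on T v"
  shows "continuous_on T (\<lambda>t. B (f t) (u t) (v t))"
proof -
  have "continuous_on T (\<lambda>t. B (f t) i j)" for i j
    by (rule continuous_on_compose2[OF cont f(1)]) (use f in auto)
  then have "continuous_on T (\<lambda>t. \<Sum>i\<in>Basis. \<Sum>j\<in>Basis. ((u t \<bullet> i) * (v t \<bullet> j)) *\<^sub>R B (f t) i j)"
    by (intro continuous_intros u v)
  then show ?thesis
  proof (rule continuous_on_eq)
    fix t assume "t \<in> T"
    then have "bilinear (B (f t))" using f bil by auto
    then show "(\<Sum>i\<in>Basis. \<Sum>j\<in>Basis. ((u t \<bullet> i) * (v t \<bullet> j)) *\<^sub>R B (f t) i j) = B (f t) (u t) (v t)"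
      by (rule bilinear_expand[symmetric])
  qed
qed

locale bilinear_family =
  fixes B :: "'a::euclidean_space \<Rightarrow> 'e::euclidean_space \<Rightarrow> 'e \<Rightarrow> 'c::real_normed_vector"
    and B' :: "'e \<Rightarrow> 'e \<Rightarrow> 'a \<Rightarrow> 'a \<Rightarrow> 'c" and S :: "'a set"
  assumes open_S: "open S" and bil: "\<And>y. y \<in> S \<Longrightarrow> bilinear (B y)"
    and C1: "\<And>u v. C1_on (\<lambda>y. B y u v) (B' u v) S"
begin

text \<open>By uniqueness of derivatives, linear identities between the values of \<open>B\<close>
  pass to \<open>B'\<close>. With coefficients 1 and 0 this also transfers symmetry.\<close>

lemma deriv_linear_combination:
  assumes y: "y \<in> S" and eq: "\<And>z. z \<in> S \<Longrightarrow> B z u v = a *\<^sub>R B z p q + b *\<^sub>R B z r s"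
  shows "B' u v y h = a *\<^sub>R B' p q y h + b *\<^sub>R B' r s y h"
proof -
  have "((\<lambda>z. a *\<^sub>R B z p q + b *\<^sub>R B z r s) has_derivative (\<lambda>h. a *\<^sub>R B' p q y h + b *\<^sub>R B' r s y h)) (at y)"
    by (intro has_derivative_add has_derivative_scaleR_right C1_on_has_derivative[OF C1 y])
  then have "((\<lambda>z. B z u v) has_derivative (\<lambda>h. a *\<^sub>R B' p q y h + b *\<^sub>R B' r s y h)) (at y)"
    by (rule has_derivative_transform_within_open[OF _ open_S y]) (simp add: eq)
  from has_derivative_unique[OF this C1_on_has_derivative[OF C1 y]] show ?thesis by metis
qed

lemma deriv_bilinear:
  assumes y: "y \<in> S"
  shows "bilinear (\<lambda>u v. B' u v y h)"
  unfolding bilinear_def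
proof (intro conjI allI linearI)
  show "B' x (b1 + b2) y h = B' x b1 y h + B' x b2 y h" for x b1 b2
    using deriv_linear_combination[OF y, of x "b1 + b2" 1 x b1 1 x b2] bilinear_radd[OF bil] by simp
  show "B' (b1 + b2) x y h = B' b1 x y h + B' b2 x y h" for x b1 b2
    using deriv_linear_combination[OF y, of "b1 + b2" x 1 b1 x 1 b2 x] bilinear_ladd[OF bil] by simp
  show "B' x (r *\<^sub>R b) y h = r *\<^sub>R B' x b y h" for x r b
    using deriv_linear_combination[OF y, of x "r *\<^sub>R b" r x b 0 x b] bilinear_rmul[OF bil] by simp
  show "B' (r *\<^sub>R b) x y h = r *\<^sub>R B' b x y h" for x r b
    using deriv_linear_combination[OF y, of "r *\<^sub>R b" x r b x 0 b x] bilinear_lmul[OF bil] by simp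
qed

text \<open>Expansion over the basis leaves finitely many functions of the point alone, multiplied
  by coordinates of the two vectors; the ordinary product rule then applies.\<close>

lemma has_derivative_joint:
  assumes y: "y \<in> S"
  shows "((\<lambda>p. B (fst p) (fst (snd p)) (snd (snd p))) has_derivative
    (\<lambda>q. B' u v y (fst q) + B y (fst (snd q)) v + B y u (snd (snd q)))) (at (y, u, v))"
proof -
  have d: "((\<lambda>p. B (fst p) i j) has_derivative (\<lambda>q. B' i j y (fst q))) (at (y, u, v))"
    for i j and u v :: 'e
  proof -
    have "(fst has_derivative fst) (at (y, u, v))" by (rule bounded_linear_imp_has_derivative[OF bounded_linear_fst])
    then show ?thesis
      by (rule has_derivative_compose[of fst fst]) (use C1_on_has_derivative[OF C1 y] in simp)
  qed
  have "((\<lambda>p. \<Sum>i\<in>Basis. \<Sum>j\<in>Basis. ((fst (snd p) \<bullet> i) * (snd (snd p) \<bullet> j)) *\<^sub>R B (fst p) i j) has_derivative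
    (\<lambda>q. \<Sum>i\<in>Basis. \<Sum>j\<in>Basis. ((u \<bullet> i) * (v \<bullet> j)) *\<^sub>R B' i j y (fst q) +
      ((u \<bullet> i) * (snd (snd q) \<bullet> j) + (fst (snd q) \<bullet> i) * (v \<bullet> j)) *\<^sub>R B y i j)) (at (y, u, v))"
    by (rule derivative_eq_intros d refl ext | simp)+
  moreover have "(\<Sum>i\<in>Basis. \<Sum>j\<in>Basis. ((u \<bullet> i) * (v \<bullet> j)) *\<^sub>R B' i j y (fst q) +
      ((u \<bullet> i) * (snd (snd q) \<bullet> j) + (fst (snd q) \<bullet> i) * (v \<bullet> j)) *\<^sub>R B y i j) =
      B' u v y (fst q) + B y (fst (snd q)) v + B y u (snd (snd q))" for q :: "'a \<times> 'e \<times> 'e"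
    unfolding bilinear_expand[OF bil[OF y], of "fst (snd q)" v] bilinear_expand[OF bil[OF y], of u "snd (snd q)"]
      bilinear_expand[OF deriv_bilinear[OF y], of u v]
    by (simp add: scaleR_add_left sum.distrib)
  ultimately have "((\<lambda>p. \<Sum>i\<in>Basis. \<Sum>j\<in>Basis. ((fst (snd p) \<bullet> i) * (snd (snd p) \<bullet> j)) *\<^sub>R B (fst p) i j) has_derivative
    (\<lambda>q. B' u v y (fst q) + B y (fst (snd q)) v + B y u (snd (snd q)))) (at (y, u, v))"
    by simp
  then show ?thesis
  proof (rule has_derivative_transform_within_open[where s = "S \<times> UNIV"])
    show "open (S \<times> (UNIV :: ('e \<times> 'e) set))" by (intro open_Times open_S open_UNIV)
    show "(\<Sum>i\<in>Basis. \<Sum>j\<in>Basis. ((fst (snd p) \<bullet> i) * (snd (snd p) \<bullet> j)) *\<^sub>R B (fst p) i j) =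
        B (fst p) (fst (snd p)) (snd (snd p))" if "p \<in> S \<times> UNIV" for p
      using bilinear_expand[OF bil, of "fst p" "fst (snd p)" "snd (snd p)"] that by auto
  qed (use y in simp)
qed

lemma has_vector_derivative_along:
  assumes f: "(f has_vector_derivative f') (at t within T)" and ft: "f t \<in> S"
    and u: "(u has_vector_derivative u') (at t within T)" and v: "(v has_vector_derivative v') (at t within T)"
  shows "((\<lambda>s. B (f s) (u s) (v s)) has_vector_derivative
    B' (u t) (v t) (f t) f' + B (f t) u' (v t) + B (f t) (u t) v') (at t within T)"
proof -
  have "((\<lambda>s. (f s, u s, v s)) has_derivative (\<lambda>h. (h *\<^sub>R f', h *\<^sub>R u', h *\<^sub>R v'))) (at t within T)"
    using f u v unfolding has_vector_derivative_def by (intro has_derivative_Pair)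
  from has_derivative_compose[OF this, OF has_derivative_joint[OF ft]]
  have "((\<lambda>s. B (f s) (u s) (v s)) has_derivative
    (\<lambda>h. B' (u t) (v t) (f t) (h *\<^sub>R f') + B (f t) (h *\<^sub>R u') (v t) + B (f t) (u t) (h *\<^sub>R v'))) (at t within T)"
    by simp
  moreover have "linear (B' (u t) (v t) (f t))"
    using C1_on_has_derivative[OF C1 ft] has_derivative_linear by blast
  ultimately show ?thesis
    unfolding has_vector_derivative_def
    by (simp add: linear_scale bilinear_lmul[OF bil[OF ft]] bilinear_rmul[OF bil[OF ft]] scaleR_add_right)
qed

text \<open>Prepared for the geodesic equation, whose right-hand side is quadratic in the
  velocity.\<close>

lemma C1_on_diagonal:
  "C1_on (\<lambda>p. B (fst p) (snd p) (snd p))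
    (\<lambda>p q. B' (snd p) (snd p) (fst p) (fst q) + B (fst p) (snd q) (snd p) + B (fst p) (snd p) (snd q))
    (S \<times> UNIV)"
  unfolding C1_on_def
proof (intro conjI ballI allI)
  fix p :: "'a \<times> 'e" assume p: "p \<in> S \<times> UNIV"
  have "((\<lambda>p. (fst p, snd p, snd p)) has_derivative (\<lambda>q. (fst q, snd q, snd q))) (at p)"
    by (intro has_derivative_Pair bounded_linear_imp_has_derivative bounded_linear_fst bounded_linear_snd)
  from has_derivative_compose[OF this, OF has_derivative_joint] p
  show "((\<lambda>p. B (fst p) (snd p) (snd p)) has_derivative
     (\<lambda>q. B' (snd p) (snd p) (fst p) (fst q) + B (fst p) (snd q) (snd p) + B (fst p) (snd p) (snd q))) (at p)"
    by auto
next
  fix q :: "'a \<times> 'e"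
  have cB: "continuous_on S (\<lambda>y. B y u v)" for u v by (rule C1_on_continuous_on[OF C1])
  have cB': "continuous_on S (\<lambda>y. B' u v y h)" for u v h using C1 by (simp add: C1_on_def)
  show "continuous_on (S \<times> UNIV)
     (\<lambda>p. B' (snd p) (snd p) (fst p) (fst q) + B (fst p) (snd q) (snd p) + B (fst p) (snd p) (snd q))"
    by (intro continuous_on_add bilinear_family_continuous[where B = B, OF bil cB]
        bilinear_family_continuous[where B = "\<lambda>y u v. B' u v y (fst q)", OF deriv_bilinear cB']
        continuous_intros) auto
qed

end

section \<open>Charts, metric and connection\<close>

locale riemannian =
  fixes M :: "('a::{t2_space, second_countable_topology}, 'e::euclidean_space) riemannian"
  assumes riemannian_manifold: "riemannian_manifold M"
begin

section \<open>Charts and coordinate changes\<close>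

abbreviation chart_image :: "('a, 'e) chart \<Rightarrow> 'e set" where
  "chart_image c \<equiv> snd c ` fst c"

lemma smooth_atlas: "smooth_atlas (atlas M)"
  using riemannian_manifold by (simp add: riemannian_manifold_def)

lemma chart_homeomorphism:
  "c \<in> atlas M \<Longrightarrow> homeomorphism (fst c) (chart_image c) (snd c) (chart_inv c)"
  using smooth_atlas by (simp add: smooth_atlas_def)

lemma open_chart: "c \<in> atlas M \<Longrightarrow> open (fst c)"
  and open_chart_image: "c \<in> atlas M \<Longrightarrow> open (chart_image c)"
  using smooth_atlas by (simp_all add: smooth_atlas_def)

lemma chart_inv_left: "c \<in> atlas M \<Longrightarrow> x \<in> fst c \<Longrightarrow> chart_inv c (snd c x) = x"
  using chart_homeomorphism by (simp add: homeomorphism_def)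

lemma chart_inv_right: "c \<in> atlas M \<Longrightarrow> y \<in> chart_image c \<Longrightarrow> snd c (chart_inv c y) = y"
  using chart_inv_left by fastforce

lemma chart_inv_in: "c \<in> atlas M \<Longrightarrow> y \<in> chart_image c \<Longrightarrow> chart_inv c y \<in> fst c"
  using chart_inv_left by fastforce

lemma continuous_on_chart: "c \<in> atlas M \<Longrightarrow> continuous_on (fst c) (snd c)"
  using chart_homeomorphism by (simp add: homeomorphism_def)

lemma continuous_on_chart_inv: "c \<in> atlas M \<Longrightarrow> continuous_on (chart_image c) (chart_inv c)"
  using chart_homeomorphism by (simp add: homeomorphism_def)

lemma chart_at_in: "chart_at M x \<in> atlas M" and in_chart_at: "x \<in> fst (chart_at M x)"
proof -
  have "\<exists>c. c \<in> atlas M \<and> x \<in> fst c" using smooth_atlas unfolding smooth_atlas_def by blast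
  from someI_ex[OF this] show "chart_at M x \<in> atlas M" "x \<in> fst (chart_at M x)"
    by (simp_all add: chart_at_def)
qed

lemma open_chart_subset:
  assumes c: "c \<in> atlas M" and "open U" "U \<subseteq> fst c"
  shows "open (snd c ` U)"
proof -
  have "openin (top_of_set (fst c)) U" using assms by (auto simp: openin_open)
  then have "openin (top_of_set (chart_image c)) (snd c ` U)"
    by (rule homeomorphism_imp_open_map[OF chart_homeomorphism[OF c]])
  then show ?thesis using open_chart_image[OF c] by (simp add: openin_open_eq)
qed

lemma open_overlap: "c \<in> atlas M \<Longrightarrow> d \<in> atlas M \<Longrightarrow> open (snd c ` (fst c \<inter> fst d))"
  by (intro open_chart_subset open_Int open_chart) auto

lemma smooth_transition:
  "c \<in> atlas M \<Longrightarrow> d \<in> atlas M \<Longrightarrow> smooth_on (snd d \<circ> chart_inv c) (snd c ` (fst c \<inter> fst d))"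
  using smooth_atlas by (simp add: smooth_atlas_def)

lemma transition_has_derivative:
  assumes "c \<in> atlas M" "d \<in> atlas M" "x \<in> fst c" "x \<in> fst d"
  shows "((snd d \<circ> chart_inv c) has_derivative coord_change c d x) (at (snd c x))"
  unfolding coord_change_def
  using C1_on_has_derivative[OF smooth_on_C1_on[OF smooth_transition open_overlap]] assms by blast

lemma linear_coord_change:
  assumes "c \<in> atlas M" "d \<in> atlas M" "x \<in> fst c" "x \<in> fst d"
  shows "linear (coord_change c d x)"
  using transition_has_derivative[OF assms] by (rule has_derivative_linear)

lemma coord_change_compose:
  assumes c: "c \<in> atlas M" "x \<in> fst c" and d: "d \<in> atlas M" "x \<in> fst d" and e: "e \<in> atlas M" "x \<in> fst e"
  shows "coord_change d e x (coord_change c d x v) = coord_change c e x v"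
proof -
  let ?U = "fst c \<inter> fst d \<inter> fst e"
  have "((snd e \<circ> chart_inv d) has_derivative coord_change d e x) (at ((snd d \<circ> chart_inv c) (snd c x)))"
    using transition_has_derivative[of d e x] assms by (simp add: chart_inv_left)
  from has_derivative_compose[OF transition_has_derivative[of c d x] this]
  have "((\<lambda>y. (snd e \<circ> chart_inv d) ((snd d \<circ> chart_inv c) y)) has_derivative
      (\<lambda>v. coord_change d e x (coord_change c d x v))) (at (snd c x))"
    using assms by simp
  moreover have "open (snd c ` ?U)"
    using c(1) by (rule open_chart_subset) (auto intro!: open_Int open_chart assms)
  ultimately have "((snd e \<circ> chart_inv c) has_derivative
      (\<lambda>v. coord_change d e x (coord_change c d x v))) (at (snd c x))"
    by (rule has_derivative_transform_within_open) (use assms in \<open>auto simp: chart_inv_left\<close>)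
  from has_derivative_unique[OF this transition_has_derivative[of c e x]] assms
  show ?thesis by (auto dest: fun_cong)
qed

lemma coord_change_id:
  assumes c: "c \<in> atlas M" "x \<in> fst c"
  shows "coord_change c c x v = v"
proof -
  have "((\<lambda>y. y) has_derivative (\<lambda>v. v)) (at (snd c x))" by (rule has_derivative_ident)
  then have "((snd c \<circ> chart_inv c) has_derivative (\<lambda>v. v)) (at (snd c x))"
    by (rule has_derivative_transform_within_open[OF _ open_chart_image[OF c(1)]])
      (use c in \<open>auto simp: chart_inv_left\<close>)
  from has_derivative_unique[OF this transition_has_derivative[of c c x]] assms
  show ?thesis by metis
qed

section \<open>The metric and the Levi-Civita connection in coordinates\<close>

lemma bilinear_metric: "bilinear (metric M x)"
  and metric_sym: "metric M x u v = metric M x v u"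
  and metric_pos: "u \<noteq> 0 \<Longrightarrow> metric M x u u > 0"
  using riemannian_manifold by (auto simp: riemannian_manifold_def)

lemma metric_in_eq:
  "c \<in> atlas M \<Longrightarrow> x \<in> fst c \<Longrightarrow> metric_in M c (snd c x) u v =
    metric M x (coord_change c (chart_at M x) x u) (coord_change c (chart_at M x) x v)"
  by (simp add: metric_in_def Let_def chart_inv_left)

lemma metric_in_chart_at: "metric_in M (chart_at M x) (snd (chart_at M x) x) u v = metric M x u v"
  by (simp add: metric_in_eq chart_at_in in_chart_at coord_change_id)

lemma bilinear_metric_in:
  assumes c: "c \<in> atlas M" and y: "y \<in> chart_image c"
  shows "bilinear (metric_in M c y)"
proof -
  obtain x where x: "x \<in> fst c" "y = snd c x" using y by auto
  have "linear (coord_change c (chart_at M x) x)"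
    using linear_coord_change x c chart_at_in in_chart_at by blast
  then have "linear (\<lambda>u. metric M x v (coord_change c (chart_at M x) x u))"
    "linear (\<lambda>u. metric M x (coord_change c (chart_at M x) x u) v)" for v
    using bilinear_metric[of x] linear_compose[unfolded o_def] unfolding bilinear_def by blast+
  then show ?thesis using c x by (simp add: bilinear_def metric_in_eq)
qed

lemma metric_in_sym:
  assumes c: "c \<in> atlas M" and y: "y \<in> chart_image c"
  shows "metric_in M c y u v = metric_in M c y v u"
  using assms metric_sym by (auto simp: metric_in_eq)

lemma metric_in_pos:
  assumes c: "c \<in> atlas M" and y: "y \<in> chart_image c" and u: "u \<noteq> 0"
  shows "metric_in M c y u u > 0"
proof -
  obtain x where x: "x \<in> fst c" "y = snd c x" using y by auto
  have "coord_change (chart_at M x) c x (coord_change c (chart_at M x) x u) = u"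
    using coord_change_compose[of c x "chart_at M x" c u] c x chart_at_in in_chart_at coord_change_id by simp
  moreover have "coord_change (chart_at M x) c x 0 = 0"
    using linear_0[OF linear_coord_change] c x chart_at_in in_chart_at by blast
  ultimately have "coord_change c (chart_at M x) x u \<noteq> 0" using u by auto
  then show ?thesis using c x by (simp add: metric_in_eq metric_pos)
qed

lemma metric_in_nonneg: "c \<in> atlas M \<Longrightarrow> y \<in> chart_image c \<Longrightarrow> metric_in M c y u u \<ge> 0"
  using metric_in_pos[of c y u] bilinear_lzero[OF bilinear_metric_in] by (cases "u = 0") auto

lemma smooth_metric_in: "c \<in> atlas M \<Longrightarrow> smooth_on (\<lambda>y. metric_in M c y u v) (chart_image c)"
  using riemannian_manifold by (simp add: riemannian_manifold_def)

lemma metric_family: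
  assumes c: "c \<in> atlas M"
  shows "bilinear_family (metric_in M c) (\<lambda>u v y h. metric_deriv M c y h u v) (chart_image c)"
proof
  show "C1_on (\<lambda>y. metric_in M c y u v) (\<lambda>y h. metric_deriv M c y h u v) (chart_image c)" for u v
    unfolding metric_deriv_def by (rule smooth_on_C1_on[OF smooth_metric_in[OF c] open_chart_image[OF c]])
qed (use c open_chart_image bilinear_metric_in in auto)

lemma linear_metric_deriv:
  assumes c: "c \<in> atlas M" and y: "y \<in> chart_image c"
  shows "linear (\<lambda>h. metric_deriv M c y h u v)"
  using C1_on_has_derivative[OF bilinear_family.C1[OF metric_family[OF c]] y] by (rule has_derivative_linear)

lemma bilinear_metric_deriv:
  assumes c: "c \<in> atlas M" and y: "y \<in> chart_image c"
  shows "bilinear (metric_deriv M c y h)"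
  using bilinear_family.deriv_bilinear[OF metric_family[OF c] y] .

lemma metric_deriv_sym:
  assumes c: "c \<in> atlas M" and y: "y \<in> chart_image c"
  shows "metric_deriv M c y h u v = metric_deriv M c y h v u"
  using bilinear_family.deriv_linear_combination[OF metric_family[OF c] y, of u v 1 v u 0 v u]
    metric_in_sym[OF c] by (simp add: bilinear_lzero)

text \<open>The Christoffel symbol of the first kind: the factor 2 of the Koszul formula is moved to
  this side, so that it is the product of \<open>christoffel M c y u v\<close> with
  \<open>z\<close>.\<close>

definition koszul :: "('a, 'e) chart \<Rightarrow> 'e \<Rightarrow> 'e \<Rightarrow> 'e \<Rightarrow> 'e \<Rightarrow> real" where
  "koszul c y u v z =
    (metric_deriv M c y u v z + metric_deriv M c y v u z - metric_deriv M c y z u v) / 2"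

lemma koszul_linear:
  assumes c: "c \<in> atlas M" and y: "y \<in> chart_image c"
  shows "linear (\<lambda>u. koszul c y u v z)" "linear (\<lambda>v. koszul c y u v z)" "linear (koszul c y u v)"
  using linear_metric_deriv[OF c y] bilinear_metric_deriv[OF c y]
  unfolding koszul_def bilinear_def linear_iff
  by (auto simp: field_simps)

lemma christoffel_unique:
  assumes c: "c \<in> atlas M" and y: "y \<in> chart_image c"
  shows "\<exists>!w. \<forall>z. metric_in M c y w z = koszul c y u v z"
  by (rule riesz_bilinear[OF bilinear_metric_in[OF c y] metric_in_pos[OF c y] koszul_linear(3)[OF c y]])

lemma christoffel_koszul:
  assumes c: "c \<in> atlas M" and y: "y \<in> chart_image c"
  shows "metric_in M c y (christoffel M c y u v) z = koszul c y u v z"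
proof -
  have "christoffel M c y u v = (THE w. \<forall>z. metric_in M c y w z = koszul c y u v z)"
    unfolding christoffel_def koszul_def by (simp add: field_simps)
  then show ?thesis using theI'[OF christoffel_unique[OF c y, of u v]] by simp
qed

lemma christoffel_eqI:
  assumes c: "c \<in> atlas M" and y: "y \<in> chart_image c" and "\<And>z. metric_in M c y w z = koszul c y u v z"
  shows "christoffel M c y u v = w"
  using christoffel_unique[OF c y, of u v] assms christoffel_koszul[OF c y] by blast

lemma christoffel_sym:
  assumes c: "c \<in> atlas M" and y: "y \<in> chart_image c"
  shows "christoffel M c y u v = christoffel M c y v u"
  by (rule christoffel_eqI[OF c y])
    (simp add: christoffel_koszul[OF c y] koszul_def metric_deriv_sym[OF c y, of _ u v] algebra_simps)

lemma bilinear_christoffel: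
  assumes c: "c \<in> atlas M" and y: "y \<in> chart_image c"
  shows "bilinear (christoffel M c y)"
proof -
  note b = bilinear_metric_in[OF c y]
  have lin: "linear (\<lambda>u. christoffel M c y u v)" for v
  proof (rule linearI)
    show "christoffel M c y (a + b) v = christoffel M c y a v + christoffel M c y b v" for a b
      by (rule christoffel_eqI[OF c y])
        (simp add: bilinear_ladd[OF b] christoffel_koszul[OF c y] linear_add[OF koszul_linear(1)[OF c y]])
    show "christoffel M c y (r *\<^sub>R a) v = r *\<^sub>R christoffel M c y a v" for r a
      by (rule christoffel_eqI[OF c y])
        (simp add: bilinear_lmul[OF b] christoffel_koszul[OF c y] linear_scale[OF koszul_linear(1)[OF c y]])
  qed
  moreover have "linear (christoffel M c y u)" for u
    using lin[of u] christoffel_sym[OF c y, of u] by presburger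
  ultimately show ?thesis by (simp add: bilinear_def)
qed

text \<open>In the sum of the Koszul formulas for \<open>(u, v, z)\<close> and
  \<open>(u, z, v)\<close> everything cancels except the derivative in the direction
  \<open>u\<close>.\<close>

lemma metric_compatible:
  assumes c: "c \<in> atlas M" and y: "y \<in> chart_image c"
  shows "metric_deriv M c y u v z =
    metric_in M c y (christoffel M c y u v) z + metric_in M c y v (christoffel M c y u z)"
  using metric_deriv_sym[OF c y]
  by (simp add: metric_in_sym[OF c y, of v] christoffel_koszul[OF c y] koszul_def field_simps)

definition christoffel_deriv :: "('a, 'e) chart \<Rightarrow> 'e \<Rightarrow> 'e \<Rightarrow> 'e \<Rightarrow> 'e \<Rightarrow> 'e" where
  "christoffel_deriv c y h u v = frechet_derivative (\<lambda>y'. christoffel M c y' u v) (at y) h"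

text \<open>The Christoffel symbols solve a linear system whose matrix is the metric. Its right-hand
  side contains first derivatives of the metric, which are again continuously
  differentiable.\<close>

lemma christoffel_family:
  assumes c: "c \<in> atlas M"
  shows "bilinear_family (christoffel M c) (\<lambda>u v y h. christoffel_deriv c y h u v) (chart_image c)"
proof
  interpret posdef_family "metric_in M c" "chart_image c"
    by unfold_locales (use c open_chart_image bilinear_metric_in metric_in_pos in auto)
  fix u v
  have C1d: "C1_on (\<lambda>y. metric_deriv M c y h u v)
      (\<lambda>x. frechet_derivative (\<lambda>y. metric_deriv M c y h u v) (at x)) (chart_image c)" for h u v
    unfolding metric_deriv_def
    by (rule smooth_on_C1_on_deriv[OF smooth_metric_in[OF c] open_chart_image[OF c]])
  have "\<exists>k'. C1_on (\<lambda>y. \<Sum>b\<in>Basis. koszul c y u v b *\<^sub>R b) k' (chart_image c)"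
    unfolding koszul_def
    by (rule exI, rule C1_on_sum, rule C1_on_scaleR_left, rule C1_on_divide, rule C1_on_diff,
      rule C1_on_add, (rule C1d)+)
  then obtain k' where "C1_on (\<lambda>y. \<Sum>b\<in>Basis. koszul c y u v b *\<^sub>R b) k' (chart_image c)" by blast
  moreover have "\<exists>B'. C1_on (\<lambda>y. metric_in M c y u v) B' (chart_image c)" for u v
    using bilinear_family.C1[OF metric_family[OF c]] by blast
  moreover have "gram (metric_in M c y) (christoffel M c y u v) = (\<Sum>b\<in>Basis. koszul c y u v b *\<^sub>R b)"
    if "y \<in> chart_image c" for y
    by (simp add: gram_def christoffel_koszul[OF c that])
  ultimately obtain w' where w': "C1_on (\<lambda>y. christoffel M c y u v) w' (chart_image c)"
    using solution_C1[of _ k' "\<lambda>y. christoffel M c y u v"] by blast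
  have "frechet_derivative (\<lambda>y. christoffel M c y u v) (at y) = w' y" if "y \<in> chart_image c" for y
    using frechet_derivative_at[OF C1_on_has_derivative[OF w' that]] by simp
  then show "C1_on (\<lambda>y. christoffel M c y u v) (\<lambda>y h. christoffel_deriv c y h u v) (chart_image c)"
    using w' by (simp add: C1_on_def christoffel_deriv_def cong: continuous_on_cong)
qed (use c open_chart_image bilinear_christoffel in auto)

text \<open>The geodesic equation as an autonomous first-order system for pairs of position and
  velocity; \<open>spray_deriv\<close> is its linearisation, the Jacobi equation in
  coordinates.\<close>

definition spray :: "('a, 'e) chart \<Rightarrow> 'e \<times> 'e \<Rightarrow> 'e \<times> 'e" where
  "spray c p = (snd p, - christoffel M c (fst p) (snd p) (snd p))"

definition spray_deriv :: "('a, 'e) chart \<Rightarrow> 'e \<times> 'e \<Rightarrow> 'e \<times> 'e \<Rightarrow> 'e \<times> 'e" where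
  "spray_deriv c p q = (snd q, - (christoffel_deriv c (fst p) (fst q) (snd p) (snd p) +
     christoffel M c (fst p) (snd q) (snd p) + christoffel M c (fst p) (snd p) (snd q)))"

lemma C1_spray:
  assumes c: "c \<in> atlas M"
  shows "C1_on (spray c) (spray_deriv c) (chart_image c \<times> UNIV)"
proof -
  note * = bilinear_family.C1_on_diagonal[OF christoffel_family[OF c]]
  show ?thesis unfolding C1_on_def
  proof (intro conjI ballI allI)
    fix p :: "'e \<times> 'e" assume p: "p \<in> chart_image c \<times> UNIV"
    show "(spray c has_derivative spray_deriv c p) (at p)"
      unfolding spray_def spray_deriv_def
      by (intro has_derivative_Pair has_derivative_minus C1_on_has_derivative[OF * p]
          bounded_linear_imp_has_derivative bounded_linear_snd)
  next
    fix q :: "'e \<times> 'e"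
    show "continuous_on (chart_image c \<times> UNIV) (\<lambda>p. spray_deriv c p q)"
      unfolding spray_deriv_def
      using * unfolding C1_on_def by (intro continuous_on_Pair continuous_on_minus continuous_on_const) blast
  qed
qed

text \<open>The change of coordinates on the tangent bundle: a position is moved by the transition
  map, a velocity by its differential.\<close>

definition tangent_transition :: "('a, 'e) chart \<Rightarrow> ('a, 'e) chart \<Rightarrow> 'e \<times> 'e \<Rightarrow> 'e \<times> 'e" where
  "tangent_transition c d p =
    ((snd d \<circ> chart_inv c) (fst p), frechet_derivative (snd d \<circ> chart_inv c) (at (fst p)) (snd p))"

text \<open>Second derivatives of the transition map appear. Written out over the basis, the
  velocity component is a sum of products of coordinates with first derivatives in fixed directions;
  this agrees with \<open>tangent_transition\<close> over the overlap only, which is enough near one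
  point.\<close>

lemma tangent_transition_strict_deriv:
  assumes c: "c \<in> atlas M" and d: "d \<in> atlas M" and y: "y \<in> snd c ` (fst c \<inter> fst d)"
  shows "\<exists>L. strict_deriv (tangent_transition c d) L (y, w)"
proof -
  let ?S = "snd c ` (fst c \<inter> fst d)" and ?\<phi> = "snd d \<circ> chart_inv c"
  have S: "open ?S" by (rule open_overlap[OF c d])
  have C1: "C1_on ?\<phi> (\<lambda>y. frechet_derivative ?\<phi> (at y)) ?S"
    by (rule smooth_on_C1_on[OF smooth_transition[OF c d] S])
  define H where "H = (\<lambda>i y. frechet_derivative (\<lambda>y. frechet_derivative ?\<phi> (at y) i) (at y))"
  have C2: "C1_on (\<lambda>y. frechet_derivative ?\<phi> (at y) i) (H i) ?S" for i
    unfolding H_def by (rule smooth_on_C1_on_deriv[OF smooth_transition[OF c d] S])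
  define F where "F = (\<lambda>p :: 'e \<times> 'e. (?\<phi> (fst p), \<Sum>i\<in>Basis. (snd p \<bullet> i) *\<^sub>R frechet_derivative ?\<phi> (at (fst p)) i))"
  define F' where "F' = (\<lambda>(p :: 'e \<times> 'e) q :: 'e \<times> 'e. (frechet_derivative ?\<phi> (at (fst p)) (fst q),
    \<Sum>i\<in>Basis. (snd p \<bullet> i) *\<^sub>R H i (fst p) (fst q) + (snd q \<bullet> i) *\<^sub>R frechet_derivative ?\<phi> (at (fst p)) i))"
  have "C1_on F F' (?S \<times> UNIV)" unfolding C1_on_def
  proof (intro conjI ballI allI)
    fix p :: "'e \<times> 'e" assume p: "p \<in> ?S \<times> UNIV"
    have f: "(fst has_derivative fst) (at p)" by (rule bounded_linear_imp_has_derivative[OF bounded_linear_fst])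
    have a: "((\<lambda>p. ?\<phi> (fst p)) has_derivative (\<lambda>q. frechet_derivative ?\<phi> (at (fst p)) (fst q))) (at p)"
      by (rule has_derivative_compose[OF f C1_on_has_derivative[OF C1]]) (use p in auto)
    have b: "((\<lambda>p. frechet_derivative ?\<phi> (at (fst p)) i) has_derivative (\<lambda>q. H i (fst p) (fst q))) (at p)" for i
      by (rule has_derivative_compose[OF f C1_on_has_derivative[OF C2]]) (use p in auto)
    have s: "((\<lambda>p. snd p \<bullet> i) has_derivative (\<lambda>q. snd q \<bullet> i)) (at p)" for i :: 'e
      by (intro has_derivative_inner_left bounded_linear_imp_has_derivative bounded_linear_snd)
    show "(F has_derivative F' p) (at p)"
      unfolding F_def F'_def
      by (intro has_derivative_Pair a has_derivative_sum has_derivative_scaleR s b)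
  next
    fix q :: "'e \<times> 'e"
    have f: "continuous_on (?S \<times> UNIV) fst" by (intro continuous_intros)
    have "continuous_on ?S (\<lambda>y. frechet_derivative ?\<phi> (at y) v)" for v using C1 unfolding C1_on_def by blast
    then have "continuous_on (?S \<times> UNIV) (\<lambda>p. frechet_derivative ?\<phi> (at (fst p)) v)" for v
      by (rule continuous_on_compose2[OF _ f]) auto
    moreover have "continuous_on ?S (\<lambda>y. H i y v)" for i v using C2 unfolding C1_on_def by blast
    then have "continuous_on (?S \<times> UNIV) (\<lambda>p. H i (fst p) v)" for i v
      by (rule continuous_on_compose2[OF _ f]) auto
    ultimately show "continuous_on (?S \<times> UNIV) (\<lambda>p. F' p q)"
      unfolding F'_def by (intro continuous_intros)
  qed
  moreover have op: "open (?S \<times> (UNIV :: 'e set))" by (intro open_Times S open_UNIV)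
  ultimately have "strict_deriv F (F' (y, w)) (y, w)"
    using y by (intro C1_on_strict_deriv) auto
  then have "strict_deriv (tangent_transition c d) (F' (y, w)) (y, w)"
  proof (rule strict_deriv_transform)
    have "\<forall>\<^sub>F p in nhds (y, w). p \<in> ?S \<times> UNIV" using y by (intro eventually_nhds_in_open op) auto
    then show "\<forall>\<^sub>F p in nhds (y, w). F p = tangent_transition c d p"
    proof eventually_elim
      case (elim p)
      then have "linear (frechet_derivative ?\<phi> (at (fst p)))"
        using C1_on_has_derivative[OF C1, of "fst p"] has_derivative_linear by auto
      then have "frechet_derivative ?\<phi> (at (fst p)) (\<Sum>i\<in>Basis. (snd p \<bullet> i) *\<^sub>R i) =
          (\<Sum>i\<in>Basis. (snd p \<bullet> i) *\<^sub>R frechet_derivative ?\<phi> (at (fst p)) i)"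
        by (simp add: linear_sum linear_scale)
      then show ?case by (simp add: F_def tangent_transition_def euclidean_representation)
    qed
  qed
  then show ?thesis by blast
qed

lemma tangent_transition_eq:
  "c \<in> atlas M \<Longrightarrow> x \<in> fst c \<Longrightarrow> tangent_transition c d (snd c x, w) = (snd d x, coord_change c d x w)"
  by (simp add: tangent_transition_def coord_change_def chart_inv_left)

end

section \<open>Geodesics\<close>

context riemannian
begin

lemma eventually_in_chart:
  assumes "continuous (at t within T) \<kappa>" "c \<in> atlas M" "\<kappa> t \<in> fst c"
  shows "\<forall>\<^sub>F s in at t within T. \<kappa> s \<in> fst c"
  by (rule topological_tendstoD[OF assms(1)[unfolded continuous_within] open_chart[OF assms(2)] assms(3)])

lemma change_of_chart_derivative:
  assumes c: "c \<in> atlas M" and d: "d \<in> atlas M" and x: "\<kappa> t \<in> fst c" "\<kappa> t \<in> fst d"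
    and cont: "continuous (at t within T) \<kappa>" and t: "t \<in> T"
    and w: "((snd c \<circ> \<kappa>) has_vector_derivative w) (at t within T)"
  shows "((snd d \<circ> \<kappa>) has_vector_derivative coord_change c d (\<kappa> t) w) (at t within T)"
proof -
  have "((snd d \<circ> chart_inv c) has_derivative coord_change c d (\<kappa> t)) (at ((snd c \<circ> \<kappa>) t))"
    using transition_has_derivative[OF c d x] by simp
  from has_derivative_compose[OF w[unfolded has_vector_derivative_def] this]
  have "((\<lambda>s. (snd d \<circ> chart_inv c) ((snd c \<circ> \<kappa>) s)) has_vector_derivative coord_change c d (\<kappa> t) w) (at t within T)"
    by (simp add: has_vector_derivative_def linear_scale[OF linear_coord_change[OF c d x]])
  then show ?thesis unfolding has_vector_derivative_def
  proof (rule has_derivative_transform_eventually)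
    show "\<forall>\<^sub>F s in at t within T. (snd d \<circ> chart_inv c) ((snd c \<circ> \<kappa>) s) = (snd d \<circ> \<kappa>) s"
      using eventually_in_chart[OF cont c x(1)] by eventually_elim (simp add: chart_inv_left[OF c])
  qed (use x t in \<open>simp_all add: chart_inv_left[OF c]\<close>)
qed

text \<open>Unlike \<open>velocity\<close>, this uses the same chart at all times, so it can be
  differentiated in time.\<close>

definition chart_vel :: "('a, 'e) chart \<Rightarrow> (real \<Rightarrow> 'a) \<Rightarrow> real \<Rightarrow> 'e" where
  "chart_vel c \<gamma> t = vector_derivative (snd c \<circ> \<gamma>) (at t)"

definition state :: "('a, 'e) chart \<Rightarrow> (real \<Rightarrow> 'a) \<Rightarrow> real \<Rightarrow> 'e \<times> 'e" where
  "state c \<gamma> t = (snd c (\<gamma> t), chart_vel c \<gamma> t)"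

lemma velocity_eq_chart_vel: "velocity M \<gamma> t = chart_vel (chart_at M (\<gamma> t)) \<gamma> t"
  by (simp add: velocity_def chart_vel_def)

lemma geodesic_continuous: "geodesic M \<gamma> \<Longrightarrow> continuous (at t within T) \<gamma>"
  by (rule continuous_within_subset[OF _ subset_UNIV])
    (simp add: geodesic_def continuous_on_eq_continuous_within)

lemma geodesic_eventually_in_chart:
  "geodesic M \<gamma> \<Longrightarrow> c \<in> atlas M \<Longrightarrow> \<gamma> t \<in> fst c \<Longrightarrow> \<forall>\<^sub>F s in nhds t. \<gamma> s \<in> fst c"
  unfolding eventually_nhds_conv_at using eventually_in_chart[OF geodesic_continuous, of \<gamma> c t UNIV] by blast

lemma geodesic_position:
  assumes "geodesic M \<gamma>" "c \<in> atlas M" "\<gamma> t \<in> fst c"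
  shows "((snd c \<circ> \<gamma>) has_vector_derivative chart_vel c \<gamma> t) (at t)"
proof -
  obtain w where "\<And>t. \<gamma> t \<in> fst c \<Longrightarrow> ((snd c \<circ> \<gamma>) has_vector_derivative w t) (at t)"
    using assms unfolding geodesic_def by metis
  then show ?thesis unfolding chart_vel_def using vector_derivative_at assms(3) by metis
qed

lemma geodesic_equation:
  assumes "geodesic M \<gamma>" "c \<in> atlas M" "\<gamma> t \<in> fst c"
  shows "(chart_vel c \<gamma> has_vector_derivative
    - christoffel M c (snd c (\<gamma> t)) (chart_vel c \<gamma> t) (chart_vel c \<gamma> t)) (at t)"
proof -
  obtain w where w: "\<And>t. \<gamma> t \<in> fst c \<Longrightarrow> ((snd c \<circ> \<gamma>) has_vector_derivative w t) (at t)"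
    "\<And>t. \<gamma> t \<in> fst c \<Longrightarrow> (w has_vector_derivative - christoffel M c (snd c (\<gamma> t)) (w t) (w t)) (at t)"
    using assms unfolding geodesic_def by metis
  have eq: "w s = chart_vel c \<gamma> s" if "\<gamma> s \<in> fst c" for s
    using vector_derivative_at[OF w(1)[OF that]] by (simp add: chart_vel_def)
  have "(chart_vel c \<gamma> has_vector_derivative - christoffel M c (snd c (\<gamma> t)) (w t) (w t)) (at t)"
    using w(2)[OF assms(3)] unfolding has_vector_derivative_def
  proof (rule has_derivative_transform_eventually)
    show "\<forall>\<^sub>F s in at t. w s = chart_vel c \<gamma> s"
      using eventually_in_chart[OF geodesic_continuous[OF assms(1)] assms(2,3)]
      by eventually_elim (rule eq)
  qed (use eq assms in auto)
  then show ?thesis using eq assms(3) by simp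
qed

lemma state_derivative:
  assumes "geodesic M \<gamma>" "c \<in> atlas M" "\<gamma> t \<in> fst c"
  shows "(state c \<gamma> has_vector_derivative spray c (state c \<gamma> t)) (at t)"
  using has_vector_derivative_Pair[OF geodesic_position[OF assms] geodesic_equation[OF assms]]
  by (simp add: state_def[abs_def] spray_def o_def)

lemma state_continuous:
  assumes "geodesic M \<gamma>" "c \<in> atlas M" "\<gamma> t \<in> fst c"
  shows "isCont (state c \<gamma>) t"
  using has_vector_derivative_continuous[OF state_derivative[OF assms]] .

lemma chart_vel_change:
  assumes "geodesic M \<gamma>" "c \<in> atlas M" "\<gamma> t \<in> fst c" "d \<in> atlas M" "\<gamma> t \<in> fst d"
  shows "chart_vel d \<gamma> t = coord_change c d (\<gamma> t) (chart_vel c \<gamma> t)"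
  unfolding chart_vel_def[of d]
  by (rule vector_derivative_at, rule change_of_chart_derivative)
    (use assms in \<open>auto intro: geodesic_position geodesic_continuous\<close>)

lemma state_change:
  assumes "geodesic M \<gamma>" "c \<in> atlas M" "\<gamma> t \<in> fst c" "d \<in> atlas M" "\<gamma> t \<in> fst d"
  shows "state d \<gamma> t = tangent_transition c d (state c \<gamma> t)"
  unfolding state_def tangent_transition_eq[OF assms(2,3)] chart_vel_change[OF assms] ..

text \<open>The connection term is quadratic in the velocity, so both sides of the geodesic equation
  are multiplied by the square of \<open>r\<close>. Negative \<open>r\<close> is included and gives
  reversal of time.\<close>

lemma geodesic_affine:
  assumes "geodesic M \<gamma>"
  shows "geodesic M (\<lambda>s. \<gamma> (r * s + a))"
    and "c \<in> atlas M \<Longrightarrow> \<gamma> (r * s + a) \<in> fst c \<Longrightarrow> chart_vel c (\<lambda>s. \<gamma> (r * s + a)) s = r *\<^sub>R chart_vel c \<gamma> (r * s + a)"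
proof -
  have inner: "((\<lambda>s. r * s + a) has_vector_derivative r) (at s)" for s
    by (auto intro!: derivative_eq_intros simp: has_real_derivative_iff_has_vector_derivative[symmetric])
  have pos: "((snd c \<circ> (\<lambda>s. \<gamma> (r * s + a))) has_vector_derivative r *\<^sub>R chart_vel c \<gamma> (r * s + a)) (at s)"
    if "c \<in> atlas M" "\<gamma> (r * s + a) \<in> fst c" for c s
    using vector_diff_chain_at[OF inner geodesic_position[OF assms that]] by (simp add: o_def)
  then show "c \<in> atlas M \<Longrightarrow> \<gamma> (r * s + a) \<in> fst c \<Longrightarrow> chart_vel c (\<lambda>s. \<gamma> (r * s + a)) s = r *\<^sub>R chart_vel c \<gamma> (r * s + a)"
    unfolding chart_vel_def[of c "\<lambda>s. \<gamma> (r * s + a)"] by (simp add: vector_derivative_at)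
  show "geodesic M (\<lambda>s. \<gamma> (r * s + a))"
    unfolding geodesic_def
  proof (intro conjI ballI)
    have "continuous_on UNIV \<gamma>" using assms by (simp add: geodesic_def)
    then show "continuous_on UNIV (\<lambda>s. \<gamma> (r * s + a))"
      by (rule continuous_on_compose2) (auto intro!: continuous_intros)
    fix c assume c: "c \<in> atlas M"
    show "\<exists>w. \<forall>t. \<gamma> (r * t + a) \<in> fst c \<longrightarrow>
      ((snd c \<circ> (\<lambda>s. \<gamma> (r * s + a))) has_vector_derivative w t) (at t) \<and>
      (w has_vector_derivative - christoffel M c (snd c (\<gamma> (r * t + a))) (w t) (w t)) (at t)"
    proof (intro exI[of _ "\<lambda>t. r *\<^sub>R chart_vel c \<gamma> (r * t + a)"] allI impI conjI)
      fix t assume t: "\<gamma> (r * t + a) \<in> fst c"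
      show "((snd c \<circ> (\<lambda>s. \<gamma> (r * s + a))) has_vector_derivative r *\<^sub>R chart_vel c \<gamma> (r * t + a)) (at t)"
        by (rule pos[OF c t])
      have "((\<lambda>t. chart_vel c \<gamma> (r * t + a)) has_vector_derivative
          r *\<^sub>R - christoffel M c (snd c (\<gamma> (r * t + a))) (chart_vel c \<gamma> (r * t + a)) (chart_vel c \<gamma> (r * t + a))) (at t)"
        using vector_diff_chain_at[OF inner geodesic_equation[OF assms c t]] by (simp add: o_def)
      then have "((\<lambda>t. r *\<^sub>R chart_vel c \<gamma> (r * t + a)) has_vector_derivative
          r *\<^sub>R r *\<^sub>R - christoffel M c (snd c (\<gamma> (r * t + a))) (chart_vel c \<gamma> (r * t + a)) (chart_vel c \<gamma> (r * t + a))) (at t)"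
        by (rule bounded_linear.has_vector_derivative[OF bounded_linear_scaleR_right])
      moreover have "bilinear (christoffel M c (snd c (\<gamma> (r * t + a))))"
        using bilinear_christoffel[OF c] t by blast
      ultimately show "((\<lambda>t. r *\<^sub>R chart_vel c \<gamma> (r * t + a)) has_vector_derivative
          - christoffel M c (snd c (\<gamma> (r * t + a))) (r *\<^sub>R chart_vel c \<gamma> (r * t + a)) (r *\<^sub>R chart_vel c \<gamma> (r * t + a))) (at t)"
        by (simp add: bilinear_lmul bilinear_rmul)
    qed
  qed
qed

lemma velocity_affine:
  "geodesic M \<gamma> \<Longrightarrow> velocity M (\<lambda>s. \<gamma> (r * s + a)) s = r *\<^sub>R velocity M \<gamma> (r * s + a)"
  by (simp add: velocity_eq_chart_vel geodesic_affine(2) chart_at_in in_chart_at)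

text \<open>In one chart both states solve the same first-order system with locally Lipschitz
  right-hand side and the same initial value; Gronwall with zero data makes them equal. The
  velocities in the selected charts follow by changing coordinates.\<close>

lemma geodesic_forward_local_unique:
  assumes g: "geodesic M \<gamma>" and s: "geodesic M \<sigma>" and t: "\<gamma> t = \<sigma> t" "velocity M \<gamma> t = velocity M \<sigma> t"
  shows "\<exists>u>t. \<forall>r. t < r \<and> r \<le> u \<longrightarrow> \<gamma> r = \<sigma> r \<and> velocity M \<gamma> r = velocity M \<sigma> r"
proof -
  define c where "c = chart_at M (\<gamma> t)"
  have c: "c \<in> atlas M" "\<gamma> t \<in> fst c" "\<sigma> t \<in> fst c"
    using chart_at_in in_chart_at[of "\<gamma> t"] t by (auto simp: c_def)
  have eq: "state c \<gamma> t = state c \<sigma> t"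
    using t by (simp add: state_def c_def velocity_eq_chart_vel)
  have "open (chart_image c \<times> (UNIV :: 'e set))" by (intro open_Times open_chart_image c open_UNIV)
  moreover have "state c \<gamma> t \<in> chart_image c \<times> UNIV" using c by (simp add: state_def)
  ultimately have "strict_deriv (spray c) (spray_deriv c (state c \<gamma> t)) (state c \<gamma> t)"
    by (rule C1_on_strict_deriv[OF C1_spray[OF c(1)]])
  from strict_deriv_lipschitz[OF this] obtain C d where C: "C > 0" "d > 0"
    "\<And>y z. y \<in> ball (state c \<gamma> t) d \<Longrightarrow> z \<in> ball (state c \<gamma> t) d \<Longrightarrow> norm (spray c y - spray c z) \<le> C * norm (y - z)"
    by blast
  have "\<forall>\<^sub>F r in nhds t. dist (state c \<gamma> r) (state c \<gamma> t) < d"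
    "\<forall>\<^sub>F r in nhds t. dist (state c \<sigma> r) (state c \<sigma> t) < d"
    using state_continuous[OF g c(1,2)] state_continuous[OF s c(1,3)] C(2)
    unfolding isCont_def tendsto_iff eventually_nhds_conv_at by simp_all
  with geodesic_eventually_in_chart[OF g c(1,2)] geodesic_eventually_in_chart[OF s c(1,3)]
  have "\<forall>\<^sub>F r in nhds t. \<gamma> r \<in> fst c \<and> \<sigma> r \<in> fst c \<and>
      state c \<gamma> r \<in> ball (state c \<gamma> t) d \<and> state c \<sigma> r \<in> ball (state c \<gamma> t) d"
    by eventually_elim (simp add: eq dist_commute)
  then obtain e where e: "e > 0" "\<And>r. dist r t < e \<Longrightarrow> \<gamma> r \<in> fst c \<and> \<sigma> r \<in> fst c \<and>
      state c \<gamma> r \<in> ball (state c \<gamma> t) d \<and> state c \<sigma> r \<in> ball (state c \<gamma> t) d"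
    unfolding eventually_nhds_metric by blast
  show ?thesis
  proof (intro exI[of _ "t + e/2"] conjI allI impI)
    show "t < t + e / 2" using e by simp
    fix r assume r: "t < r \<and> r \<le> t + e / 2"
    have near: "\<gamma> q \<in> fst c \<and> \<sigma> q \<in> fst c \<and>
      state c \<gamma> q \<in> ball (state c \<gamma> t) d \<and> state c \<sigma> q \<in> ball (state c \<gamma> t) d" if "q \<in> {t..r}" for q
      by (rule e(2)) (use that r e in \<open>auto simp: dist_real_def\<close>)
    have "norm (state c \<gamma> r - state c \<sigma> r) \<le>
      (norm (state c \<gamma> t - state c \<sigma> t) + 0 * (r - t)) * exp (C * (r - t))"
    proof (rule gronwall[where b = r and D' = "\<lambda>q. spray c (state c \<gamma> q) - spray c (state c \<sigma> q)" and D = "\<lambda>q. state c \<gamma> q - state c \<sigma> q"])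
      fix q assume q: "q \<in> {t..r}"
      show "((\<lambda>q. state c \<gamma> q - state c \<sigma> q) has_vector_derivative
          spray c (state c \<gamma> q) - spray c (state c \<sigma> q)) (at q within {t..r})"
        using near[OF q]
        by (intro has_vector_derivative_diff has_vector_derivative_at_within[OF state_derivative[OF g c(1)]]
            has_vector_derivative_at_within[OF state_derivative[OF s c(1)]]) auto
      show "norm (spray c (state c \<gamma> q) - spray c (state c \<sigma> q)) \<le> C * norm (state c \<gamma> q - state c \<sigma> q) + 0"
        using C(3) near[OF q] by simp
    qed (use C r in auto)
    then have st: "state c \<gamma> r = state c \<sigma> r" by (simp add: eq)
    have in_c: "\<gamma> r \<in> fst c" "\<sigma> r \<in> fst c" using near[of r] r by auto
    have "snd c (\<gamma> r) = snd c (\<sigma> r)" using st by (simp add: state_def)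
    then show eqr: "\<gamma> r = \<sigma> r"
      using chart_inv_left[OF c(1) in_c(1)] chart_inv_left[OF c(1) in_c(2)] by metis
    have "velocity M \<gamma> r = coord_change c (chart_at M (\<gamma> r)) (\<gamma> r) (chart_vel c \<gamma> r)"
      unfolding velocity_eq_chart_vel by (rule chart_vel_change[OF g c(1) in_c(1) chart_at_in in_chart_at])
    moreover have "velocity M \<sigma> r = coord_change c (chart_at M (\<sigma> r)) (\<sigma> r) (chart_vel c \<sigma> r)"
      unfolding velocity_eq_chart_vel by (rule chart_vel_change[OF s c(1) in_c(2) chart_at_in in_chart_at])
    moreover have "chart_vel c \<gamma> r = chart_vel c \<sigma> r" using st by (simp add: state_def)
    ultimately show "velocity M \<gamma> r = velocity M \<sigma> r" using eqr by simp
  qed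
qed

text \<open>Positions agree at \<open>t\<close> because limits are unique in a Hausdorff space.
  Velocities do not converge in the selected charts, so they are first rewritten in the one chart
  chosen at the limit point.\<close>

lemma geodesic_closed_agreement:
  assumes g: "geodesic M \<gamma>" and s: "geodesic M \<sigma>" and "a < t"
    and eq: "\<And>r. a \<le> r \<Longrightarrow> r < t \<Longrightarrow> \<gamma> r = \<sigma> r \<and> velocity M \<gamma> r = velocity M \<sigma> r"
  shows "\<gamma> t = \<sigma> t \<and> velocity M \<gamma> t = velocity M \<sigma> t"
proof -
  have nt: "at t within {a..<t} \<noteq> bot" using \<open>a < t\<close> by (simp add: trivial_limit_within islimpt_Ico)
  have ev: "\<forall>\<^sub>F r in at t within {a..<t}. \<gamma> r = \<sigma> r \<and> velocity M \<gamma> r = velocity M \<sigma> r"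
    unfolding eventually_at_filter by (intro always_eventually) (use eq in auto)
  have "(\<gamma> \<longlongrightarrow> \<gamma> t) (at t within {a..<t})" "(\<sigma> \<longlongrightarrow> \<sigma> t) (at t within {a..<t})"
    using geodesic_continuous g s by (auto simp: continuous_within)
  moreover have "(\<gamma> \<longlongrightarrow> \<sigma> t) (at t within {a..<t}) = (\<sigma> \<longlongrightarrow> \<sigma> t) (at t within {a..<t})"
    by (rule tendsto_cong) (use ev in \<open>auto elim: eventually_mono\<close>)
  ultimately have pt: "\<gamma> t = \<sigma> t" using tendsto_unique[OF nt] by blast
  define c where "c = chart_at M (\<gamma> t)"
  have c: "c \<in> atlas M" "\<gamma> t \<in> fst c" "\<sigma> t \<in> fst c"
    using chart_at_in in_chart_at[of "\<gamma> t"] pt by (auto simp: c_def)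
  have "(state c \<gamma> \<longlongrightarrow> state c \<gamma> t) (at t within {a..<t})" "(state c \<sigma> \<longlongrightarrow> state c \<sigma> t) (at t within {a..<t})"
    using state_continuous[OF g c(1,2)] state_continuous[OF s c(1,3)]
    unfolding isCont_def by (auto intro: tendsto_within_subset)
  moreover have "(state c \<gamma> \<longlongrightarrow> state c \<sigma> t) (at t within {a..<t}) = (state c \<sigma> \<longlongrightarrow> state c \<sigma> t) (at t within {a..<t})"
  proof (rule tendsto_cong)
    show "\<forall>\<^sub>F r in at t within {a..<t}. state c \<gamma> r = state c \<sigma> r"
      using ev eventually_in_chart[OF geodesic_continuous[OF g] c(1,2)]
    proof eventually_elim
      case (elim r)
      then have "chart_vel c \<gamma> r = coord_change (chart_at M (\<gamma> r)) c (\<gamma> r) (velocity M \<gamma> r)"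
        "chart_vel c \<sigma> r = coord_change (chart_at M (\<sigma> r)) c (\<sigma> r) (velocity M \<sigma> r)"
        unfolding velocity_eq_chart_vel
        by (intro chart_vel_change g s chart_at_in in_chart_at c; simp)+
      then show ?case using elim by (simp add: state_def)
    qed
  qed
  ultimately have "state c \<gamma> t = state c \<sigma> t" using tendsto_unique[OF nt] by blast
  then show ?thesis using pt by (simp add: state_def velocity_eq_chart_vel c_def)
qed

lemma geodesic_unique_forward:
  assumes g: "geodesic M \<gamma>" and s: "geodesic M \<sigma>" and 0: "\<gamma> 0 = \<sigma> 0" "velocity M \<gamma> 0 = velocity M \<sigma> 0"
    and t: "t \<ge> 0"
  shows "\<gamma> t = \<sigma> t"
proof -
  have "\<forall>r\<in>{0..t}. \<gamma> r = \<sigma> r \<and> velocity M \<gamma> r = velocity M \<sigma> r"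
  proof (induction rule: real_interval_induct[OF t])
    case 1
    then show ?case using 0 by simp
  next
    case (2 r)
    then have "\<gamma> r = \<sigma> r" "velocity M \<gamma> r = velocity M \<sigma> r" by auto
    from geodesic_forward_local_unique[OF g s this] show ?case by blast
  next
    case (3 r)
    show ?case by (rule geodesic_closed_agreement[OF g s]) (use 3 in auto)
  qed
  then show ?thesis using t by simp
qed

lemma geodesic_unique:
  assumes g: "geodesic M \<gamma>" and s: "geodesic M \<sigma>" and 0: "\<gamma> 0 = \<sigma> 0" "velocity M \<gamma> 0 = velocity M \<sigma> 0"
  shows "\<gamma> = \<sigma>"
proof
  fix t
  show "\<gamma> t = \<sigma> t"
  proof (cases "t \<ge> 0")
    case True
    then show ?thesis using geodesic_unique_forward[OF g s 0] by simp
  next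
    case False
    \<comment> \<open>Past times are future times of the reversed geodesics; the odd shape matches
      \<open>geodesic_affine\<close>.\<close>
    have "\<gamma> (-1 * (- t) + 0) = \<sigma> (-1 * (- t) + 0)"
      by (rule geodesic_unique_forward[of "\<lambda>t. \<gamma> (-1 * t + 0)" "\<lambda>t. \<sigma> (-1 * t + 0)"])
        (use False 0 in \<open>simp_all only: geodesic_affine(1)[OF g] geodesic_affine(1)[OF s]
          velocity_affine[OF g] velocity_affine[OF s], simp_all\<close>)
    then show ?thesis by simp
  qed
qed

lemma metric_velocity:
  assumes "geodesic M \<gamma>" "c \<in> atlas M" "\<gamma> t \<in> fst c"
  shows "metric M (\<gamma> t) (velocity M \<gamma> t) (velocity M \<gamma> t) =
    metric_in M c (snd c (\<gamma> t)) (chart_vel c \<gamma> t) (chart_vel c \<gamma> t)"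
proof -
  have "velocity M \<gamma> t = coord_change c (chart_at M (\<gamma> t)) (\<gamma> t) (chart_vel c \<gamma> t)"
    unfolding velocity_eq_chart_vel by (rule chart_vel_change[OF assms chart_at_in in_chart_at])
  then show ?thesis using assms by (simp only: metric_in_eq)
qed

text \<open>The derivative of the squared speed in a chart vanishes by compatibility of the metric
  with the connection. The squared speed does not depend on the chart, so the local computation
  gives a derivative at every time.\<close>

lemma geodesic_constant_speed:
  assumes g: "geodesic M \<gamma>"
  shows "metric M (\<gamma> t) (velocity M \<gamma> t) (velocity M \<gamma> t) = metric M (\<gamma> 0) (velocity M \<gamma> 0) (velocity M \<gamma> 0)"
proof -
  define E where "E t = metric M (\<gamma> t) (velocity M \<gamma> t) (velocity M \<gamma> t)" for t
  have "(E has_vector_derivative 0) (at t)" for t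
  proof -
    define c where "c = chart_at M (\<gamma> t)"
    have c: "c \<in> atlas M" "\<gamma> t \<in> fst c" using chart_at_in in_chart_at[of "\<gamma> t"] by (auto simp: c_def)
    have y: "(snd c \<circ> \<gamma>) t \<in> chart_image c" using c by simp
    define y where "y = snd c (\<gamma> t)"
    define w where "w = chart_vel c \<gamma> t"
    have yi: "y \<in> chart_image c" using c by (simp add: y_def)
    have "((\<lambda>s. metric_in M c ((snd c \<circ> \<gamma>) s) (chart_vel c \<gamma> s) (chart_vel c \<gamma> s)) has_vector_derivative
      metric_deriv M c y w w w + metric_in M c y (- christoffel M c y w w) w
      + metric_in M c y w (- christoffel M c y w w)) (at t)"
      using bilinear_family.has_vector_derivative_along[OF metric_family[OF c(1)] geodesic_position[OF g c] y
        geodesic_equation[OF g c] geodesic_equation[OF g c]] by (simp add: y_def w_def)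
    moreover have "metric_deriv M c y w w w + metric_in M c y (- christoffel M c y w w) w
      + metric_in M c y w (- christoffel M c y w w) = 0"
      using bilinear_metric_in[OF c(1) yi] by (simp add: metric_compatible[OF c(1) yi] bilinear_lneg bilinear_rneg)
    ultimately have "((\<lambda>s. metric_in M c ((snd c \<circ> \<gamma>) s) (chart_vel c \<gamma> s) (chart_vel c \<gamma> s)) has_vector_derivative 0) (at t)"
      by simp
    then show ?thesis unfolding has_vector_derivative_def
    proof (rule has_derivative_transform_eventually)
      show "\<forall>\<^sub>F s in at t. metric_in M c ((snd c \<circ> \<gamma>) s) (chart_vel c \<gamma> s) (chart_vel c \<gamma> s) = E s"
        using eventually_in_chart[OF geodesic_continuous[OF g] c]
        by eventually_elim (simp add: E_def metric_velocity[OF g c(1)])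
    qed (use c in \<open>simp_all add: E_def metric_velocity[OF g]\<close>)
  qed
  then have "E t = E 0"
    by (intro DERIV_isconst_all) (simp add: has_real_derivative_iff_has_vector_derivative)
  then show ?thesis by (simp add: E_def)
qed

end

locale complete_riemannian = riemannian +
  assumes complete: "geodesically_complete M"
begin

definition geo :: "'a \<Rightarrow> 'b \<Rightarrow> real \<Rightarrow> 'a" where
  "geo p v = (THE \<gamma>. geodesic M \<gamma> \<and> \<gamma> 0 = p \<and> velocity M \<gamma> 0 = v)"

lemma geo: "geodesic M (geo p v)" "geo p v 0 = p" "velocity M (geo p v) 0 = v"
proof -
  have "\<exists>!\<gamma>. geodesic M \<gamma> \<and> \<gamma> 0 = p \<and> velocity M \<gamma> 0 = v"
    using complete geodesic_unique unfolding geodesically_complete_def by metis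
  from theI'[OF this] show "geodesic M (geo p v)" "geo p v 0 = p" "velocity M (geo p v) 0 = v"
    by (simp_all add: geo_def)
qed

lemma geo_unique: "geodesic M \<gamma> \<Longrightarrow> \<gamma> 0 = p \<Longrightarrow> velocity M \<gamma> 0 = v \<Longrightarrow> \<gamma> = geo p v"
  using geodesic_unique[OF _ geo(1)] geo(2,3) by simp

lemma expmap_eq: "expmap M p v = geo p v 1"
  unfolding expmap_def
proof (rule the_equality)
  show "\<exists>\<gamma>. geodesic M \<gamma> \<and> \<gamma> 0 = p \<and> velocity M \<gamma> 0 = v \<and> \<gamma> 1 = geo p v 1"
    by (intro exI[of _ "geo p v"] conjI geo refl)
  fix q assume "\<exists>\<gamma>. geodesic M \<gamma> \<and> \<gamma> 0 = p \<and> velocity M \<gamma> 0 = v \<and> \<gamma> 1 = q"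
  then obtain \<gamma> where "geodesic M \<gamma>" "\<gamma> 0 = p" "velocity M \<gamma> 0 = v" "\<gamma> 1 = q" by blast
  then show "q = geo p v 1" using geo_unique[of \<gamma> p v] by simp
qed

lemma geo_scale: "geo p (r *\<^sub>R v) t = geo p v (r * t)"
proof -
  have "(\<lambda>s. geo p v (r * s + 0)) = geo p (r *\<^sub>R v)"
    by (rule geo_unique) (simp_all only: geodesic_affine(1)[OF geo(1)] velocity_affine[OF geo(1)], simp_all add: geo)
  from fun_cong[OF this, of t] show ?thesis by simp
qed

lemma expmap_scale: "expmap M p (t *\<^sub>R v) = geo p v t"
  by (simp add: expmap_eq geo_scale)

lemma expmap_zero: "expmap M p 0 = p"
  using expmap_scale[of p 0 0] by (simp add: geo)

lemma ray_eq: "ray M p v t = geo p v t"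
  by (simp add: ray_def expmap_scale)

lemma geo_shift: "geo (geo p v t) (velocity M (geo p v) t) s = geo p v (t + s)"
proof -
  have "(\<lambda>s. geo p v (1 * s + t)) = geo (geo p v t) (velocity M (geo p v) t)"
    by (rule geo_unique) (simp_all only: geodesic_affine(1)[OF geo(1)] velocity_affine[OF geo(1)], simp_all)
  from fun_cong[OF this, of s] show ?thesis by (simp add: add.commute)
qed

lemma tnorm_velocity_geo: "tnorm M (geo p v t) (velocity M (geo p v) t) = tnorm M p v"
  using geodesic_constant_speed[OF geo(1), of p v t] by (simp add: tnorm_def geo)

end

section \<open>Dependence of geodesics on the initial velocity\<close>

context complete_riemannian
begin

text \<open>Solutions are confined to the domain of \<open>c\<close>. A geodesic whose coordinates
  remain in a compact part of the chart image cannot leave this domain: the corresponding part of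
  the manifold is compact, hence closed, and contains the limit.\<close>

lemma geo_flow_in_chart:
  assumes c: "c \<in> atlas M" and ab: "a \<le> b" and inc: "\<And>t. t \<in> {a..b} \<Longrightarrow> geo p v0 t \<in> fst c"
    and ev: "\<forall>\<^sub>F v in nhds v0. geo p v a \<in> fst c"
    and init: "strict_deriv (\<lambda>v. state c (geo p v) a) L v0"
  shows "\<exists>L'. L' a = L \<and>
    (\<forall>t\<in>{a..b}. (\<forall>\<^sub>F v in nhds v0. geo p v t \<in> fst c) \<and> strict_deriv (\<lambda>v. state c (geo p v) t) (L' t) v0) \<and>
    (\<forall>t\<in>{a..b}. \<forall>\<xi>. ((\<lambda>t. L' t \<xi>) has_vector_derivative spray_deriv c (state c (geo p v0) t) (L' t \<xi>)) (at t within {a..b}))"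
proof (rule ode_strict_deriv_parameter[where In = "\<lambda>v t. geo p v t \<in> fst c" and x = "\<lambda>v. state c (geo p v)",
      OF C1_spray[OF c] _ ab inc _ _ _ ev init])
  show "open (chart_image c \<times> (UNIV :: 'b set))" by (intro open_Times open_chart_image c open_UNIV)
next
  fix v t assume "t \<in> {a..b}" "geo p v t \<in> fst c"
  then show "state c (geo p v) t \<in> chart_image c \<times> UNIV \<and>
      (state c (geo p v) has_vector_derivative spray c (state c (geo p v) t)) (at t within {a..b})"
    using has_vector_derivative_at_within[OF state_derivative[OF geo(1) c]] by (auto simp: state_def)
next
  fix v t assume "geo p v t \<in> fst c"
  from geodesic_eventually_in_chart[OF geo(1) c this]
  show "\<exists>e>0. \<forall>s\<in>{a..b}. \<bar>s - t\<bar> < e \<longrightarrow> geo p v s \<in> fst c"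
    unfolding eventually_nhds_metric dist_real_def by blast
next
  fix v t K assume t: "a < t" "t \<le> b" and K: "compact K" "K \<subseteq> chart_image c \<times> UNIV"
    and s: "\<And>s. a \<le> s \<Longrightarrow> s < t \<Longrightarrow> geo p v s \<in> fst c \<and> state c (geo p v) s \<in> K"
  define C where "C = chart_inv c ` fst ` K"
  have sub: "fst ` K \<subseteq> chart_image c" using K by auto
  have "compact C" unfolding C_def
    by (intro compact_continuous_image K continuous_on_subset[OF continuous_on_chart_inv[OF c] sub] continuous_intros)
  then have "closed C" by (rule compact_imp_closed)
  moreover have "geo p v s \<in> C" if "a \<le> s" "s < t" for s
  proof -
    have "geo p v s = chart_inv c (fst (state c (geo p v) s))"
      using s[OF that] by (simp add: state_def chart_inv_left[OF c])
    then show ?thesis using s[OF that] unfolding C_def by blast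
  qed
  then have "\<forall>\<^sub>F s in at t within {a..<t}. geo p v s \<in> C"
    unfolding eventually_at_filter by (intro always_eventually) auto
  moreover have "at t within {a..<t} \<noteq> bot" using t by (simp add: trivial_limit_within islimpt_Ico)
  moreover have "(geo p v \<longlongrightarrow> geo p v t) (at t within {a..<t})"
    using geodesic_continuous[OF geo(1)] by (simp add: continuous_within)
  ultimately have "geo p v t \<in> C" by (rule Lim_in_closed_set)
  then show "geo p v t \<in> fst c" using sub chart_inv_in[OF c] by (auto simp: C_def)
qed

text \<open>Coordinates in \<open>c\<close> say nothing outside the domain of \<open>c\<close>;
  therefore nearby geodesics are required to be in the domain at time \<open>t\<close> as
  well.\<close>

definition flow_diff :: "'a \<Rightarrow> 'b \<Rightarrow> ('a, 'b) chart \<Rightarrow> real \<Rightarrow> bool" where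
  "flow_diff p v0 c t \<longleftrightarrow> (\<forall>\<^sub>F v in nhds v0. geo p v t \<in> fst c) \<and>
    (\<exists>L. strict_deriv (\<lambda>v. state c (geo p v) t) L v0)"

text \<open>Convergence in the manifold itself, which brings nearby geodesics into the domain of any
  other chart around the limit point.\<close>

lemma flow_diff_tendsto:
  assumes c: "c \<in> atlas M" and x: "geo p v0 t \<in> fst c" and fd: "flow_diff p v0 c t"
  shows "((\<lambda>v. geo p v t) \<longlongrightarrow> geo p v0 t) (nhds v0)"
proof -
  obtain L where "strict_deriv (\<lambda>v. state c (geo p v) t) L v0" using fd by (auto simp: flow_diff_def)
  then have "((\<lambda>v. state c (geo p v) t) \<longlongrightarrow> state c (geo p v0) t) (nhds v0)"
    using strict_deriv_isCont tendsto_at_iff_tendsto_nhds[of "\<lambda>v. state c (geo p v) t" v0]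
    by (auto simp: isCont_def)
  then have "((\<lambda>v. fst (state c (geo p v) t)) \<longlongrightarrow> fst (state c (geo p v0) t)) (nhds v0)"
    by (rule tendsto_fst)
  then have "((\<lambda>v. snd c (geo p v t)) \<longlongrightarrow> snd c (geo p v0 t)) (nhds v0)" by (simp add: state_def)
  moreover have "isCont (chart_inv c) (snd c (geo p v0 t))"
    using continuous_on_chart_inv[OF c] open_chart_image[OF c] x by (simp add: continuous_on_eq_continuous_at)
  ultimately have "((\<lambda>v. chart_inv c (snd c (geo p v t))) \<longlongrightarrow> chart_inv c (snd c (geo p v0 t))) (nhds v0)"
    by (rule isCont_tendsto_compose[rotated])
  moreover have "\<forall>\<^sub>F v in nhds v0. chart_inv c (snd c (geo p v t)) = geo p v t"
    using fd unfolding flow_diff_def by (auto elim!: eventually_mono simp: chart_inv_left[OF c])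
  ultimately show ?thesis
    using tendsto_cong chart_inv_left[OF c x] by fastforce
qed

lemma flow_diff_change_chart:
  assumes c: "c \<in> atlas M" "geo p v0 t \<in> fst c" and d: "d \<in> atlas M" "geo p v0 t \<in> fst d"
    and fd: "flow_diff p v0 c t"
  shows "flow_diff p v0 d t"
proof -
  have ed: "\<forall>\<^sub>F v in nhds v0. geo p v t \<in> fst d"
    by (rule topological_tendstoD[OF flow_diff_tendsto[OF c fd] open_chart[OF d(1)] d(2)])
  have ec: "\<forall>\<^sub>F v in nhds v0. geo p v t \<in> fst c" using fd by (simp add: flow_diff_def)
  obtain L where L: "strict_deriv (\<lambda>v. state c (geo p v) t) L v0" using fd by (auto simp: flow_diff_def)
  have "snd c (geo p v0 t) \<in> snd c ` (fst c \<inter> fst d)" using c d by blast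
  then obtain K where "strict_deriv (tangent_transition c d) K (state c (geo p v0) t)"
    unfolding state_def using tangent_transition_strict_deriv[OF c(1) d(1)] by blast
  from strict_deriv_compose[OF L this]
  have "strict_deriv (\<lambda>v. tangent_transition c d (state c (geo p v) t)) (\<lambda>v. K (L v)) v0" .
  then have "strict_deriv (\<lambda>v. state d (geo p v) t) (\<lambda>v. K (L v)) v0"
  proof (rule strict_deriv_transform)
    show "\<forall>\<^sub>F v in nhds v0. tangent_transition c d (state c (geo p v) t) = state d (geo p v) t"
      using ec ed by eventually_elim (simp add: state_change[OF geo(1) c(1) _ d(1)])
  qed
  then show ?thesis using ed by (auto simp: flow_diff_def)
qed

lemma state_geo_0:
  assumes c: "c \<in> atlas M" "p \<in> fst c"
  shows "state c (geo p v) 0 = (snd c p, coord_change (chart_at M p) c p v)"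
  using chart_vel_change[OF geo(1) chart_at_in in_chart_at c(1), of p v 0] c geo
  by (simp add: state_def velocity_eq_chart_vel[symmetric] velocity_def chart_vel_def)

lemma flow_diff_0:
  assumes c: "c \<in> atlas M" "p \<in> fst c"
  shows "strict_deriv (\<lambda>v. state c (geo p v) 0) (\<lambda>v. (0, coord_change (chart_at M p) c p v)) v0"
proof -
  have lin: "linear (coord_change (chart_at M p) c p)"
    by (intro linear_coord_change chart_at_in in_chart_at c)
  then have "bounded_linear (\<lambda>v. (0 :: 'b, coord_change (chart_at M p) c p v))"
    by (intro bounded_linear_Pair bounded_linear_zero) (simp add: linear_conv_bounded_linear)
  then show ?thesis
    unfolding strict_deriv_def state_geo_0[OF c] using lin
    by (auto simp: linear_diff intro!: exI[of _ "1 :: real"])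
qed

text \<open>Differentiability at one time passes to later times within a chart, and at one time from
  chart to chart. Continuous induction combines the two along the whole geodesic.\<close>

lemma flow_diff_all:
  assumes T: "T \<ge> 0" and c: "c \<in> atlas M" "geo p v0 T \<in> fst c"
  shows "flow_diff p v0 c T"
proof -
  \<comment> \<open>The quantifier over all charts lets each step of the induction use the chart
    selected at its own point.\<close>
  define P where "P t \<longleftrightarrow> (\<forall>c\<in>atlas M. geo p v0 t \<in> fst c \<longrightarrow> flow_diff p v0 c t)" for t
  have one: "P t" if "d \<in> atlas M" "geo p v0 t \<in> fst d" "flow_diff p v0 d t" for d t
    using flow_diff_change_chart that unfolding P_def by blast
  have step: "P t" if a: "0 \<le> a" "P a" "a \<le> t" and d: "d \<in> atlas M"
    and inc: "\<And>s. a \<le> s \<Longrightarrow> s \<le> t \<Longrightarrow> geo p v0 s \<in> fst d" for a t d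
  proof -
    have "flow_diff p v0 d a" using a d inc unfolding P_def by simp
    then obtain L where "\<forall>\<^sub>F v in nhds v0. geo p v a \<in> fst d" "strict_deriv (\<lambda>v. state d (geo p v) a) L v0"
      by (auto simp: flow_diff_def)
    from geo_flow_in_chart[OF d a(3) _ this] inc have "flow_diff p v0 d t"
      using a(3) unfolding flow_diff_def by fastforce
    then show ?thesis using one d inc a by blast
  qed
  have near: "\<exists>e>0. \<forall>s. \<bar>s - t\<bar> < e \<longrightarrow> geo p v0 s \<in> fst (chart_at M (geo p v0 t))" for t
    using geodesic_eventually_in_chart[OF geo(1) chart_at_in in_chart_at, of p v0 t]
    unfolding eventually_nhds_metric dist_real_def by blast
  have "\<forall>t\<in>{0..T}. P t"
  proof (induction rule: real_interval_induct[OF T])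
    case 1
    show ?case unfolding P_def flow_diff_def geo(2) using flow_diff_0 by (simp add: eventually_const_iff) blast
  next
    case (2 t)
    obtain e where e: "e > 0" "\<forall>s. \<bar>s - t\<bar> < e \<longrightarrow> geo p v0 s \<in> fst (chart_at M (geo p v0 t))"
      using near by blast
    have "P s" if "t < s" "s \<le> t + e / 2" for s
      by (rule step[OF _ _ _ chart_at_in[of "geo p v0 t"]]) (use 2 e that in auto)
    then show ?case using e(1) by (intro exI[of _ "t + e / 2"]) auto
  next
    case (3 t)
    obtain e where e: "e > 0" "\<forall>s. \<bar>s - t\<bar> < e \<longrightarrow> geo p v0 s \<in> fst (chart_at M (geo p v0 t))"
      using near by blast
    define a where "a = max 0 (t - e / 2)"
    show ?case
      by (rule step[of a, OF _ _ _ chart_at_in[of "geo p v0 t"]]) (use 3 e in \<open>auto simp: a_def\<close>)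
  qed
  then show ?thesis using T c unfolding P_def by auto
qed

lemma geo_tendsto:
  assumes "t \<ge> 0"
  shows "((\<lambda>v. geo p v t) \<longlongrightarrow> geo p v0 t) (nhds v0)"
  by (rule flow_diff_tendsto[OF chart_at_in in_chart_at flow_diff_all[OF assms chart_at_in in_chart_at]])

text \<open>Its components are a Jacobi field and the derivative of its coordinates, not the
  covariant derivative.\<close>

definition flow_deriv :: "'a \<Rightarrow> 'b \<Rightarrow> ('a, 'b) chart \<Rightarrow> real \<Rightarrow> 'b \<Rightarrow> 'b \<times> 'b" where
  "flow_deriv p v c t = frechet_derivative (\<lambda>v. state c (geo p v) t) (at v)"

lemma flow_deriv_eqI: "strict_deriv (\<lambda>v. state c (geo p v) t) L v \<Longrightarrow> L = flow_deriv p v c t"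
  unfolding flow_deriv_def by (rule frechet_derivative_at[OF strict_deriv_has_derivative])

lemma flow_strict_deriv:
  assumes "t \<ge> 0" "c \<in> atlas M" "geo p v t \<in> fst c"
  shows "strict_deriv (\<lambda>v. state c (geo p v) t) (flow_deriv p v c t) v"
  using flow_diff_all[OF assms] flow_deriv_eqI unfolding flow_diff_def by metis

lemma flow_deriv_0:
  assumes c: "c \<in> atlas M" "p \<in> fst c"
  shows "flow_deriv p v c 0 \<xi> = (0, coord_change (chart_at M p) c p \<xi>)"
  using flow_deriv_eqI[OF flow_diff_0[OF c]] by metis

lemma flow_deriv_ode:
  assumes a: "0 \<le> a" "a \<le> b" and c: "c \<in> atlas M" and inc: "\<And>t. t \<in> {a..b} \<Longrightarrow> geo p v t \<in> fst c"
    and t: "t \<in> {a..b}"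
  shows "((\<lambda>t. flow_deriv p v c t \<xi>) has_vector_derivative
    spray_deriv c (state c (geo p v) t) (flow_deriv p v c t \<xi>)) (at t within {a..b})"
proof -
  have ia: "geo p v a \<in> fst c" using inc a by simp
  have ev: "\<forall>\<^sub>F u in nhds v. geo p u a \<in> fst c"
    using flow_diff_all[OF a(1) c ia] by (simp add: flow_diff_def)
  from geo_flow_in_chart[OF c a(2) inc ev flow_strict_deriv[OF a(1) c ia]]
  obtain L' where L': "\<And>t. t \<in> {a..b} \<Longrightarrow> strict_deriv (\<lambda>v. state c (geo p v) t) (L' t) v"
    "\<And>t. t \<in> {a..b} \<Longrightarrow> ((\<lambda>t. L' t \<xi>) has_vector_derivative spray_deriv c (state c (geo p v) t) (L' t \<xi>)) (at t within {a..b})"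
    by blast
  have eq: "L' s = flow_deriv p v c s" if "s \<in> {a..b}" for s by (rule flow_deriv_eqI[OF L'(1)[OF that]])
  from has_vector_derivative_transform[OF t _ L'(2)[OF t], of "\<lambda>t. flow_deriv p v c t \<xi>"] eq t
  show ?thesis by simp
qed

text \<open>The Jacobi field along \<open>geo p v\<close> that vanishes at time 0 and has initial
  derivative \<open>\<xi>\<close>. At time 1 it is the differential of the exponential map at
  \<open>v\<close>.\<close>

definition jacobi :: "'a \<Rightarrow> 'b \<Rightarrow> ('a, 'b) chart \<Rightarrow> real \<Rightarrow> 'b \<Rightarrow> 'b" where
  "jacobi p v c t \<xi> = fst (flow_deriv p v c t \<xi>)"

lemma jacobi_strict_deriv:
  assumes "t \<ge> 0" "c \<in> atlas M" "geo p v t \<in> fst c"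
  shows "strict_deriv (\<lambda>v. snd c (geo p v t)) (jacobi p v c t) v"
  using strict_deriv_compose[OF flow_strict_deriv[OF assms] strict_deriv_linear[OF bounded_linear_fst]]
  by (simp add: state_def jacobi_def[abs_def])

lemma jacobi_change_chart:
  assumes t: "t \<ge> 0" and c: "c \<in> atlas M" "geo p v t \<in> fst c" and d: "d \<in> atlas M" "geo p v t \<in> fst d"
  shows "jacobi p v d t \<xi> = coord_change c d (geo p v t) (jacobi p v c t \<xi>)"
proof -
  have "((snd d \<circ> chart_inv c) has_derivative coord_change c d (geo p v t)) (at (snd c (geo p v t)))"
    by (rule transition_has_derivative) (use c d in auto)
  from has_derivative_compose[OF strict_deriv_has_derivative[OF jacobi_strict_deriv[OF t c]] this]
  have "((\<lambda>v. (snd d \<circ> chart_inv c) (snd c (geo p v t))) has_derivative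
      (\<lambda>\<xi>. coord_change c d (geo p v t) (jacobi p v c t \<xi>))) (at v)" .
  moreover have "\<forall>\<^sub>F u in nhds v. (snd d \<circ> chart_inv c) (snd c (geo p u t)) = snd d (geo p u t)"
    using flow_diff_all[OF t c] unfolding flow_diff_def
    by (auto elim!: eventually_mono simp: chart_inv_left[OF c(1)])
  then have "\<forall>\<^sub>F u in at v. (snd d \<circ> chart_inv c) (snd c (geo p u t)) = snd d (geo p u t)"
    by (simp add: eventually_nhds_conv_at)
  ultimately have "((\<lambda>v. snd d (geo p v t)) has_derivative
      (\<lambda>\<xi>. coord_change c d (geo p v t) (jacobi p v c t \<xi>))) (at v)"
    by (rule has_derivative_transform_eventually) (use c in \<open>auto simp: chart_inv_left\<close>)
  from has_derivative_unique[OF this strict_deriv_has_derivative[OF jacobi_strict_deriv[OF t d]]]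
  show ?thesis by metis
qed

end

section \<open>Jacobi fields in nonpositive curvature\<close>

text \<open>The vector is \<open>B v v\<close> times the part of \<open>u\<close> orthogonal to
  \<open>v\<close>. The identity gives the Cauchy-Schwarz inequality and, for independent vectors, a
  positive Gram determinant.\<close>

lemma posdef_gap:
  fixes B :: "'e::real_vector \<Rightarrow> 'e \<Rightarrow> real"
  assumes B: "bilinear B" and sym: "\<And>u v. B u v = B v u"
  shows "B (B v v *\<^sub>R u - B u v *\<^sub>R v) (B v v *\<^sub>R u - B u v *\<^sub>R v) = B v v * (B u u * B v v - (B u v)\<^sup>2)"
proof -
  have "B v u = B u v" by (rule sym)
  then show ?thesis
    using B by (simp add: bilinear_lsub bilinear_rsub bilinear_lmul bilinear_rmul power2_eq_square algebra_simps)
qed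

lemma posdef_cauchy_schwarz:
  fixes B :: "'e::real_vector \<Rightarrow> 'e \<Rightarrow> real"
  assumes B: "bilinear B" and sym: "\<And>u v. B u v = B v u" and pos: "\<And>u. u \<noteq> 0 \<Longrightarrow> B u u > 0"
  shows "(B u v)\<^sup>2 \<le> B u u * B v v"
proof (cases "v = 0")
  case False
  define z where "z = B v v *\<^sub>R u - B u v *\<^sub>R v"
  have "B z z \<ge> 0" using pos[of z] bilinear_lzero[OF B] by (cases "z = 0") auto
  then have "B v v * (B u u * B v v - (B u v)\<^sup>2) \<ge> 0" using posdef_gap[of B v u, OF B sym] by (simp add: z_def)
  then show ?thesis using pos[OF False] by (simp add: zero_le_mult_iff)
qed (simp add: bilinear_rzero[OF B])

lemma deriv_nonneg_mono:
  fixes f :: "real \<Rightarrow> real"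
  assumes "s \<le> t" "\<And>x. s \<le> x \<Longrightarrow> x \<le> t \<Longrightarrow> (f has_real_derivative f' x) (at x)"
    "\<And>x. s \<le> x \<Longrightarrow> x \<le> t \<Longrightarrow> f' x \<ge> 0"
  shows "f s \<le> f t"
  using DERIV_nonneg_imp_nondecreasing[OF assms(1), of f] assms(2,3) by blast

text \<open>The hypothesis says that \<open>sqrt \<phi>\<close> is convex, hence \<open>sqrt (\<phi> t) / t\<close> is increasing.\<close>

lemma convex_sqrt_growth:
  fixes \<phi> \<phi>' \<phi>'' :: "real \<Rightarrow> real"
  assumes d1: "\<And>t. t > 0 \<Longrightarrow> (\<phi> has_real_derivative \<phi>' t) (at t)"
    and d2: "\<And>t. t > 0 \<Longrightarrow> (\<phi>' has_real_derivative \<phi>'' t) (at t)"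
    and nonneg: "\<And>t. t > 0 \<Longrightarrow> \<phi> t \<ge> 0" "\<And>t. t > 0 \<Longrightarrow> \<phi>'' t \<ge> 0"
    and cs: "\<And>t. t > 0 \<Longrightarrow> (\<phi>' t)\<^sup>2 \<le> 2 * \<phi> t * \<phi>'' t"
    and lim: "((\<lambda>t. \<phi> t / t\<^sup>2) \<longlongrightarrow> m) (at_right 0)" and m: "m > 0"
  shows "\<phi> 1 \<ge> m"
proof -
  have "((\<lambda>t. \<phi> t / t\<^sup>2 * t\<^sup>2) \<longlongrightarrow> m * 0\<^sup>2) (at_right 0)" by (intro tendsto_intros lim)
  moreover have "\<forall>\<^sub>F t in at_right 0. \<phi> t / t\<^sup>2 * t\<^sup>2 = \<phi> t"
    by (auto simp: eventually_at_filter intro!: always_eventually)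
  ultimately have lim0: "(\<phi> \<longlongrightarrow> 0) (at_right 0)" using tendsto_cong by fastforce
  have \<phi>'_mono: "\<phi>' s \<le> \<phi>' t" if "0 < s" "s \<le> t" for s t
    by (rule deriv_nonneg_mono[OF that(2), where f' = \<phi>'']) (use that in \<open>auto intro: d2 nonneg(2)\<close>)
  \<comment> \<open>Since \<open>\<phi>'\<close> is monotone, a negative value would make
    \<open>\<phi>\<close> strictly decreasing up to \<open>t\<close>, which a nonnegative function
    with limit 0 at 0 cannot be.\<close>
  have \<phi>'_nonneg: "\<phi>' t \<ge> 0" if t: "t > 0" for t
  proof (rule ccontr)
    assume "\<not> \<phi>' t \<ge> 0"
    then have neg: "\<phi>' s < 0" if "0 < s" "s \<le> t" for s using \<phi>'_mono[OF that] by simp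
    have dec: "\<phi> r < \<phi> s" if "0 < s" "s < r" "r \<le> t" for s r
    proof (rule DERIV_neg_imp_decreasing[OF that(2)])
      fix x assume "s \<le> x" "x \<le> r"
      then have "0 < x" "x \<le> t" using that by auto
      then show "\<exists>y. (\<phi> has_real_derivative y) (at x) \<and> y < 0" using d1 neg by blast
    qed
    have "\<forall>\<^sub>F s in at_right 0. s < t / 2"
      unfolding eventually_at_right_field using t by (intro exI[of _ "t / 2"]) auto
    then have "\<forall>\<^sub>F s in at_right 0. \<phi> (t / 2) \<le> \<phi> s"
      using eventually_at_right_less[of 0] by eventually_elim (use dec t in \<open>auto intro: less_imp_le\<close>)
    then have "\<phi> (t / 2) \<le> 0" by (rule tendsto_lowerbound[OF lim0]) simp
    then show False using dec[of "t / 2" t] nonneg(1)[OF t] t by simp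
  qed
  have \<phi>_mono: "\<phi> s \<le> \<phi> t" if "0 < s" "s \<le> t" for s t
    by (rule deriv_nonneg_mono[OF that(2), where f' = \<phi>']) (use that in \<open>auto intro: d1 \<phi>'_nonneg\<close>)
  have ev: "\<forall>\<^sub>F t in at_right 0. \<phi> t / t\<^sup>2 > 0" using order_tendstoD(1)[OF lim m] .
  \<comment> \<open>The positive limit of the quotient gives positive values at small times and
    monotonicity carries them on, so the square root is differentiable.\<close>
  have pos: "\<phi> t > 0" if t: "t > 0" for t
  proof -
    have "\<forall>\<^sub>F s in at_right 0. s < t" using t by (auto simp: eventually_at_right_field)
    with ev eventually_at_right_less[of 0]
    have "\<forall>\<^sub>F s in at_right 0. 0 < s \<and> s < t \<and> \<phi> s / s\<^sup>2 > 0" by eventually_elim auto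
    from eventually_happens'[OF _ this] obtain s where "0 < s" "s < t" "\<phi> s / s\<^sup>2 > 0"
      using trivial_limit_at_right_real by blast
    then show ?thesis using \<phi>_mono[of s t] by (simp add: zero_less_divide_iff)
  qed
  define \<psi> where "\<psi> t = sqrt (\<phi> t)" for t
  define \<psi>' where "\<psi>' t = \<phi>' t / (2 * \<psi> t)" for t
  have \<psi>pos: "\<psi> t > 0" if "t > 0" for t using pos[OF that] by (simp add: \<psi>_def)
  have \<psi>sq: "\<psi> t * \<psi> t = \<phi> t" if "t > 0" for t using pos[OF that] by (simp add: \<psi>_def)
  have d\<psi>: "(\<psi> has_real_derivative \<psi>' t) (at t)" if t: "t > 0" for t
  proof -
    have "(\<psi> has_real_derivative inverse (sqrt (\<phi> t)) / 2 * \<phi>' t) (at t)"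
      unfolding \<psi>_def by (rule DERIV_chain2[OF DERIV_real_sqrt[OF pos[OF t]] d1[OF t]])
    then show ?thesis by (simp add: \<psi>'_def \<psi>_def field_simps)
  qed
  \<comment> \<open>The numerator of the second derivative of the square root is nonnegative exactly
    by \<open>cs\<close>.\<close>
  have d\<psi>': "\<exists>y. (\<psi>' has_real_derivative y) (at t) \<and> y \<ge> 0" if t: "t > 0" for t
  proof (intro exI conjI)
    show "(\<psi>' has_real_derivative (\<phi>'' t * (2 * \<psi> t) - \<phi>' t * (2 * \<psi>' t)) / (2 * \<psi> t * (2 * \<psi> t))) (at t)"
      unfolding \<psi>'_def[abs_def] using \<psi>pos[OF t]
      by (intro DERIV_divide d2 t DERIV_cmult) (use d\<psi>[OF t] in \<open>auto simp: \<psi>'_def\<close>)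
    have "\<phi>' t * (2 * \<psi>' t) = (\<phi>' t)\<^sup>2 / \<psi> t" by (simp add: \<psi>'_def power2_eq_square)
    also have "\<dots> \<le> 2 * \<phi> t * \<phi>'' t / \<psi> t" using cs[OF t] \<psi>pos[OF t] by (simp add: divide_right_mono)
    also have "\<dots> = \<phi>'' t * (2 * \<psi> t)" using \<psi>sq[OF t] \<psi>pos[OF t] by (simp add: field_simps)
    finally show "(\<phi>'' t * (2 * \<psi> t) - \<phi>' t * (2 * \<psi>' t)) / (2 * \<psi> t * (2 * \<psi> t)) \<ge> 0"
      using \<psi>pos[OF t] by simp
  qed
  \<comment> \<open>The numerator of the derivative of \<open>\<psi> t / t\<close>. It increases by
    convexity of \<open>\<psi>\<close>, and it is nonnegative because near 0 it is at least
    \<open>- \<psi>\<close>, which tends to 0.\<close>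
  define \<zeta> where "\<zeta> t = t * \<psi>' t - \<psi> t" for t
  have \<zeta>_mono: "\<zeta> s \<le> \<zeta> t" if "0 < s" "s \<le> t" for s t
  proof (rule DERIV_nonneg_imp_nondecreasing[OF that(2)])
    fix x assume "s \<le> x" "x \<le> t"
    then have x: "x > 0" using that by simp
    obtain y where y: "(\<psi>' has_real_derivative y) (at x)" "y \<ge> 0" using d\<psi>'[OF x] by blast
    have "(\<zeta> has_real_derivative x * y) (at x)"
      unfolding \<zeta>_def[abs_def] by (rule derivative_eq_intros y d\<psi>[OF x] refl | simp)+
    then show "\<exists>y. (\<zeta> has_real_derivative y) (at x) \<and> 0 \<le> y" using x y by fastforce
  qed
  have \<psi>0: "((\<lambda>s. - \<psi> s) \<longlongrightarrow> - sqrt 0) (at_right 0)" unfolding \<psi>_def by (intro tendsto_intros lim0)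
  have \<zeta>_nonneg: "\<zeta> t \<ge> 0" if t: "t > 0" for t
  proof -
    have "\<forall>\<^sub>F s in at_right 0. s < t" using t by (auto simp: eventually_at_right_field)
    then have "\<forall>\<^sub>F s in at_right 0. - \<psi> s \<le> \<zeta> t"
      using eventually_at_right_less[of 0]
    proof eventually_elim
      case (elim s)
      have "0 \<le> s * \<psi>' s" using elim \<phi>'_nonneg[of s] \<psi>pos[of s] by (simp add: \<psi>'_def)
      then have "- \<psi> s \<le> \<zeta> s" by (simp add: \<zeta>_def)
      also have "\<dots> \<le> \<zeta> t" using elim by (intro \<zeta>_mono) auto
      finally show ?case .
    qed
    then have "- sqrt 0 \<le> \<zeta> t" by (intro tendsto_upperbound[OF \<psi>0]) auto
    then show ?thesis by simp
  qed
  have Q_mono: "\<psi> s / s \<le> \<psi> 1 / 1" if "0 < s" "s \<le> 1" for s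
  proof (rule DERIV_nonneg_imp_nondecreasing[OF that(2)])
    fix x assume "s \<le> x" "x \<le> 1"
    then have x: "x > 0" using that by simp
    have "((\<lambda>x. \<psi> x / x) has_real_derivative (\<psi>' x * x - \<psi> x * 1) / (x * x)) (at x)"
      using x by (intro DERIV_divide d\<psi> DERIV_ident) auto
    moreover have "(\<psi>' x * x - \<psi> x * 1) / (x * x) \<ge> 0" using \<zeta>_nonneg[OF x] x by (simp add: \<zeta>_def mult.commute)
    ultimately show "\<exists>y. ((\<lambda>x. \<psi> x / x) has_real_derivative y) (at x) \<and> 0 \<le> y" by blast
  qed
  have "((\<lambda>t. sqrt (\<phi> t / t\<^sup>2)) \<longlongrightarrow> sqrt m) (at_right 0)" by (intro tendsto_intros lim)
  moreover have "\<forall>\<^sub>F s in at_right 0. s < (1::real)" by (auto simp: eventually_at_right_field intro: exI[of _ 1])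
  then have "\<forall>\<^sub>F s in at_right 0. sqrt (\<phi> s / s\<^sup>2) \<le> \<psi> 1"
    using eventually_at_right_less[of 0]
    by eventually_elim (use Q_mono in \<open>auto simp: real_sqrt_divide \<psi>_def\<close>)
  ultimately have "sqrt m \<le> \<psi> 1" by (intro tendsto_upperbound) auto
  then show ?thesis by (simp add: \<psi>_def)
qed

context complete_riemannian
begin

lemma christoffel_deriv_sym:
  assumes c: "c \<in> atlas M" and y: "y \<in> chart_image c"
  shows "christoffel_deriv c y h u v = christoffel_deriv c y h v u"
  using bilinear_family.deriv_linear_combination[OF christoffel_family[OF c] y, of u v 1 v u 0 v u]
    christoffel_sym[OF c] by simp

text \<open>\<open>D\<close> is the covariant derivative of \<open>J\<close>. Compatibility of the
  metric turns derivatives of products into products with covariant derivatives, and the Jacobi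
  equation supplies the covariant derivative of \<open>D\<close>. Parallel frames do not
  appear.\<close>

lemma jacobi_norm_derivatives:
  fixes p v c \<xi>
  defines "y \<equiv> \<lambda>t. snd c (geo p v t)" and "w \<equiv> \<lambda>t. chart_vel c (geo p v) t"
    and "J \<equiv> \<lambda>t. jacobi p v c t \<xi>" and "K \<equiv> \<lambda>t. snd (flow_deriv p v c t \<xi>)"
  defines "D \<equiv> \<lambda>t. K t + christoffel M c (y t) (w t) (J t)"
  assumes a: "0 \<le> a" "a \<le> b" and c: "c \<in> atlas M" and inc: "\<And>t. t \<in> {a..b} \<Longrightarrow> geo p v t \<in> fst c"
    and t: "t \<in> {a..b}"
  shows "((\<lambda>t. metric_in M c (y t) (J t) (J t)) has_vector_derivative 2 * metric_in M c (y t) (D t) (J t)) (at t within {a..b})"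
    and "((\<lambda>t. 2 * metric_in M c (y t) (D t) (J t)) has_vector_derivative
      2 * metric_in M c (y t) (D t) (D t) - 2 * metric_in M c (y t) (curvature_tensor M c (y t) (J t) (w t) (w t)) (J t)) (at t within {a..b})"
    and "(J has_vector_derivative K t) (at t within {a..b})"
proof -
  have yi: "y t \<in> chart_image c" using inc[OF t] by (simp add: y_def)
  note G = bilinear_christoffel[OF c yi] and g = bilinear_metric_in[OF c yi]
  have dy: "(y has_vector_derivative w t) (at t within {a..b})"
    using has_vector_derivative_at_within[OF geodesic_position[OF geo(1) c inc[OF t]]]
    by (simp add: y_def w_def o_def)
  have dw: "(w has_vector_derivative - christoffel M c (y t) (w t) (w t)) (at t within {a..b})"
    using has_vector_derivative_at_within[OF geodesic_equation[OF geo(1) c inc[OF t]]]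
    by (simp add: y_def w_def)
  note ode = flow_deriv_ode[OF a c inc t, of \<xi>]
  show dJ: "(J has_vector_derivative K t) (at t within {a..b})"
    using bounded_linear.has_vector_derivative[OF bounded_linear_fst ode]
    by (simp add: J_def[abs_def] K_def jacobi_def spray_deriv_def)
  have dK: "(K has_vector_derivative - (christoffel_deriv c (y t) (J t) (w t) (w t) +
      christoffel M c (y t) (K t) (w t) + christoffel M c (y t) (w t) (K t))) (at t within {a..b})"
    using bounded_linear.has_vector_derivative[OF bounded_linear_snd ode]
    by (simp add: J_def K_def[abs_def] jacobi_def spray_deriv_def state_def y_def w_def)
  have dD: "(D has_vector_derivative - (christoffel_deriv c (y t) (J t) (w t) (w t) +
      christoffel M c (y t) (K t) (w t) + christoffel M c (y t) (w t) (K t)) +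
      (christoffel_deriv c (y t) (w t) (w t) (J t) + christoffel M c (y t) (- christoffel M c (y t) (w t) (w t)) (J t)
        + christoffel M c (y t) (w t) (K t))) (at t within {a..b})"
    unfolding D_def
    by (intro has_vector_derivative_add dK
        bilinear_family.has_vector_derivative_along[OF christoffel_family[OF c] dy yi dw dJ])
  \<comment> \<open>The Jacobi equation: moved to the left, the last term completes the derivative
    of \<open>D\<close> to the covariant one, which equals minus the curvature term.\<close>
  have DD: "- (christoffel_deriv c (y t) (J t) (w t) (w t) +
      christoffel M c (y t) (K t) (w t) + christoffel M c (y t) (w t) (K t)) +
      (christoffel_deriv c (y t) (w t) (w t) (J t) + christoffel M c (y t) (- christoffel M c (y t) (w t) (w t)) (J t)
        + christoffel M c (y t) (w t) (K t)) = - curvature_tensor M c (y t) (J t) (w t) (w t) - christoffel M c (y t) (w t) (D t)"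
    unfolding curvature_tensor_def Let_def christoffel_deriv_def[symmetric] D_def
    using christoffel_deriv_sym[OF c yi, of "w t" "w t" "J t"] christoffel_sym[OF c yi, of "K t" "w t"]
      christoffel_sym[OF c yi, of "J t" "christoffel M c (y t) (w t) (w t)"] christoffel_sym[OF c yi, of "J t" "w t"]
    by (simp add: bilinear_lneg[OF G] bilinear_radd[OF G] algebra_simps)
  note along = bilinear_family.has_vector_derivative_along[OF metric_family[OF c] dy yi]
  have "((\<lambda>t. metric_in M c (y t) (J t) (J t)) has_vector_derivative metric_deriv M c (y t) (w t) (J t) (J t)
      + metric_in M c (y t) (K t) (J t) + metric_in M c (y t) (J t) (K t)) (at t within {a..b})"
    by (rule along[OF dJ dJ])
  moreover have "metric_deriv M c (y t) (w t) (J t) (J t) + metric_in M c (y t) (K t) (J t) + metric_in M c (y t) (J t) (K t)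
      = 2 * metric_in M c (y t) (D t) (J t)"
    using metric_in_sym[OF c yi, of "J t" "K t"] metric_in_sym[OF c yi, of "J t" "christoffel M c (y t) (w t) (J t)"]
    by (simp add: metric_compatible[OF c yi] D_def bilinear_ladd[OF g])
  ultimately show "((\<lambda>t. metric_in M c (y t) (J t) (J t)) has_vector_derivative 2 * metric_in M c (y t) (D t) (J t)) (at t within {a..b})"
    by simp
  have "((\<lambda>t. 2 * metric_in M c (y t) (D t) (J t)) has_vector_derivative
      2 * (metric_deriv M c (y t) (w t) (D t) (J t) +
        metric_in M c (y t) (- curvature_tensor M c (y t) (J t) (w t) (w t) - christoffel M c (y t) (w t) (D t)) (J t)
        + metric_in M c (y t) (D t) (K t))) (at t within {a..b})"
    using bounded_linear.has_vector_derivative[OF bounded_linear_mult_right along[OF dD dJ], of 2] unfolding DD .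
  moreover have "metric_deriv M c (y t) (w t) (D t) (J t) +
        metric_in M c (y t) (- curvature_tensor M c (y t) (J t) (w t) (w t) - christoffel M c (y t) (w t) (D t)) (J t)
        + metric_in M c (y t) (D t) (K t)
      = metric_in M c (y t) (D t) (D t) - metric_in M c (y t) (curvature_tensor M c (y t) (J t) (w t) (w t)) (J t)"
  proof -
    have "metric_in M c (y t) (D t) (D t) = metric_in M c (y t) (D t) (K t) + metric_in M c (y t) (D t) (christoffel M c (y t) (w t) (J t))"
      by (simp add: D_def bilinear_radd[OF g])
    then show ?thesis by (simp add: metric_compatible[OF c yi] bilinear_lsub[OF g] bilinear_lneg[OF g])
  qed
  ultimately show "((\<lambda>t. 2 * metric_in M c (y t) (D t) (J t)) has_vector_derivative
      2 * metric_in M c (y t) (D t) (D t) - 2 * metric_in M c (y t) (curvature_tensor M c (y t) (J t) (w t) (w t)) (J t)) (at t within {a..b})"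
    by (simp add: right_diff_distrib)
qed

text \<open>The chart changes with \<open>t\<close>, but the value is the same in all charts around
  the point, so this function of time may be differentiated in any of them.\<close>

definition jacobi_sq :: "'a \<Rightarrow> 'b \<Rightarrow> 'b \<Rightarrow> real \<Rightarrow> real" where
  "jacobi_sq p v \<xi> t = (let c = chart_at M (geo p v t) in
     metric M (geo p v t) (jacobi p v c t \<xi>) (jacobi p v c t \<xi>))"

lemma jacobi_sq_chart:
  assumes "t \<ge> 0" "c \<in> atlas M" "geo p v t \<in> fst c"
  shows "jacobi_sq p v \<xi> t = metric_in M c (snd c (geo p v t)) (jacobi p v c t \<xi>) (jacobi p v c t \<xi>)"
  using jacobi_change_chart[OF assms chart_at_in in_chart_at] assms
  by (simp add: jacobi_sq_def metric_in_eq Let_def)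

text \<open>The field vanishes at 0 with derivative \<open>\<xi>\<close>, so
  \<open>J t /\<^sub>R t\<close> tends to \<open>\<xi>\<close>, while the metric converges along the
  geodesic.\<close>

lemma jacobi_sq_initial:
  "((\<lambda>t. jacobi_sq p v \<xi> t / t\<^sup>2) \<longlongrightarrow> metric M p \<xi> \<xi>) (at_right 0)"
proof -
  define c where "c = chart_at M p"
  have c: "c \<in> atlas M" "p \<in> fst c" using chart_at_in in_chart_at by (auto simp: c_def)
  have p0: "geo p v 0 \<in> fst c" using c geo by simp
  obtain e where e: "e > 0" "\<And>s. dist s 0 < e \<Longrightarrow> geo p v s \<in> fst c"
    using geodesic_eventually_in_chart[OF geo(1) c(1) p0] unfolding eventually_nhds_metric by blast
  define b where "b = e / 2"
  have b: "0 \<le> b" "0 < b" and inc: "\<And>t. t \<in> {0..b} \<Longrightarrow> geo p v t \<in> fst c" using e by (auto simp: b_def)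
  define J where "J t = jacobi p v c t \<xi>" for t
  define y where "y t = snd c (geo p v t)" for t
  have J0: "J 0 = 0" and K0: "snd (flow_deriv p v c 0 \<xi>) = \<xi>"
    using flow_deriv_0[OF c] coord_change_id[OF c] by (simp_all add: J_def jacobi_def c_def)
  have dJ: "(J has_vector_derivative snd (flow_deriv p v c t \<xi>)) (at t within {0..b})" if "t \<in> {0..b}" for t
    unfolding J_def[abs_def] by (rule jacobi_norm_derivatives(3)[OF order_refl b(1) c(1) inc that])
  have lim: "((\<lambda>t. J t /\<^sub>R t) \<longlongrightarrow> \<xi>) (at_right 0)"
  proof (rule LIM_zero_cancel)
    have "((\<lambda>t. (1 / norm (t - 0)) *\<^sub>R (J t - (J 0 + (t - 0) *\<^sub>R \<xi>))) \<longlongrightarrow> 0) (at 0 within {0..b})"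
      using dJ[of 0] b K0 unfolding has_vector_derivative_def has_derivative_within by simp
    then have "((\<lambda>t. (1 / norm t) *\<^sub>R (J t - t *\<^sub>R \<xi>)) \<longlongrightarrow> 0) (at_right 0)"
      by (simp add: J0 at_within_Icc_at_right[OF b(2)])
    moreover have "\<forall>\<^sub>F t in at_right 0. (1 / norm t) *\<^sub>R (J t - t *\<^sub>R \<xi>) = J t /\<^sub>R t - \<xi>"
      using eventually_at_right_less[of 0]
      by eventually_elim (simp add: scaleR_diff_right divide_inverse)
    ultimately show "((\<lambda>t. J t /\<^sub>R t - \<xi>) \<longlongrightarrow> 0) (at_right 0)"
      using tendsto_cong by fastforce
  qed
  have y0: "y 0 \<in> chart_image c" using p0 by (simp add: y_def)
  have "isCont (snd c \<circ> geo p v) 0"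
    using has_vector_derivative_continuous[OF geodesic_position[OF geo(1) c(1) p0]] .
  then have ylim: "(y \<longlongrightarrow> y 0) (at_right 0)"
    unfolding y_def[abs_def] isCont_def o_def by (rule tendsto_within_subset) simp
  have glim: "((\<lambda>t. metric_in M c (y t) i j) \<longlongrightarrow> metric_in M c (y 0) i j) (at_right 0)" for i j
  proof (rule isCont_tendsto_compose[OF _ ylim])
    show "isCont (\<lambda>y. metric_in M c y i j) (y 0)"
      using C1_on_continuous_on[OF bilinear_family.C1[OF metric_family[OF c(1)]]] y0
      unfolding continuous_on_eq_continuous_at[OF open_chart_image[OF c(1)]] by blast
  qed
  have "((\<lambda>t. \<Sum>i\<in>Basis. \<Sum>j\<in>Basis. (((J t /\<^sub>R t) \<bullet> i) * ((J t /\<^sub>R t) \<bullet> j)) *\<^sub>R metric_in M c (y t) i j) \<longlongrightarrow>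
      (\<Sum>i\<in>Basis. \<Sum>j\<in>Basis. ((\<xi> \<bullet> i) * (\<xi> \<bullet> j)) *\<^sub>R metric_in M c (y 0) i j)) (at_right 0)"
    by (intro tendsto_sum tendsto_scaleR tendsto_mult tendsto_inner tendsto_const lim glim)
  also have "(\<Sum>i\<in>Basis. \<Sum>j\<in>Basis. ((\<xi> \<bullet> i) * (\<xi> \<bullet> j)) *\<^sub>R metric_in M c (y 0) i j) = metric_in M c (y 0) \<xi> \<xi>"
    by (rule bilinear_expand[OF bilinear_metric_in[OF c(1) y0], symmetric])
  also have "\<dots> = metric M p \<xi> \<xi>" by (simp add: y_def geo c_def metric_in_chart_at)
  finally have l: "((\<lambda>t. \<Sum>i\<in>Basis. \<Sum>j\<in>Basis. (((J t /\<^sub>R t) \<bullet> i) * ((J t /\<^sub>R t) \<bullet> j)) *\<^sub>R metric_in M c (y t) i j) \<longlongrightarrow>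
      metric M p \<xi> \<xi>) (at_right 0)" .
  have "\<forall>\<^sub>F t in at_right 0. t < b" unfolding eventually_at_right_field using b by blast
  then have "\<forall>\<^sub>F t in at_right 0. (\<Sum>i\<in>Basis. \<Sum>j\<in>Basis. (((J t /\<^sub>R t) \<bullet> i) * ((J t /\<^sub>R t) \<bullet> j)) *\<^sub>R metric_in M c (y t) i j)
      = jacobi_sq p v \<xi> t / t\<^sup>2"
    using eventually_at_right_less[of 0]
  proof eventually_elim
    case (elim t)
    then have it: "geo p v t \<in> fst c" by (intro inc) auto
    have bl: "bilinear (metric_in M c (y t))" using it by (intro bilinear_metric_in c) (simp add: y_def)
    have "(\<Sum>i\<in>Basis. \<Sum>j\<in>Basis. (((J t /\<^sub>R t) \<bullet> i) * ((J t /\<^sub>R t) \<bullet> j)) *\<^sub>R metric_in M c (y t) i j)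
        = metric_in M c (y t) (J t /\<^sub>R t) (J t /\<^sub>R t)"
      by (rule bilinear_expand[OF bl, symmetric])
    also have "\<dots> = metric_in M c (y t) (J t) (J t) / t\<^sup>2"
      by (simp add: bilinear_lmul[OF bl] bilinear_rmul[OF bl] power2_eq_square divide_inverse)
    finally show ?case using jacobi_sq_chart[of t c p v \<xi>] elim it c by (simp add: J_def y_def)
  qed
  from tendsto_cong[OF this] l show ?thesis by simp
qed

end

locale hadamard =
  fixes M :: "('a::{t2_space, second_countable_topology}, 'e::euclidean_space) riemannian"
  assumes hadamard: "hadamard_manifold M"

sublocale hadamard \<subseteq> complete_riemannian
  by unfold_locales (use hadamard in \<open>simp_all add: hadamard_manifold_def\<close>)

context hadamard
begin

text \<open>On dependent vectors the sectional curvature is \<open>0 / 0\<close>; there the numerator vanishes.\<close>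

lemma curvature_nonpos:
  "metric M x (curvature_tensor M (chart_at M x) (snd (chart_at M x) x) u v v) u \<le> 0"
proof -
  define c where "c = chart_at M x"
  have c: "c \<in> atlas M" "x \<in> fst c" using chart_at_in in_chart_at by (auto simp: c_def)
  then have y: "snd c x \<in> chart_image c" by simp
  note G = bilinear_christoffel[OF c(1) y]
  have dG: "bilinear (christoffel_deriv c (snd c x) h)" for h
    using bilinear_family.deriv_bilinear[OF christoffel_family[OF c(1)] y] .
  have dG': "linear (\<lambda>h. christoffel_deriv c (snd c x) h a b)" for a b
    using C1_on_has_derivative[OF bilinear_family.C1[OF christoffel_family[OF c(1)]] y] has_derivative_linear by blast
  let ?R = "curvature_tensor M c (snd c x) u v v"
  have R: "?R = christoffel_deriv c (snd c x) u v v - christoffel_deriv c (snd c x) v u v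
    + christoffel M c (snd c x) u (christoffel M c (snd c x) v v) - christoffel M c (snd c x) v (christoffel M c (snd c x) u v)"
    by (simp add: curvature_tensor_def christoffel_deriv_def Let_def)
  have "metric M x ?R u \<le> 0"
  proof (cases "u \<noteq> v \<and> independent {u, v}")
    case True
    then have uv: "u \<notin> span {v}" "v \<noteq> 0" by (auto simp: independent_insert dependent_zero)
    define z where "z = metric M x v v *\<^sub>R u - metric M x u v *\<^sub>R v"
    have vv: "metric M x v v > 0" using uv(2) by (rule metric_pos)
    have "z \<noteq> 0"
    proof
      assume "z = 0"
      then have "inverse (metric M x v v) *\<^sub>R metric M x v v *\<^sub>R u = inverse (metric M x v v) *\<^sub>R metric M x u v *\<^sub>R v"
        by (simp add: z_def)
      then have "u = (inverse (metric M x v v) * metric M x u v) *\<^sub>R v" using vv by simp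
      then show False using uv(1) by (metis span_base span_scale singletonI)
    qed
    then have "metric M x z z > 0" by (rule metric_pos)
    \<comment> \<open>The denominator of the sectional curvature is positive, so quotient and
      numerator have the same sign.\<close>
    then have "metric M x u u * metric M x v v - (metric M x u v)\<^sup>2 > 0"
      using posdef_gap[of "metric M x" v u, OF bilinear_metric metric_sym] vv by (simp add: z_def zero_less_mult_iff)
    moreover have "sectional_curvature M x u v \<le> 0"
      using hadamard True by (simp add: hadamard_manifold_def)
    ultimately show ?thesis by (simp add: sectional_curvature_def Let_def c_def divide_le_0_iff)
  next
    case False
    have "v = 0 \<or> (\<exists>r. u = r *\<^sub>R v)"
    proof (cases "v = 0 \<or> u = v")
      case True
      then show ?thesis by (metis scaleR_one)
    next
      case F: False
      then have "u \<in> span {v}" using False by (auto simp: independent_insert split: if_splits)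
      then show ?thesis by (auto simp: span_singleton)
    qed
    then have "?R = 0"
    proof
      assume "v = 0"
      then show ?thesis unfolding R using linear_0[OF dG']
        by (simp add: bilinear_lzero[OF dG] bilinear_rzero[OF dG] bilinear_lzero[OF G] bilinear_rzero[OF G])
    next
      assume "\<exists>r. u = r *\<^sub>R v"
      then obtain r where "u = r *\<^sub>R v" by blast
      then show ?thesis unfolding R
        by (simp add: linear_scale[OF dG'] bilinear_lmul[OF dG] bilinear_lmul[OF G] bilinear_rmul[OF G])
    qed
    then show ?thesis by (simp add: bilinear_lzero[OF bilinear_metric])
  qed
  then show ?thesis by (simp add: c_def)
qed

lemma jacobi_sq_nonneg: "jacobi_sq p v \<xi> t \<ge> 0"
proof -
  have "metric M x u u \<ge> 0" for x u
    using metric_pos[of u x] bilinear_lzero[OF bilinear_metric] by (cases "u = 0") auto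
  then show ?thesis by (simp add: jacobi_sq_def Let_def)
qed

text \<open>Nonpositive curvature makes the second derivative at least twice the square of the
  covariant derivative, and Cauchy-Schwarz bounds the first derivative by it. Together these are the
  hypotheses of \<open>convex_sqrt_growth\<close>. Using \<open>deriv\<close> gives one first
  derivative for all times, though each time has its own chart.\<close>

lemma jacobi_sq_derivatives:
  assumes t0: "t0 > 0"
  shows "\<exists>\<phi>''. (jacobi_sq p v \<xi> has_real_derivative deriv (jacobi_sq p v \<xi>) t0) (at t0) \<and>
    (deriv (jacobi_sq p v \<xi>) has_real_derivative \<phi>'') (at t0) \<and> \<phi>'' \<ge> 0 \<and>
    (deriv (jacobi_sq p v \<xi>) t0)\<^sup>2 \<le> 2 * jacobi_sq p v \<xi> t0 * \<phi>''"
proof -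
  define c where "c = chart_at M (geo p v t0)"
  have c: "c \<in> atlas M" "geo p v t0 \<in> fst c" using chart_at_in in_chart_at by (auto simp: c_def)
  obtain e where e: "e > 0" "\<And>s. dist s t0 < e \<Longrightarrow> geo p v s \<in> fst c"
    using geodesic_eventually_in_chart[OF geo(1) c] unfolding eventually_nhds_metric by blast
  define r where "r = min e t0 / 2"
  have r: "r > 0" "r \<le> t0 / 2" "r < e" using e t0 by (auto simp: r_def)
  define a where "a = t0 - r"
  define b where "b = t0 + r"
  have ab: "0 \<le> a" "a \<le> b" "a < t0" "t0 < b" using r t0 by (auto simp: a_def b_def)
  have inc: "geo p v t \<in> fst c" if "t \<in> {a..b}" for t
    by (rule e(2)) (use that r in \<open>auto simp: a_def b_def dist_real_def\<close>)
  define y where "y = (\<lambda>t. snd c (geo p v t))"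
  define w where "w = (\<lambda>t. chart_vel c (geo p v) t)"
  define J where "J = (\<lambda>t. jacobi p v c t \<xi>)"
  define D where "D = (\<lambda>t. snd (flow_deriv p v c t \<xi>) + christoffel M c (y t) (w t) (J t))"
  note d = jacobi_norm_derivatives[OF ab(1,2) c(1) inc, where \<xi> = \<xi>]
  have d1': "((\<lambda>t. metric_in M c (y t) (J t) (J t)) has_vector_derivative 2 * metric_in M c (y t) (D t) (J t)) (at t within {a..b})"
    and d2': "((\<lambda>t. 2 * metric_in M c (y t) (D t) (J t)) has_vector_derivative
      2 * metric_in M c (y t) (D t) (D t) - 2 * metric_in M c (y t) (curvature_tensor M c (y t) (J t) (w t) (w t)) (J t)) (at t within {a..b})"
    if "t \<in> {a..b}" for t
    using d(1,2)[OF _ that] by (simp_all add: y_def w_def J_def D_def)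
  have eq: "jacobi_sq p v \<xi> t = metric_in M c (y t) (J t) (J t)" if "t \<in> {a<..<b}" for t
    using jacobi_sq_chart[of t c p v \<xi>] inc[of t] c that ab by (simp add: y_def J_def)
  have op: "open {a<..<b}" by simp
  have d1: "(jacobi_sq p v \<xi> has_real_derivative 2 * metric_in M c (y t) (D t) (J t)) (at t)" if t: "t \<in> {a<..<b}" for t
  proof -
    have "((\<lambda>t. metric_in M c (y t) (J t) (J t)) has_vector_derivative 2 * metric_in M c (y t) (D t) (J t)) (at t)"
      using d1'[of t] t at_within_Icc_at[of a t b] by simp
    then have "(jacobi_sq p v \<xi> has_vector_derivative 2 * metric_in M c (y t) (D t) (J t)) (at t)"
      by (rule has_vector_derivative_transform_within_open[OF _ op t]) (simp add: eq)
    then show ?thesis by (simp add: has_real_derivative_iff_has_vector_derivative)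
  qed
  have deriv_eq: "deriv (jacobi_sq p v \<xi>) t = 2 * metric_in M c (y t) (D t) (J t)" if "t \<in> {a<..<b}" for t
    by (rule DERIV_imp_deriv[OF d1[OF that]])
  define \<phi>'' where "\<phi>'' = 2 * metric_in M c (y t0) (D t0) (D t0) -
    2 * metric_in M c (y t0) (curvature_tensor M c (y t0) (J t0) (w t0) (w t0)) (J t0)"
  have t0': "t0 \<in> {a<..<b}" using ab by simp
  have "((\<lambda>t. 2 * metric_in M c (y t) (D t) (J t)) has_vector_derivative \<phi>'') (at t0)"
    using d2'[of t0] ab at_within_Icc_at[of a t0 b] by (simp add: \<phi>''_def)
  then have "(deriv (jacobi_sq p v \<xi>) has_vector_derivative \<phi>'') (at t0)"
    by (rule has_vector_derivative_transform_within_open[OF _ op t0']) (simp add: deriv_eq)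
  then have d2: "(deriv (jacobi_sq p v \<xi>) has_real_derivative \<phi>'') (at t0)"
    by (simp add: has_real_derivative_iff_has_vector_derivative)
  have yi: "y t0 \<in> chart_image c" using c by (simp add: y_def)
  \<comment> \<open>\<open>c\<close> is the chart selected at this very point, the one in which
    \<open>sectional_curvature\<close> is defined.\<close>
  have curv: "metric_in M c (y t0) (curvature_tensor M c (y t0) (J t0) (w t0) (w t0)) (J t0) \<le> 0"
    using curvature_nonpos[of "geo p v t0" "J t0" "w t0"] by (simp add: y_def c_def metric_in_chart_at)
  then have ge: "\<phi>'' \<ge> 2 * metric_in M c (y t0) (D t0) (D t0)" by (simp add: \<phi>''_def)
  have nn: "metric_in M c (y t0) u u \<ge> 0" for u by (rule metric_in_nonneg[OF c(1) yi])
  have "(2 * metric_in M c (y t0) (D t0) (J t0))\<^sup>2 \<le> 4 * (metric_in M c (y t0) (D t0) (D t0) * metric_in M c (y t0) (J t0) (J t0))"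
    using posdef_cauchy_schwarz[of "metric_in M c (y t0)" "D t0" "J t0", OF bilinear_metric_in[OF c(1) yi] metric_in_sym[OF c(1) yi] metric_in_pos[OF c(1) yi]]
    by (simp add: power_mult_distrib)
  also have "\<dots> = 2 * metric_in M c (y t0) (J t0) (J t0) * (2 * metric_in M c (y t0) (D t0) (D t0))" by simp
  also have "\<dots> \<le> 2 * metric_in M c (y t0) (J t0) (J t0) * \<phi>''"
    using ge nn by (intro mult_left_mono) auto
  finally have cs: "(2 * metric_in M c (y t0) (D t0) (J t0))\<^sup>2 \<le> 2 * metric_in M c (y t0) (J t0) (J t0) * \<phi>''" .
  have "\<phi>'' \<ge> 0" using ge nn[of "D t0"] by simp
  then show ?thesis
    using d1[OF t0'] d2 cs unfolding deriv_eq[OF t0'] eq[OF t0'] by blast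
qed

text \<open>The form in which the curvature bound is used from here on: the differential of the
  exponential map does not shorten vectors.\<close>

lemma jacobi_expanding: "metric M p \<xi> \<xi> \<le> jacobi_sq p v \<xi> 1"
proof (cases "\<xi> = 0")
  case True
  then show ?thesis using jacobi_sq_nonneg bilinear_lzero[OF bilinear_metric] by simp
next
  case False
  have "\<forall>t. \<exists>r. t > 0 \<longrightarrow> (jacobi_sq p v \<xi> has_real_derivative deriv (jacobi_sq p v \<xi>) t) (at t) \<and>
    (deriv (jacobi_sq p v \<xi>) has_real_derivative r) (at t) \<and> r \<ge> 0 \<and>
    (deriv (jacobi_sq p v \<xi>) t)\<^sup>2 \<le> 2 * jacobi_sq p v \<xi> t * r"
    using jacobi_sq_derivatives[of _ p v \<xi>] by blast
  then obtain \<phi>'' where \<phi>'': "\<And>t. t > 0 \<Longrightarrow> (jacobi_sq p v \<xi> has_real_derivative deriv (jacobi_sq p v \<xi>) t) (at t) \<and>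
    (deriv (jacobi_sq p v \<xi>) has_real_derivative \<phi>'' t) (at t) \<and> \<phi>'' t \<ge> 0 \<and>
    (deriv (jacobi_sq p v \<xi>) t)\<^sup>2 \<le> 2 * jacobi_sq p v \<xi> t * \<phi>'' t"
    by metis
  show ?thesis
    by (rule convex_sqrt_growth[where \<phi>' = "deriv (jacobi_sq p v \<xi>)" and \<phi>'' = \<phi>''])
      (use \<phi>'' jacobi_sq_nonneg jacobi_sq_initial metric_pos[OF False] in auto)
qed

end

section \<open>Sections of expanding local diffeomorphisms\<close>

lemma strict_deriv_local_bounds:
  fixes \<phi> :: "'e::euclidean_space \<Rightarrow> 'e"
  assumes "open O'" "u \<in> O'" "strict_deriv \<phi> L u" "inj L"
  shows "\<exists>d>0. \<exists>m>0. ball u d \<subseteq> O' \<and>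
    (\<forall>x\<in>ball u d. \<forall>y\<in>ball u d. m * norm (x - y) \<le> norm (\<phi> x - \<phi> y)) \<and>
    (\<forall>x. \<forall>r>0. ball x r \<subseteq> ball u d \<longrightarrow> ball (\<phi> x) (m * r) \<subseteq> \<phi> ` ball x r)"
proof -
  obtain d m where dm: "d > 0" "m > 0"
    "\<And>x y. x \<in> ball u d \<Longrightarrow> y \<in> ball u d \<Longrightarrow> m * norm (x - y) \<le> norm (\<phi> x - \<phi> y)"
    "\<And>x r. r > 0 \<Longrightarrow> ball x r \<subseteq> ball u d \<Longrightarrow> ball (\<phi> x) (m * r) \<subseteq> \<phi> ` ball x r"
    using strict_deriv_local_inverse[OF assms(3,4)] by blast
  obtain e where e: "e > 0" "ball u e \<subseteq> O'" using assms(1,2) open_contains_ball by blast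
  have sub: "ball u (min d e) \<subseteq> ball u d" "ball u (min d e) \<subseteq> O'" using e by auto
  show ?thesis
    by (rule exI[of _ "min d e"], intro conjI exI[of _ m])
      (use dm e sub in \<open>auto intro: order_trans\<close>)
qed

text \<open>On the interior a continuous section is differentiable and its derivative inverts that
  of \<open>\<phi>\<close>, so its norm is at most \<open>1 / m\<close>. The bound follows by
  integrating along the segment from \<open>y0\<close> to \<open>y\<close>.\<close>

lemma section_displacement:
  fixes \<phi> :: "'e::euclidean_space \<Rightarrow> 'e"
  assumes strict: "\<And>u. u \<in> O' \<Longrightarrow> \<exists>L. strict_deriv \<phi> L u \<and> inj L"
    and m: "m > 0" and expand: "\<And>u L \<xi>. u \<in> O' \<Longrightarrow> \<phi> u \<in> Q \<Longrightarrow> strict_deriv \<phi> L u \<Longrightarrow> m * norm \<xi> \<le> norm (L \<xi>)"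
    and Q: "cball y0 r \<subseteq> Q" and s: "continuous_on (cball y0 r) s"
    and sec: "\<And>y. y \<in> cball y0 r \<Longrightarrow> s y \<in> O' \<and> \<phi> (s y) = y" and y: "y \<in> cball y0 r"
  shows "norm (s y - s y0) \<le> norm (y - y0) / m"
proof (cases "y = y0")
  case False
  then have r: "r > 0" using y by (auto simp: dist_norm norm_minus_commute) (smt (verit) zero_less_norm_iff right_minus_eq)
  define l where "l t = y0 + t *\<^sub>R (y - y0)" for t :: real
  have l_in: "l t \<in> cball y0 r" if "0 \<le> t" "t \<le> 1" for t
  proof -
    have "t * norm (y - y0) \<le> 1 * norm (y - y0)" using that by (intro mult_right_mono) auto
    then show ?thesis using y that by (simp add: l_def dist_norm norm_minus_commute)
  qed
  \<comment> \<open>Even when \<open>y\<close> lies on the boundary sphere, the segment is inside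
    the open ball at interior times; derivatives are taken only there.\<close>
  have l_in': "l t \<in> ball y0 r" if "0 < t" "t < 1" for t
  proof -
    have "t * norm (y - y0) < 1 * norm (y - y0)" using that False by (intro mult_strict_right_mono) auto
    then show ?thesis using y that by (simp add: l_def dist_norm norm_minus_commute)
  qed
  have der: "\<exists>g'. ((s \<circ> l) has_vector_derivative g') (at t) \<and> norm g' \<le> norm (y - y0) / m"
    if t: "0 < t" "t < 1" for t
  proof -
    have lt: "l t \<in> ball y0 r" by (rule l_in'[OF t])
    then have lt': "l t \<in> cball y0 r" by simp
    obtain L where L: "strict_deriv \<phi> L (s (l t))" "inj L" using strict sec[OF lt'] by blast
    have lin: "linear L" using strict_deriv_bounded_linear[OF L(1)] by (rule bounded_linear.linear)
    obtain P where P: "linear P" "\<And>v. P (L v) = v" "\<And>v. L (P v) = v"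
      using linear_injective_isomorphism[OF lin L(2)] by blast
    have "continuous_on (ball y0 r) s" by (rule continuous_on_subset[OF s]) auto
    then have "isCont s (l t)" using lt by (simp add: continuous_on_eq_continuous_at)
    have "(s has_derivative P) (at (l t))"
    proof (rule has_derivative_inverse_basic)
      show "(\<phi> has_derivative L) (at (s (l t)))" by (rule strict_deriv_has_derivative[OF L(1)])
      show "bounded_linear P" using P(1) by (simp add: linear_conv_bounded_linear)
      show "P \<circ> L = id" using P(2) by auto
      show "\<phi> (s z) = z" if "z \<in> ball y0 r" for z using sec that by auto
    qed (use lt \<open>isCont s (l t)\<close> in auto)
    moreover have "(l has_derivative (\<lambda>h. h *\<^sub>R (y - y0))) (at t)"
      unfolding l_def[abs_def] by (auto intro!: derivative_eq_intros)
    ultimately have "((\<lambda>x. s (l x)) has_derivative (\<lambda>h. P (h *\<^sub>R (y - y0)))) (at t)"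
      by (rule has_derivative_compose[rotated])
    then have "((s \<circ> l) has_vector_derivative P (y - y0)) (at t)"
      unfolding has_vector_derivative_def o_def by (simp add: linear_scale[OF P(1)])
    moreover have "m * norm (P (y - y0)) \<le> norm (L (P (y - y0)))"
      using expand[OF _ _ L(1)] sec[OF lt'] lt' Q by auto
    then have "norm (P (y - y0)) \<le> norm (y - y0) / m" using m by (simp add: P(3) field_simps)
    ultimately show ?thesis by blast
  qed
  have "\<forall>t. \<exists>g'. 0 < t \<and> t < 1 \<longrightarrow> ((s \<circ> l) has_vector_derivative g') (at t) \<and> norm g' \<le> norm (y - y0) / m"
    using der by blast
  then obtain g' where g': "\<And>t. 0 < t \<Longrightarrow> t < 1 \<Longrightarrow> ((s \<circ> l) has_vector_derivative g' t) (at t) \<and> norm (g' t) \<le> norm (y - y0) / m"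
    by metis
  have "norm ((s \<circ> l) 1 - (s \<circ> l) 0) \<le> norm (y - y0) / m * 1 - norm (y - y0) / m * 0"
  proof (rule differentiable_bound_general[where \<phi> = "\<lambda>t. norm (y - y0) / m * t" and \<phi>' = "\<lambda>t. norm (y - y0) / m" and f' = g'])
    show "continuous_on {0..1} (s \<circ> l)"
      unfolding o_def
      by (rule continuous_on_compose2[OF s]) (use l_in in \<open>auto simp: l_def[abs_def] intro!: continuous_intros\<close>)
    show "((\<lambda>t. norm (y - y0) / m * t) has_vector_derivative norm (y - y0) / m) (at x)" for x
      using m by (auto intro!: derivative_eq_intros simp: has_real_derivative_iff_has_vector_derivative[symmetric])
    show "continuous_on {0..1} (\<lambda>t. norm (y - y0) / m * t)" by (intro continuous_intros)
    show "((s \<circ> l) has_vector_derivative g' x) (at x)" "norm (g' x) \<le> norm (y - y0) / m"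
      if "0 < x" "x < 1" for x using g'[OF that] by auto
  qed simp
  then show ?thesis by (simp add: l_def)
qed simp

text \<open>The section is extended by a fixed amount of radius at a time: a priori it stays in a compact
  set, on which the size of the domains of the local inverses is bounded below.\<close>

lemma expanding_section:
  fixes \<phi> :: "'e::euclidean_space \<Rightarrow> 'e"
  assumes O': "open O'" and strict: "\<And>u. u \<in> O' \<Longrightarrow> \<exists>L. strict_deriv \<phi> L u \<and> inj L"
    and m: "m > 0" and expand: "\<And>u L \<xi>. u \<in> O' \<Longrightarrow> \<phi> u \<in> Q \<Longrightarrow> strict_deriv \<phi> L u \<Longrightarrow> m * norm \<xi> \<le> norm (L \<xi>)"
    and closed: "closed {u \<in> O'. \<phi> u \<in> Q}" and u: "u \<in> O'" and r: "r \<ge> 0" and Q: "cball (\<phi> u) r \<subseteq> Q"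
  shows "\<exists>s. continuous_on (cball (\<phi> u) r) s \<and> s (\<phi> u) = u \<and> (\<forall>y\<in>cball (\<phi> u) r. s y \<in> O' \<and> \<phi> (s y) = y)"
proof -
  \<comment> \<open>By \<open>section_displacement\<close>, a section over a ball of radius at most
    \<open>r\<close> moves at most \<open>r / m\<close> away from \<open>u\<close>.\<close>
  define K where "K = cball u (r / m) \<inter> {u \<in> O'. \<phi> u \<in> Q}"
  have K: "compact K" unfolding K_def by (intro compact_Int_closed closed) simp
  \<comment> \<open>Local inverses of uniform size: a finite subcover by balls of half the radius
    leaves room for a common \<open>\<epsilon>\<close> and a common expansion constant
    \<open>\<kappa>\<close>.\<close>
  have "\<exists>\<epsilon>>0. \<exists>k>0. \<forall>x\<in>K. ball x (2 * \<epsilon>) \<subseteq> O' \<and>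
    (\<forall>a\<in>ball x (2 * \<epsilon>). \<forall>b\<in>ball x (2 * \<epsilon>). k * norm (a - b) \<le> norm (\<phi> a - \<phi> b)) \<and> ball (\<phi> x) (k * \<epsilon>) \<subseteq> \<phi> ` ball x \<epsilon>"
  proof -
    define G where "G x d k \<longleftrightarrow> d > 0 \<and> k > 0 \<and> ball x d \<subseteq> O' \<and>
      (\<forall>a\<in>ball x d. \<forall>b\<in>ball x d. k * norm (a - b) \<le> norm (\<phi> a - \<phi> b)) \<and>
      (\<forall>y. \<forall>r>0. ball y r \<subseteq> ball x d \<longrightarrow> ball (\<phi> y) (k * r) \<subseteq> \<phi> ` ball y r)" for x d k
    have "\<exists>d k. G x d k" if "x \<in> K" for x
    proof -
      obtain L where "x \<in> O'" "strict_deriv \<phi> L x" "inj L" using strict \<open>x \<in> K\<close> unfolding K_def by blast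
      from strict_deriv_local_bounds[OF O' this] show ?thesis unfolding G_def by blast
    qed
    then obtain d k where G: "\<And>x. x \<in> K \<Longrightarrow> G x (d x) (k x)" by metis
    have dk: "x \<in> K \<Longrightarrow> d x > 0" "x \<in> K \<Longrightarrow> k x > 0" "x \<in> K \<Longrightarrow> ball x (d x) \<subseteq> O'"
      "x \<in> K \<Longrightarrow> a \<in> ball x (d x) \<Longrightarrow> b \<in> ball x (d x) \<Longrightarrow> k x * norm (a - b) \<le> norm (\<phi> a - \<phi> b)"
      "x \<in> K \<Longrightarrow> r > 0 \<Longrightarrow> ball y r \<subseteq> ball x (d x) \<Longrightarrow> ball (\<phi> y) (k x * r) \<subseteq> \<phi> ` ball y r" for x a b y r
      using G[of x] unfolding G_def by blast+
    have "K \<subseteq> (\<Union>x\<in>K. ball x (d x / 2))"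
    proof
      fix x assume "x \<in> K"
      then show "x \<in> (\<Union>x\<in>K. ball x (d x / 2))" using dk(1)[of x] by (intro UN_I[of x]) auto
    qed
    then obtain F where F: "F \<subseteq> K" "finite F" "K \<subseteq> (\<Union>x\<in>F. ball x (d x / 2))"
      using compactE_image[OF K, of K "\<lambda>x. ball x (d x / 2)"] by auto
    define \<epsilon> where "\<epsilon> = Min (insert 1 ((\<lambda>x. d x / 4) ` F))"
    define \<kappa> where "\<kappa> = Min (insert 1 (k ` F))"
    have \<epsilon>: "\<epsilon> > 0" "\<And>x. x \<in> F \<Longrightarrow> \<epsilon> \<le> d x / 4"
    proof -
      show "\<epsilon> > 0" unfolding \<epsilon>_def using F dk(1) by (auto simp: Min_gr_iff)
      show "\<epsilon> \<le> d x / 4" if "x \<in> F" for x unfolding \<epsilon>_def by (rule Min_le) (use F that in auto)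
    qed
    have \<kappa>: "\<kappa> > 0" "\<And>x. x \<in> F \<Longrightarrow> \<kappa> \<le> k x"
    proof -
      show "\<kappa> > 0" unfolding \<kappa>_def using F dk(2) by (auto simp: Min_gr_iff)
      show "\<kappa> \<le> k x" if "x \<in> F" for x unfolding \<kappa>_def by (rule Min_le) (use F that in auto)
    qed
    show ?thesis
    proof (rule exI[of _ \<epsilon>], intro exI[of _ \<kappa>] conjI ballI \<epsilon>(1) \<kappa>(1))
      fix x assume "x \<in> K"
      then obtain z where z: "z \<in> F" "x \<in> ball z (d z / 2)" using F by blast
      have zK: "z \<in> K" using z F by auto
      have sub: "ball x (2 * \<epsilon>) \<subseteq> ball z (d z)"
      proof
        fix a assume "a \<in> ball x (2 * \<epsilon>)"
        then show "a \<in> ball z (d z)" using z(2) \<epsilon>(2)[OF z(1)] dist_triangle[of z a x] by simp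
      qed
      show "ball x (2 * \<epsilon>) \<subseteq> O'" using sub dk(3)[OF zK] by blast
      show "\<kappa> * norm (a - b) \<le> norm (\<phi> a - \<phi> b)" if "a \<in> ball x (2 * \<epsilon>)" "b \<in> ball x (2 * \<epsilon>)" for a b
        using dk(4)[OF zK, of a b] sub that mult_right_mono[OF \<kappa>(2)[OF z(1)], of "norm (a - b)"] by fastforce
      have "\<kappa> * \<epsilon> \<le> k z * \<epsilon>" using \<kappa> \<epsilon> z by (intro mult_right_mono) auto
      then have "ball (\<phi> x) (\<kappa> * \<epsilon>) \<subseteq> ball (\<phi> x) (k z * \<epsilon>)" by (rule subset_ball)
      also have "ball x \<epsilon> \<subseteq> ball z (d z)" using sub \<epsilon>(1) by force
      then have "ball (\<phi> x) (k z * \<epsilon>) \<subseteq> \<phi> ` ball x \<epsilon>" by (rule dk(5)[OF zK \<epsilon>(1)])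
      finally show "ball (\<phi> x) (\<kappa> * \<epsilon>) \<subseteq> \<phi> ` ball x \<epsilon>" .
    qed
  qed
  then obtain \<epsilon> k where \<epsilon>: "\<epsilon> > 0" "k > 0" "\<And>x. x \<in> K \<Longrightarrow> ball x (2 * \<epsilon>) \<subseteq> O'"
    "\<And>x a b. x \<in> K \<Longrightarrow> a \<in> ball x (2 * \<epsilon>) \<Longrightarrow> b \<in> ball x (2 * \<epsilon>) \<Longrightarrow> k * norm (a - b) \<le> norm (\<phi> a - \<phi> b)"
    "\<And>x. x \<in> K \<Longrightarrow> ball (\<phi> x) (k * \<epsilon>) \<subseteq> \<phi> ` ball x \<epsilon>" by blast
  have k\<epsilon>: "k * \<epsilon> > 0" using \<epsilon> by simp
  \<comment> \<open>The radius grows in \<open>N\<close> equal steps, each shorter than the reach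
    \<open>k * \<epsilon>\<close> of a local inverse.\<close>
  obtain N :: nat where N: "N > 0" "r / N < k * \<epsilon>"
  proof -
    obtain N :: nat where "r / (k * \<epsilon>) < real N" using reals_Archimedean2 by blast
    then have "r / (k * \<epsilon>) < real (Suc N)" by simp
    then have "r / real (Suc N) < k * \<epsilon>" using k\<epsilon> by (simp add: field_simps)
    then show thesis using that by blast
  qed
  let ?c = "\<phi> u"
  have "\<exists>s. continuous_on (cball ?c (r * n / N)) s \<and> s ?c = u \<and> (\<forall>y\<in>cball ?c (r * n / N). s y \<in> O' \<and> \<phi> (s y) = y)"
    if "n \<le> N" for n
    using that
  proof (induction n)
    case 0
    show ?case by (intro exI[of _ "\<lambda>_. u"]) (use u in auto)
  next
    case (Suc n)
    define \<rho> where "\<rho> = r * n / N"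
    define \<rho>' where "\<rho>' = r * Suc n / N"
    obtain s where s: "continuous_on (cball ?c \<rho>) s" "s ?c = u" "\<And>y. y \<in> cball ?c \<rho> \<Longrightarrow> s y \<in> O' \<and> \<phi> (s y) = y"
      using Suc unfolding \<rho>_def by auto
    have \<rho>: "0 \<le> \<rho>" "\<rho> \<le> \<rho>'" "\<rho>' \<le> r" "\<rho>' - \<rho> < k * \<epsilon>"
    proof -
      show "0 \<le> \<rho>" "\<rho> \<le> \<rho>'" using r N by (auto simp: \<rho>_def \<rho>'_def intro!: divide_right_mono mult_left_mono)
      have "r * Suc n \<le> r * N" using Suc.prems r by (intro mult_left_mono) auto
      then show "\<rho>' \<le> r" using N by (simp add: \<rho>'_def field_simps)
      have "\<rho>' - \<rho> = r / N" by (simp add: \<rho>_def \<rho>'_def field_simps add_divide_distrib)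
      then show "\<rho>' - \<rho> < k * \<epsilon>" using N by simp
    qed
    have Q\<rho>: "cball ?c \<rho> \<subseteq> Q" "cball ?c \<rho>' \<subseteq> Q" using Q \<rho> by auto
    \<comment> \<open>Ratio of the radial contraction \<open>c\<close> of the larger ball to the
      smaller one; the case 0 covers \<open>r = 0\<close>.\<close>
    define \<mu> where "\<mu> = (if \<rho>' = 0 then 0 else \<rho> / \<rho>')"
    have \<mu>: "0 \<le> \<mu>" "\<mu> \<le> 1" using \<rho> by (auto simp: \<mu>_def divide_le_eq_1)
    define c where "c y = ?c + \<mu> *\<^sub>R (y - ?c)" for y
    have c_in: "c y \<in> cball ?c \<rho>" if "y \<in> cball ?c \<rho>'" for y
    proof -
      have "norm (c y - ?c) = \<mu> * norm (y - ?c)" using \<mu> by (simp add: c_def)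
      also have "\<dots> \<le> \<mu> * \<rho>'" using that \<mu> by (intro mult_left_mono) (auto simp: dist_norm norm_minus_commute)
      also have "\<dots> = \<rho>" using \<rho> by (simp add: \<mu>_def)
      finally show ?thesis by (simp add: dist_norm norm_minus_commute)
    qed
    have c_dist: "norm (y - c y) < k * \<epsilon>" if "y \<in> cball ?c \<rho>'" for y
    proof -
      have "y - c y = (1 - \<mu>) *\<^sub>R (y - ?c)" by (simp add: c_def algebra_simps)
      then have "norm (y - c y) = (1 - \<mu>) * norm (y - ?c)" using \<mu> by simp
      also have "\<dots> \<le> (1 - \<mu>) * \<rho>'" using that \<mu> by (intro mult_left_mono) (auto simp: dist_norm norm_minus_commute)
      also have "\<dots> = \<rho>' - \<rho>" using \<rho> by (simp add: \<mu>_def left_diff_distrib)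
      finally show ?thesis using \<rho> by simp
    qed
    have c_c: "c ?c = ?c" by (simp add: c_def)
    have sK: "s y \<in> K" if y: "y \<in> cball ?c \<rho>" for y
    proof -
      have "norm (s y - s ?c) \<le> norm (y - ?c) / m"
        by (rule section_displacement[of O' \<phi> m Q "\<phi> u" \<rho> s y, OF _ m _ Q\<rho>(1) s(1) _ y]; fact strict expand s(3))
      also have "\<dots> \<le> r / m" using y \<rho> m by (intro divide_right_mono) (auto simp: dist_norm norm_minus_commute)
      finally have "s y \<in> cball u (r / m)" by (simp add: s(2) dist_norm norm_minus_commute)
      then show ?thesis using s(3)[OF y] y Q\<rho> by (auto simp: K_def)
    qed
    \<comment> \<open>The new section takes at \<open>y\<close> the preimage that lies near the old
      value at \<open>c y\<close>.\<close>
    have "\<exists>a. a \<in> ball (s (c y)) \<epsilon> \<and> \<phi> a = y" if y: "y \<in> cball ?c \<rho>'" for y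
    proof -
      have "\<phi> (s (c y)) = c y" using s(3) c_in[OF y] by blast
      then have "y \<in> ball (\<phi> (s (c y))) (k * \<epsilon>)" using c_dist[OF y] by (simp add: dist_norm norm_minus_commute)
      then show ?thesis using \<epsilon>(5)[OF sK[OF c_in[OF y]]] by blast
    qed
    then obtain s' where s': "\<And>y. y \<in> cball ?c \<rho>' \<Longrightarrow> s' y \<in> ball (s (c y)) \<epsilon> \<and> \<phi> (s' y) = y" by metis
    have "continuous_on (cball ?c \<rho>') s'"
      unfolding continuous_on_iff
    proof (intro ballI allI impI)
      fix y1 and e :: real assume y1: "y1 \<in> cball ?c \<rho>'" and e: "e > 0"
      have "continuous_on (cball ?c \<rho>') (\<lambda>y. s (c y))"
        by (rule continuous_on_compose2[OF s(1)]) (use c_in in \<open>auto simp: c_def[abs_def] intro!: continuous_intros\<close>)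
      then obtain d where d: "d > 0" "\<And>y. y \<in> cball ?c \<rho>' \<Longrightarrow> dist y y1 < d \<Longrightarrow> dist (s (c y)) (s (c y1)) < \<epsilon>"
        using y1 \<epsilon>(1) unfolding continuous_on_iff by blast
      show "\<exists>d>0. \<forall>y\<in>cball ?c \<rho>'. dist y y1 < d \<longrightarrow> dist (s' y) (s' y1) < e"
      proof (intro exI[of _ "min d (k * e)"] conjI ballI impI)
        show "0 < min d (k * e)" using d e \<epsilon> by simp
        fix y assume y: "y \<in> cball ?c \<rho>'" "dist y y1 < min d (k * e)"
        \<comment> \<open>For \<open>y\<close> close to \<open>y1\<close> both new values lie in one
          ball of radius \<open>2 * \<epsilon>\<close>, where \<open>\<phi>\<close> separates points
          by at least the factor \<open>k\<close>. Hence the choices fit together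
          continuously.\<close>
        have "s' y \<in> ball (s (c y1)) (2 * \<epsilon>)"
          using s'[OF y(1)] d(2)[OF y(1)] y(2) dist_triangle[of "s (c y1)" "s' y" "s (c y)"]
          by (simp add: dist_commute)
        moreover have "s' y1 \<in> ball (s (c y1)) (2 * \<epsilon>)" using s'[OF y1] \<epsilon>(1) by auto
        ultimately have "k * norm (s' y - s' y1) \<le> norm (\<phi> (s' y) - \<phi> (s' y1))"
          by (rule \<epsilon>(4)[OF sK[OF c_in[OF y1]]])
        also have "\<dots> < k * e" using s'[OF y(1)] s'[OF y1] y(2) by (simp add: dist_norm)
        finally show "dist (s' y) (s' y1) < e" using \<epsilon>(2) by (simp add: dist_norm)
      qed
    qed
    moreover have "s' ?c = u"
    proof -
      have c0: "?c \<in> cball ?c \<rho>'" "?c \<in> cball ?c \<rho>" using \<rho> by auto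
      have uK: "u \<in> K" using sK[OF c0(2)] s(2) by simp
      have "s' ?c \<in> ball u (2 * \<epsilon>)" "u \<in> ball u (2 * \<epsilon>)" using s'[OF c0(1)] \<epsilon>(1) by (auto simp: c_c s(2))
      from \<epsilon>(4)[OF uK this] s'[OF c0(1)] have "k * norm (s' ?c - u) \<le> 0" by simp
      then show ?thesis using \<epsilon>(2) by (simp add: mult_le_0_iff)
    qed
    moreover have "s' y \<in> O'" if "y \<in> cball ?c \<rho>'" for y
    proof -
      have "s' y \<in> ball (s (c y)) (2 * \<epsilon>)" using s'[OF that] \<epsilon>(1) by auto
      then show ?thesis using \<epsilon>(3)[OF sK[OF c_in[OF that]]] by blast
    qed
    ultimately show ?case using s' unfolding \<rho>'_def by blast
  qed
  from this[of N] N show ?thesis by simp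
qed

text \<open>The set where the two lifts agree is closed, and it is open because
  \<open>\<psi>\<close> is injective near the common value.\<close>

lemma lift_unique:
  fixes s t :: "'b::topological_space \<Rightarrow> 'e::metric_space" and \<psi> :: "'e \<Rightarrow> 'a"
  assumes inj: "\<And>k. \<exists>d>0. inj_on \<psi> (ball k d)" and A: "connected A"
    and s: "continuous_on A s" and t: "continuous_on A t"
    and eq: "\<And>x. x \<in> A \<Longrightarrow> \<psi> (s x) = \<psi> (t x)" and a: "a \<in> A" "s a = t a" and x: "x \<in> A"
  shows "s x = t x"
proof -
  define E where "E = {x \<in> A. dist (s x) (t x) = 0}"
  have "closedin (top_of_set A) E" unfolding E_def
    by (intro continuous_closedin_preimage_constant continuous_on_dist s t)
  moreover have "openin (top_of_set A) E"
  proof (subst openin_subopen, intro ballI)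
    fix z assume z: "z \<in> E"
    obtain d where d: "d > 0" "inj_on \<psi> (ball (s z) d)" using inj by blast
    define U where "U = (A \<inter> s -` ball (s z) d) \<inter> (A \<inter> t -` ball (s z) d)"
    have "openin (top_of_set A) U" unfolding U_def
      by (intro openin_Int continuous_openin_preimage_gen s t open_ball)
    moreover have "z \<in> U" using z d(1) by (auto simp: U_def E_def)
    moreover have "U \<subseteq> E"
      using d(2) eq by (auto simp: U_def E_def inj_on_def)
    ultimately show "\<exists>T. openin (top_of_set A) T \<and> z \<in> T \<and> T \<subseteq> E" by blast
  qed
  moreover have "a \<in> E" using a by (simp add: E_def)
  ultimately have "E = A" using A unfolding connected_clopen by blast
  then show ?thesis using x by (auto simp: E_def)
qed

section \<open>Lifting homotopies\<close>

text \<open>The covering theory of the library needs a base in a normed space. A homotopy is lifted by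
  pulling back along it: the pullback is a covering of the square.\<close>

locale sectioned_map =
  fixes \<psi> :: "'e::euclidean_space \<Rightarrow> 'a::topological_space"
  assumes cont: "continuous_on UNIV \<psi>"
    and sections: "\<And>x. \<exists>U. open U \<and> x \<in> U \<and> connected U \<and>
      (\<forall>v. \<psi> v \<in> U \<longrightarrow> (\<exists>\<sigma>. continuous_on U \<sigma> \<and> \<sigma> (\<psi> v) = v \<and> open (\<sigma> ` U) \<and> (\<forall>z\<in>U. \<psi> (\<sigma> z) = z)))"
begin

lemma locally_injective: "\<exists>d>0. inj_on \<psi> (ball v d)"
proof -
  obtain U \<sigma> where U: "\<psi> v \<in> U" "\<sigma> (\<psi> v) = v" "open (\<sigma> ` U)" "\<forall>z\<in>U. \<psi> (\<sigma> z) = z"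
    using sections[of "\<psi> v"] by blast
  then have "v \<in> \<sigma> ` U" by (metis imageI)
  then obtain d where d: "d > 0" "ball v d \<subseteq> \<sigma> ` U" using U(3) open_contains_ball by blast
  have "inj_on \<psi> (\<sigma> ` U)" using U(4) by (auto simp: inj_on_def)
  then show ?thesis using d inj_on_subset by blast
qed

text \<open>A single preimage of a point of \<open>U\<close> provides a section over all of
  \<open>U\<close>, so \<open>U\<close> lies in the range or misses it.\<close>

lemma range_clopen: "open (range \<psi>)" "open (- range \<psi>)"
proof -
  have *: "\<exists>U. open U \<and> x \<in> U \<and> (U \<subseteq> range \<psi> \<or> U \<subseteq> - range \<psi>)" for x
  proof -
    obtain U where U: "open U" "x \<in> U"
      "\<forall>v. \<psi> v \<in> U \<longrightarrow> (\<exists>\<sigma>. continuous_on U \<sigma> \<and> \<sigma> (\<psi> v) = v \<and> open (\<sigma> ` U) \<and> (\<forall>z\<in>U. \<psi> (\<sigma> z) = z))"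
      using sections[of x] by blast
    have "U \<subseteq> range \<psi>" if v: "\<psi> v \<in> U" for v
    proof
      fix z assume z: "z \<in> U"
      obtain \<sigma> where "\<forall>z\<in>U. \<psi> (\<sigma> z) = z" using U(3) v by blast
      then show "z \<in> range \<psi>" using z by (metis rangeI)
    qed
    then show ?thesis using U by blast
  qed
  show "open (range \<psi>)" using * by (subst open_subopen) blast
  show "open (- range \<psi>)"
  proof (subst open_subopen, intro ballI)
    fix x assume "x \<in> - range \<psi>"
    then show "\<exists>T. open T \<and> x \<in> T \<and> T \<subseteq> - range \<psi>" using *[of x] by (metis ComplD subsetD)
  qed
qed

text \<open>Over the preimage \<open>T\<close> of a set \<open>U\<close> with sections, the sheets
  are the graphs of the sections composed with \<open>H\<close>; open images of sections make the
  sheets open.\<close>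

lemma pullback_covering:
  fixes H :: "'b::real_normed_vector \<Rightarrow> 'a"
  assumes H: "continuous_on S H" and surj: "\<And>z. z \<in> S \<Longrightarrow> H z \<in> range \<psi>"
  shows "covering_space {(z, v). z \<in> S \<and> H z = \<psi> v} fst S"
proof
  define C where "C = {(z, v). z \<in> S \<and> H z = \<psi> v}"
  show "continuous_on {(z, v). z \<in> S \<and> H z = \<psi> v} fst" by (intro continuous_intros)
  show "fst ` {(z, v). z \<in> S \<and> H z = \<psi> v} = S" using surj by (auto simp: image_iff)
  fix z0 assume z0: "z0 \<in> S"
  obtain U where U: "open U" "H z0 \<in> U" "connected U"
    "\<forall>v. \<psi> v \<in> U \<longrightarrow> (\<exists>\<sigma>. continuous_on U \<sigma> \<and> \<sigma> (\<psi> v) = v \<and> open (\<sigma> ` U) \<and> (\<forall>z\<in>U. \<psi> (\<sigma> z) = z))"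
    using sections[of "H z0"] by blast
  define P where "P v \<sigma> \<longleftrightarrow> continuous_on U \<sigma> \<and> \<sigma> (\<psi> v) = v \<and> open (\<sigma> ` U) \<and> (\<forall>z\<in>U. \<psi> (\<sigma> z) = z)" for v \<sigma>
  have "\<forall>v. \<exists>\<sigma>. \<psi> v \<in> U \<longrightarrow> P v \<sigma>" using U(4) unfolding P_def by blast
  then obtain \<sigma> where \<sigma>: "\<And>v. \<psi> v \<in> U \<Longrightarrow> P v (\<sigma> v)" by metis
  define T where "T = S \<inter> H -` U"
  define V where "V v = (\<lambda>z. (z, \<sigma> v (H z))) ` T" for v
  have T: "openin (top_of_set S) T" unfolding T_def by (rule continuous_openin_preimage_gen[OF H U(1)])
  \<comment> \<open>Sections over the connected set \<open>U\<close> that meet once coincide. Two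
    sheets are thus disjoint or equal.\<close>
  have agree: "\<sigma> v y = \<sigma> w y" if "\<psi> v \<in> U" "\<psi> w \<in> U" "x \<in> U" "\<sigma> v x = \<sigma> w x" "y \<in> U" for v w x y
  proof (rule lift_unique[of \<psi> U "\<sigma> v" "\<sigma> w" x y])
    show "\<exists>d>0. inj_on \<psi> (ball k d)" for k by (rule locally_injective)
  qed (use \<sigma>[OF that(1)] \<sigma>[OF that(2)] that U in \<open>auto simp: P_def\<close>)
  have V_eq: "V v = C \<inter> (T \<times> \<sigma> v ` U)" if v: "\<psi> v \<in> U" for v
  proof
    show "V v \<subseteq> C \<inter> (T \<times> \<sigma> v ` U)"
      using \<sigma>[OF v] by (auto simp: V_def C_def T_def P_def)
    show "C \<inter> (T \<times> \<sigma> v ` U) \<subseteq> V v"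
    proof clarify
      fix z x assume "(z, \<sigma> v x) \<in> C" "z \<in> T" "x \<in> U"
      then have "H z = x" using \<sigma>[OF v] by (auto simp: C_def P_def)
      then show "(z, \<sigma> v x) \<in> V v" using \<open>z \<in> T\<close> by (auto simp: V_def)
    qed
  qed
  show "\<exists>T. z0 \<in> T \<and> openin (top_of_set S) T \<and>
    (\<exists>v. \<Union>v = {(z, v). z \<in> S \<and> H z = \<psi> v} \<inter> fst -` T \<and>
      (\<forall>u\<in>v. openin (top_of_set {(z, v). z \<in> S \<and> H z = \<psi> v}) u) \<and> pairwise disjnt v \<and>
      (\<forall>u\<in>v. \<exists>q. homeomorphism u T fst q))"
    unfolding C_def[symmetric]
  proof (rule exI[of _ T], intro conjI exI[of _ "V ` {v. \<psi> v \<in> U}"])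
    show "z0 \<in> T" using z0 U by (simp add: T_def)
    show "openin (top_of_set S) T" by (rule T)
    show "\<Union> (V ` {v. \<psi> v \<in> U}) = C \<inter> fst -` T"
    proof
      show "\<Union> (V ` {v. \<psi> v \<in> U}) \<subseteq> C \<inter> fst -` T" using V_eq by auto
      show "C \<inter> fst -` T \<subseteq> \<Union> (V ` {v. \<psi> v \<in> U})"
      proof clarify
        fix z v assume zv: "(z, v) \<in> C" "fst (z, v) \<in> T"
        then have v: "H z = \<psi> v" "\<psi> v \<in> U" by (auto simp: C_def T_def)
        then have "(z, v) = (z, \<sigma> v (H z))" using \<sigma>[of v] by (simp add: P_def)
        then have "(z, v) \<in> V v" using zv(2) unfolding V_def by auto
        then show "(z, v) \<in> \<Union> (V ` {v. \<psi> v \<in> U})" using v by blast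
      qed
    qed
    show "\<forall>u\<in>V ` {v. \<psi> v \<in> U}. openin (top_of_set C) u"
    proof clarify
      fix v assume v: "\<psi> v \<in> U"
      obtain W where W: "open W" "T = S \<inter> W" using T by (auto simp: openin_open)
      have "V v = C \<inter> (W \<times> \<sigma> v ` U)" using V_eq[OF v] W by (auto simp: C_def)
      moreover have "open (W \<times> \<sigma> v ` U)" using W \<sigma>[OF v] by (intro open_Times) (auto simp: P_def)
      ultimately show "openin (top_of_set C) (V v)" by (auto simp: openin_open)
    qed
    show "pairwise disjnt (V ` {v. \<psi> v \<in> U})"
    proof (clarsimp simp: pairwise_def)
      fix v w assume vw: "\<psi> v \<in> U" "\<psi> w \<in> U" "V v \<noteq> V w"
      show "disjnt (V v) (V w)"
      proof (rule ccontr)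
        assume "\<not> disjnt (V v) (V w)"
        then obtain z where "z \<in> T" "\<sigma> v (H z) = \<sigma> w (H z)" by (auto simp: disjnt_iff V_def)
        then have "\<sigma> v y = \<sigma> w y" if "y \<in> U" for y using agree[OF vw(1,2)] that by (auto simp: T_def)
        then have "V v = V w" by (auto simp: V_def T_def)
        then show False using vw by simp
      qed
    qed
    show "\<forall>u\<in>V ` {v. \<psi> v \<in> U}. \<exists>q. homeomorphism u T fst q"
    proof clarify
      fix v assume v: "\<psi> v \<in> U"
      have "continuous_on T H" using H by (rule continuous_on_subset) (auto simp: T_def)
      then have "continuous_on T (\<lambda>z. \<sigma> v (H z))"
        by (rule continuous_on_compose2[rotated]) (use \<sigma>[OF v] in \<open>auto simp: P_def T_def\<close>)
      then have "homeomorphism (V v) T fst (\<lambda>z. (z, \<sigma> v (H z)))"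
        unfolding homeomorphism_def V_def by (auto intro!: continuous_intros simp: image_image)
      then show "\<exists>q. homeomorphism (V v) T fst q" by blast
    qed
  qed
qed

text \<open>The identity of the square is lifted to the pullback covering; the second component of
  this lift is the lift of \<open>H\<close>.\<close>

lemma lift_square:
  fixes H :: "real \<times> real \<Rightarrow> 'a"
  assumes H: "continuous_on ({0..1} \<times> {0..1}) H" and surj: "range \<psi> = UNIV" and a: "H (0, 0) = \<psi> a"
  obtains k where "continuous_on ({0..1} \<times> {0..1}) k" "k (0, 0) = a"
    "\<And>z. z \<in> {0..1} \<times> {0..1} \<Longrightarrow> \<psi> (k z) = H z"
proof -
  let ?S = "{0..1} \<times> {0..1} :: (real \<times> real) set"
  let ?C = "{(z, v). z \<in> ?S \<and> H z = \<psi> v}"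
  have cov: "covering_space ?C fst ?S" by (rule pullback_covering[OF H]) (simp add: surj)
  have cvx: "convex ?S" by (intro convex_Times convex_real_interval)
  have "((0, 0), a) \<in> ?C" using a by auto
  from covering_space_lift_strong[OF cov this _ convex_imp_simply_connected[OF cvx]
      convex_imp_locally_path_connected[OF cvx], of "(0, 0)" "\<lambda>z. z"]
  obtain g where g: "continuous_on ?S g" "g \<in> ?S \<rightarrow> ?C" "g (0, 0) = ((0, 0), a)" "\<And>y. y \<in> ?S \<Longrightarrow> fst (g y) = y"
    by (auto simp: continuous_on_id)
  show thesis
  proof (rule that[of "\<lambda>z. snd (g z)"])
    show "continuous_on ?S (\<lambda>z. snd (g z))" by (intro continuous_intros g)
    show "snd (g (0, 0)) = a" by (simp add: g)
    fix z assume z: "z \<in> ?S"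
    then have "g z \<in> ?C" by (rule Pi_mem[OF g(2)])
    then show "\<psi> (snd (g z)) = H z" using g(4)[OF z] by auto
  qed
qed

text \<open>Constant loops at two points are freely homotopic, which joins the points by a path, so
  the clopen range is everything. If \<open>\<psi> a = \<psi> b\<close>, the image of the segment
  from \<open>a\<close> to \<open>b\<close> is a loop; a free homotopy to a constant loop is lifted
  and its four edges are compared.\<close>

lemma bijective:
  assumes sc: "simply_connected (UNIV :: 'a set)"
  shows "bij \<psi>"
proof -
  have loops: "\<exists>h. continuous_on ({0..1::real} \<times> {0..1}) h \<and> (\<forall>x\<in>{0..1}. h (0, x) = p x) \<and> (\<forall>x\<in>{0..1}. h (1, x) = q x) \<and>
      (\<forall>t\<in>{0..1}. h (t, 1) = h (t, 0))"
    if "path p" "path q" "pathfinish p = pathstart p" "pathfinish q = pathstart q" for p q :: "real \<Rightarrow> 'a"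
  proof -
    have "homotopic_loops UNIV p q" using sc that unfolding simply_connected_def by blast
    then show ?thesis unfolding homotopic_loops pathfinish_def pathstart_def o_def by blast
  qed
  have surj: "range \<psi> = UNIV"
  proof (rule ccontr)
    assume "range \<psi> \<noteq> UNIV"
    then obtain x where x: "x \<notin> range \<psi>" by blast
    obtain h :: "real \<times> real \<Rightarrow> 'a" where h: "continuous_on ({0..1} \<times> {0..1}) h" "\<forall>y\<in>{0..1}. h (0, y) = x" "\<forall>y\<in>{0..1}. h (1, y) = \<psi> 0"
      using loops[of "\<lambda>_. x" "\<lambda>_. \<psi> 0"] by (auto simp: path_def pathfinish_def pathstart_def)
    have "connected ({0..1::real} \<times> {0::real})" by (intro connected_Times) auto
    moreover have "continuous_on ({0..1} \<times> {0}) h" by (rule continuous_on_subset[OF h(1)]) auto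
    ultimately have "connected (h ` ({0..1} \<times> {0}))" by (rule connected_continuous_image[rotated])
    moreover have "x \<in> h ` ({0..1} \<times> {0})" "\<psi> 0 \<in> h ` ({0..1} \<times> {0})"
      using h(2,3) image_eqI[of x h "(0, 0)"] image_eqI[of "\<psi> 0" h "(1, 0)"] by simp_all
    ultimately show False
      using connectedD[OF _ range_clopen, of "h ` ({0..1} \<times> {0})"] x by auto
  qed
  have "a = b" if ab: "\<psi> a = \<psi> b" for a b
  proof -
    define g where "g t = \<psi> (linepath a b t)" for t
    have cg: "continuous_on {0..1} g"
      unfolding g_def by (rule continuous_on_compose2[OF cont]) auto
    obtain h :: "real \<times> real \<Rightarrow> 'a" where h: "continuous_on ({0..1} \<times> {0..1}) h" "\<And>y. y \<in> {0..1} \<Longrightarrow> h (0, y) = g y"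
        "\<And>y. y \<in> {0..1} \<Longrightarrow> h (1, y) = \<psi> a" "\<And>t. t \<in> {0..1} \<Longrightarrow> h (t, 1) = h (t, 0)"
      using loops[of g "\<lambda>_. \<psi> a"] cg ab by (auto simp: path_def pathfinish_def pathstart_def g_def linepath_def)
    have "h (0, 0) = \<psi> a" using h(2)[of 0] by (simp add: g_def linepath_def)
    then obtain k where k: "continuous_on ({0..1} \<times> {0..1}) k" "k (0, 0) = a"
      "\<And>z. z \<in> {0..1} \<times> {0..1} \<Longrightarrow> \<psi> (k z) = h z"
      using lift_square[OF h(1) surj] by blast
    note uniq = lift_unique[of \<psi> "{0..1::real}", OF locally_injective connected_Icc]
    have c1: "continuous_on {0..1} (\<lambda>y. k (t, y))" "continuous_on {0..1} (\<lambda>y. k (y, t))" if "t \<in> {0..1}" for t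
      by (rule continuous_on_compose2[OF k(1)]; use that in \<open>auto intro!: continuous_intros\<close>)+
    \<comment> \<open>By unique lifting the edge over the loop is the segment itself, and the edge
      over the constant loop is constant. The two remaining edges lift the same path, since the
      homotopy is through loops, and agree at one end; they then agree at the other end, which gives
      \<open>a = b\<close>.\<close>
    have "k (0, 1) = linepath a b 1"
      by (rule uniq[of "\<lambda>y. k (0, y)" "linepath a b" 0])
        (use c1(1)[of 0] k h in \<open>auto simp: g_def linepath_def intro!: continuous_intros\<close>)
    then have kb: "k (0, 1) = b" by (simp add: linepath_def)
    have k1: "k (1, 1) = k (1, 0)"
      by (rule uniq[of "\<lambda>y. k (1, y)" "\<lambda>y. k (1, 0)" 0])
        (use c1(1)[of 1] k h in \<open>auto intro!: continuous_intros\<close>)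
    have "k (0, 1) = k (0, 0)"
      by (rule uniq[of "\<lambda>t. k (t, 1)" "\<lambda>t. k (t, 0)" 1])
        (use c1(2)[of 1] c1(2)[of 0] k h k1 in auto)
    then show ?thesis using kb k by simp
  qed
  then show ?thesis using surj by (auto simp: bij_def inj_def)
qed

end

section \<open>The Cartan-Hadamard theorem\<close>

lemma posdef_lower_bound:
  fixes B :: "'e::euclidean_space \<Rightarrow> 'e \<Rightarrow> real"
  assumes B: "bilinear B" and pos: "\<And>u. u \<noteq> 0 \<Longrightarrow> B u u > 0"
  shows "\<exists>k>0. \<forall>u. k * (norm u)\<^sup>2 \<le> B u u"
proof -
  have "continuous_on (sphere (0 :: 'e) 1) (\<lambda>u. B u u)"
    by (rule bilinear_family_continuous[where B = "\<lambda>_ :: real. B" and S = UNIV and f = "\<lambda>_. 0"])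
      (auto intro: B continuous_intros)
  moreover have "sphere (0 :: 'e) 1 \<noteq> {}" by simp
  ultimately have "\<exists>w\<in>sphere 0 1. \<forall>u\<in>sphere 0 1. B w w \<le> B u u"
    by (intro continuous_attains_inf compact_sphere)
  then obtain w where w: "w \<in> sphere 0 1" "\<And>u. u \<in> sphere 0 1 \<Longrightarrow> B w w \<le> B u u" by blast
  have "B w w * (norm u)\<^sup>2 \<le> B u u" for u
  proof (cases "u = 0")
    case False
    have "B w w \<le> B (u /\<^sub>R norm u) (u /\<^sub>R norm u)" by (rule w) (use False in simp)
    then show ?thesis using False
      by (simp add: bilinear_lmul[OF B] bilinear_rmul[OF B] power2_eq_square field_simps)
  qed (simp add: bilinear_lzero[OF B])
  moreover have "B w w > 0" using w(1) by (intro pos) auto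
  ultimately show ?thesis by blast
qed

lemma bilinear_family_upper_bound:
  fixes B :: "'a::topological_space \<Rightarrow> 'e::euclidean_space \<Rightarrow> 'e \<Rightarrow> real"
  assumes Q: "compact Q" and bil: "\<And>y. y \<in> Q \<Longrightarrow> bilinear (B y)" and cont: "\<And>u v. continuous_on Q (\<lambda>y. B y u v)"
  shows "\<exists>C>0. \<forall>y\<in>Q. \<forall>u. B y u u \<le> C * (norm u)\<^sup>2"
proof -
  define F where "F y = (\<Sum>i\<in>Basis. \<Sum>j\<in>Basis. \<bar>B y i j\<bar>)" for y
  have "continuous_on Q F" unfolding F_def by (intro continuous_intros cont)
  then have "bounded (F ` Q)" by (intro compact_imp_bounded compact_continuous_image Q)
  then obtain C where C: "\<And>y. y \<in> Q \<Longrightarrow> \<bar>F y\<bar> \<le> C" unfolding bounded_iff by (auto simp: image_iff)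
  have "B y u u \<le> max C 1 * (norm u)\<^sup>2" if y: "y \<in> Q" for y u
  proof -
    have "B y u u \<le> (\<Sum>i\<in>Basis. \<Sum>j\<in>Basis. (norm u)\<^sup>2 * \<bar>B y i j\<bar>)"
      unfolding bilinear_expand[OF bil[OF y], of u u]
    proof (intro sum_mono)
      fix i j :: 'e assume ij: "i \<in> Basis" "j \<in> Basis"
      have "((u \<bullet> i) * (u \<bullet> j)) *\<^sub>R B y i j \<le> \<bar>u \<bullet> i\<bar> * \<bar>u \<bullet> j\<bar> * \<bar>B y i j\<bar>"
        by (simp flip: abs_mult)
      also have "\<dots> \<le> (norm u * norm u) * \<bar>B y i j\<bar>"
        by (intro mult_right_mono mult_mono Basis_le_norm ij) auto
      finally show "((u \<bullet> i) * (u \<bullet> j)) *\<^sub>R B y i j \<le> (norm u)\<^sup>2 * \<bar>B y i j\<bar>" by (simp add: power2_eq_square)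
    qed
    also have "\<dots> = (norm u)\<^sup>2 * F y" by (simp add: F_def sum_distrib_left)
    also have "\<dots> \<le> (norm u)\<^sup>2 * max C 1" using C[OF y] by (intro mult_left_mono) auto
    finally show ?thesis by (simp add: mult.commute)
  qed
  then show ?thesis by (intro exI[of _ "max C 1"]) auto
qed

context hadamard
begin

lemma continuous_expmap: "continuous_on UNIV (expmap M p)"
proof (rule continuous_at_imp_continuous_on, intro ballI)
  fix v
  have "((\<lambda>v. geo p v 1) \<longlongrightarrow> geo p v 1) (nhds v)" by (rule geo_tendsto) simp
  then show "isCont (expmap M p) v"
    unfolding isCont_def expmap_eq[abs_def] using tendsto_at_iff_tendsto_nhds by blast
qed

lemma expmap_strict_deriv:
  assumes "c \<in> atlas M" "expmap M p v \<in> fst c"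
  shows "strict_deriv (\<lambda>v. snd c (expmap M p v)) (jacobi p v c 1) v"
  using jacobi_strict_deriv[of 1 c p v] assms by (simp add: expmap_eq)

lemma expmap_expanding:
  assumes "c \<in> atlas M" "expmap M p v \<in> fst c"
  shows "metric M p \<xi> \<xi> \<le> metric_in M c (snd c (expmap M p v)) (jacobi p v c 1 \<xi>) (jacobi p v c 1 \<xi>)"
  using jacobi_sq_chart[of 1 c p v \<xi>] jacobi_expanding[of p \<xi> v] assms by (simp add: expmap_eq)

lemma inj_expmap_deriv:
  assumes c: "c \<in> atlas M" "expmap M p v \<in> fst c"
  shows "inj (jacobi p v c 1)"
proof -
  have lin: "linear (jacobi p v c 1)"
    using strict_deriv_bounded_linear[OF expmap_strict_deriv[OF c]] by (rule bounded_linear.linear)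
  have "\<xi> = 0" if "jacobi p v c 1 \<xi> = 0" for \<xi>
  proof (rule ccontr)
    assume "\<xi> \<noteq> 0"
    then have "metric M p \<xi> \<xi> > 0" by (rule metric_pos)
    moreover have "metric_in M c (snd c (expmap M p v)) 0 0 = 0"
      using c by (intro bilinear_lzero bilinear_metric_in) auto
    ultimately show False using expmap_expanding[OF c, of \<xi>] that by simp
  qed
  then show ?thesis using linear_injective_0[OF lin] by blast
qed

text \<open>In a chart around \<open>x\<close> the exponential map is a strictly differentiable map
  that expands by a fixed factor over a compact ball, so \<open>expanding_section\<close> provides
  sections over balls whose radius does not depend on the preimage \<open>v\<close>.\<close>

lemma expmap_sections:
  "\<exists>U. open U \<and> x \<in> U \<and> connected U \<and>
    (\<forall>v. expmap M p v \<in> U \<longrightarrow> (\<exists>\<sigma>. continuous_on U \<sigma> \<and> \<sigma> (expmap M p v) = v \<and> open (\<sigma> ` U) \<and>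
      (\<forall>z\<in>U. expmap M p (\<sigma> z) = z)))"
proof -
  define c where "c = chart_at M x"
  have c: "c \<in> atlas M" "x \<in> fst c" using chart_at_in in_chart_at by (auto simp: c_def)
  define y0 where "y0 = snd c x"
  obtain \<rho> where \<rho>: "\<rho> > 0" "ball y0 \<rho> \<subseteq> chart_image c"
    using open_chart_image[OF c(1)] c(2) open_contains_ball unfolding y0_def by blast
  \<comment> \<open>\<open>U\<close> corresponds to the ball of radius \<open>R\<close>. A section
    is built over radius \<open>2 * R\<close> about the coordinates of any point of
    \<open>U\<close>, which covers \<open>U\<close> and stays within radius \<open>3 * R\<close> of
    \<open>y0\<close>, still inside the chart.\<close>
  define R where "R = \<rho> / 4"
  have R: "R > 0" "cball y0 (3 * R) \<subseteq> chart_image c" using \<rho> by (auto simp: R_def)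
  define Q where "Q = cball y0 (3 * R)"
  have ballQ: "ball y0 R \<subseteq> Q" using R(1) by (auto simp: Q_def)
  define O' where "O' = expmap M p -` fst c"
  define \<phi> where "\<phi> v = snd c (expmap M p v)" for v
  have O': "open O'" unfolding O'_def
    by (rule open_vimage[OF open_chart[OF c(1)] continuous_expmap])
  have sd: "strict_deriv \<phi> (jacobi p v c 1) v" "inj (jacobi p v c 1)" if "v \<in> O'" for v
    using expmap_strict_deriv[OF c(1)] inj_expmap_deriv[OF c(1)] that by (auto simp: O'_def \<phi>_def[abs_def])
  obtain k where k: "k > 0" "\<And>u. k * (norm u)\<^sup>2 \<le> metric M p u u"
    using posdef_lower_bound[of "metric M p", OF bilinear_metric metric_pos] by blast
  have contQ: "continuous_on Q (\<lambda>y. metric_in M c y u v)" for u v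
    by (rule continuous_on_subset[OF C1_on_continuous_on[OF bilinear_family.C1[OF metric_family[OF c(1)]]]])
      (use R in \<open>auto simp: Q_def\<close>)
  have bilQ: "bilinear (metric_in M c y)" if "y \<in> Q" for y
    by (rule bilinear_metric_in[OF c(1)]) (use that R in \<open>auto simp: Q_def\<close>)
  have "compact Q" by (simp add: Q_def)
  from bilinear_family_upper_bound[OF this bilQ contQ]
  obtain C where C: "C > 0" "\<And>y u. y \<in> Q \<Longrightarrow> metric_in M c y u u \<le> C * (norm u)\<^sup>2" by blast
  \<comment> \<open>Expansion is known for the metrics. The lower bound \<open>k\<close> of the
    metric at \<open>p\<close> and the upper bound \<open>C\<close> of the metric over
    \<open>Q\<close> translate it into the norm of the type.\<close>
  define m where "m = sqrt (k / C)"
  have m: "m > 0" using k C by (simp add: m_def)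
  have expand: "m * norm \<xi> \<le> norm (L \<xi>)" if "u \<in> O'" "\<phi> u \<in> Q" "strict_deriv \<phi> L u" for u L \<xi>
  proof -
    have L: "L = jacobi p u c 1" by (rule strict_deriv_unique[OF that(3) sd(1)[OF that(1)]])
    have "k * (norm \<xi>)\<^sup>2 \<le> metric_in M c (\<phi> u) (L \<xi>) (L \<xi>)"
      using k(2)[of \<xi>] expmap_expanding[OF c(1), of p u \<xi>] that(1) unfolding L \<phi>_def O'_def by simp
    also have "\<dots> \<le> C * (norm (L \<xi>))\<^sup>2" by (rule C(2)[OF that(2)])
    finally have "(m * norm \<xi>)\<^sup>2 \<le> (norm (L \<xi>))\<^sup>2"
      using k C by (simp add: m_def power_mult_distrib field_simps)
    then show ?thesis by (rule power2_le_imp_le) simp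
  qed
  \<comment> \<open>\<open>O'\<close> is only open, but this set is the preimage of a compact part
    of the manifold under the exponential map.\<close>
  have closed: "closed {u \<in> O'. \<phi> u \<in> Q}"
  proof -
    have "compact (chart_inv c ` Q)" unfolding Q_def
      by (intro compact_continuous_image continuous_on_subset[OF continuous_on_chart_inv[OF c(1)] R(2)]) simp
    then have "closed (expmap M p -` (chart_inv c ` Q))"
      by (intro closed_vimage compact_imp_closed continuous_expmap)
    also have "expmap M p -` (chart_inv c ` Q) = {u \<in> O'. \<phi> u \<in> Q}"
      using R(2) chart_inv_in[OF c(1)] chart_inv_right[OF c(1)] chart_inv_left[OF c(1)]
      unfolding Q_def[symmetric] O'_def \<phi>_def by (auto simp: image_iff) (metis subsetD)+
    finally show ?thesis .
  qed
  define U where "U = chart_inv c ` ball y0 R"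
  have U_eq: "U = fst c \<inter> snd c -` ball y0 R"
  proof
    show "U \<subseteq> fst c \<inter> snd c -` ball y0 R"
    proof
      fix z assume "z \<in> U"
      then obtain y where y: "y \<in> ball y0 R" "z = chart_inv c y" by (auto simp: U_def)
      then have "y \<in> chart_image c" using R(2) ballQ unfolding Q_def by blast
      then show "z \<in> fst c \<inter> snd c -` ball y0 R"
        using y chart_inv_in[OF c(1)] chart_inv_right[OF c(1)] by simp
    qed
    show "fst c \<inter> snd c -` ball y0 R \<subseteq> U"
    proof
      fix z assume "z \<in> fst c \<inter> snd c -` ball y0 R"
      then show "z \<in> U" unfolding U_def by (intro image_eqI[of _ _ "snd c z"]) (simp_all add: chart_inv_left[OF c(1)])
    qed
  qed
  have "open U" unfolding U_eq
    by (rule continuous_open_preimage[OF continuous_on_chart[OF c(1)] open_chart[OF c(1)] open_ball])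
  moreover have "x \<in> U" using c R by (simp add: U_eq y0_def)
  moreover have "connected U" unfolding U_def
    by (rule connected_continuous_image[OF continuous_on_subset[OF continuous_on_chart_inv[OF c(1)]] connected_ball])
      (use R(2) ballQ in \<open>auto simp: Q_def\<close>)
  moreover have "\<exists>\<sigma>. continuous_on U \<sigma> \<and> \<sigma> (expmap M p v) = v \<and> open (\<sigma> ` U) \<and> (\<forall>z\<in>U. expmap M p (\<sigma> z) = z)"
    if v: "expmap M p v \<in> U" for v
  proof -
    have vO: "v \<in> O'" "\<phi> v \<in> ball y0 R" using v by (auto simp: U_eq O'_def \<phi>_def)
    have sub: "cball (\<phi> v) (2 * R) \<subseteq> Q" "ball y0 R \<subseteq> cball (\<phi> v) (2 * R)"
    proof -
      show "cball (\<phi> v) (2 * R) \<subseteq> Q"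
      proof
        fix y assume "y \<in> cball (\<phi> v) (2 * R)"
        then show "y \<in> Q" using vO(2) dist_triangle[of y0 y "\<phi> v"] by (simp add: Q_def)
      qed
      show "ball y0 R \<subseteq> cball (\<phi> v) (2 * R)"
      proof
        fix y assume "y \<in> ball y0 R"
        then show "y \<in> cball (\<phi> v) (2 * R)"
          using vO(2) dist_triangle[of "\<phi> v" y y0] by (simp add: dist_commute)
      qed
    qed
    have strict: "\<exists>L. strict_deriv \<phi> L u \<and> inj L" if "u \<in> O'" for u using sd[OF that] by blast
    have r2: "2 * R \<ge> 0" using R by simp
    have "\<exists>s. continuous_on (cball (\<phi> v) (2 * R)) s \<and> s (\<phi> v) = v \<and> (\<forall>y\<in>cball (\<phi> v) (2 * R). s y \<in> O' \<and> \<phi> (s y) = y)"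
      by (rule expanding_section[OF O' _ m _ closed vO(1) r2 sub(1)]; fact strict expand)
    then obtain s where s: "continuous_on (cball (\<phi> v) (2 * R)) s" "s (\<phi> v) = v"
      "\<And>y. y \<in> cball (\<phi> v) (2 * R) \<Longrightarrow> s y \<in> O' \<and> \<phi> (s y) = y" by blast
    have s': "s y \<in> O' \<and> \<phi> (s y) = y" if "y \<in> ball y0 R" for y using s(3) sub(2) that by blast
    have cs: "continuous_on (ball y0 R) s" by (rule continuous_on_subset[OF s(1) sub(2)])
    have "inj_on s (ball y0 R)" using s' by (metis inj_onI)
    \<comment> \<open>Invariance of domain: a section is injective and acts between open sets of the
      same dimension.\<close>
    then have op: "open (s ` ball y0 R)" by (rule invariance_of_domain[OF cs open_ball])
    have im: "snd c ` U = ball y0 R"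
      unfolding U_eq using R(2) ballQ by (auto simp: Q_def)
    show ?thesis
    proof (intro exI[of _ "s \<circ> snd c"] conjI ballI)
      show "continuous_on U (s \<circ> snd c)"
        by (rule continuous_on_compose[OF continuous_on_subset[OF continuous_on_chart[OF c(1)]]])
          (use cs im in \<open>auto simp: U_eq\<close>)
      show "(s \<circ> snd c) (expmap M p v) = v" using s(2) by (simp add: \<phi>_def)
      show "open ((s \<circ> snd c) ` U)" using op im by (metis image_comp)
      fix z assume z: "z \<in> U"
      then have "snd c z \<in> ball y0 R" "z \<in> fst c" by (auto simp: U_eq)
      from s'[OF this(1)] have "expmap M p (s (snd c z)) \<in> fst c" "snd c (expmap M p (s (snd c z))) = snd c z"
        by (auto simp: O'_def \<phi>_def)
      then show "expmap M p ((s \<circ> snd c) z) = z"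
        using chart_inv_left[OF c(1)] \<open>z \<in> fst c\<close> by (metis comp_apply)
    qed
  qed
  ultimately show ?thesis by blast
qed

lemma bij_expmap: "bij (expmap M p)"
proof -
  interpret sectioned_map "expmap M p"
    by unfold_locales (rule continuous_expmap, rule expmap_sections)
  show ?thesis by (rule bijective) (use hadamard in \<open>simp add: hadamard_manifold_def\<close>)
qed

end

section \<open>Lengths of curves\<close>

context riemannian
begin

lemma metric_nonneg: "metric M x u u \<ge> 0"
  using metric_pos[of u x] bilinear_lzero[OF bilinear_metric] by (cases "u = 0") auto

lemma tnorm_nonneg: "tnorm M x u \<ge> 0"
  by (simp add: tnorm_def metric_nonneg)

lemma tnorm_sq: "(tnorm M x u)\<^sup>2 = metric M x u u"
  by (simp add: tnorm_def metric_nonneg)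

lemma tnorm_zero_iff: "tnorm M x u = 0 \<longleftrightarrow> u = 0"
  using metric_pos[of u x] bilinear_lzero[OF bilinear_metric] by (force simp: tnorm_def)

lemma tnorm_scale: "tnorm M x (r *\<^sub>R u) = \<bar>r\<bar> * tnorm M x u"
  by (simp add: tnorm_def bilinear_lmul[OF bilinear_metric] bilinear_rmul[OF bilinear_metric]
      real_sqrt_mult mult.assoc[symmetric] flip: power2_eq_square)

lemma metric_cauchy_schwarz: "\<bar>metric M x u v\<bar> \<le> tnorm M x u * tnorm M x v"
proof -
  have "(metric M x u v)\<^sup>2 \<le> (tnorm M x u * tnorm M x v)\<^sup>2"
    using posdef_cauchy_schwarz[of "metric M x", OF bilinear_metric metric_sym metric_pos]
    by (simp add: power_mult_distrib tnorm_sq)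
  then show ?thesis by (simp add: abs_le_square_iff[symmetric] tnorm_nonneg)
qed

text \<open>\<open>velocity\<close> is a two-sided derivative and may be meaningless at the end
  points. It agrees inside the piece with the derivative within \<open>{a..b}\<close>, whose norm
  \<open>N\<close> is continuous up to the ends.\<close>

lemma integrable_speed_piece:
  assumes ab: "a < b" and \<kappa>: "C1_curve_on M a b \<kappa>"
  shows "(\<lambda>t. tnorm M (\<kappa> t) (velocity M \<kappa> t)) integrable_on {a..b}"
proof -
  define W where "W t = vector_derivative (snd (chart_at M (\<kappa> t)) \<circ> \<kappa>) (at t within {a..b})" for t
  define N where "N t = tnorm M (\<kappa> t) (W t)" for t
  have cont: "continuous_on {a..b} \<kappa>" using \<kappa> by (simp add: C1_curve_on_def)
  have "continuous (at t0 within {a..b}) N" if t0: "t0 \<in> {a..b}" for t0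
  proof -
    define c where "c = chart_at M (\<kappa> t0)"
    have c: "c \<in> atlas M" "\<kappa> t0 \<in> fst c" using chart_at_in in_chart_at by (auto simp: c_def)
    define A where "A = {t \<in> {a..b}. \<kappa> t \<in> fst c}"
    obtain w where w: "continuous_on A w"
      "\<And>t. t \<in> A \<Longrightarrow> ((snd c \<circ> \<kappa>) has_vector_derivative w t) (at t within {a..b})"
      using \<kappa> c(1) unfolding C1_curve_on_def A_def by blast
    have N: "N t = sqrt (metric_in M c (snd c (\<kappa> t)) (w t) (w t))" if t: "t \<in> A" for t
    proof -
      have tA: "t \<in> {a..b}" "\<kappa> t \<in> fst c" using t by (auto simp: A_def)
      have "continuous (at t within {a..b}) \<kappa>" using cont tA by (simp add: continuous_on_eq_continuous_within)
      from change_of_chart_derivative[OF c(1) chart_at_in tA(2) in_chart_at this tA(1) w(2)[OF t]]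
      have "W t = coord_change c (chart_at M (\<kappa> t)) (\<kappa> t) (w t)"
        unfolding W_def using vector_derivative_within_cbox[of a b] tA(1) ab by simp
      then show ?thesis using c tA by (simp add: N_def tnorm_def metric_in_eq)
    qed
    have cA: "continuous_on A \<kappa>" by (rule continuous_on_subset[OF cont]) (auto simp: A_def)
    have cA': "continuous_on A (\<lambda>t. snd c (\<kappa> t))"
      by (rule continuous_on_compose2[OF continuous_on_chart[OF c(1)] cA]) (auto simp: A_def)
    have "continuous_on A (\<lambda>t. metric_in M c (snd c (\<kappa> t)) (w t) (w t))"
      by (rule bilinear_family_continuous[where S = "chart_image c", OF bilinear_metric_in[OF c(1)]
            C1_on_continuous_on[OF bilinear_family.C1[OF metric_family[OF c(1)]]] cA' _ w(1) w(1)])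
        (auto simp: A_def)
    then have "continuous_on A (\<lambda>t. sqrt (metric_in M c (snd c (\<kappa> t)) (w t) (w t)))"
      by (intro continuous_intros)
    then have "continuous_on A N" by (rule continuous_on_eq) (simp add: N)
    moreover have "t0 \<in> A" using t0 c by (simp add: A_def)
    ultimately have "continuous (at t0 within A) N" by (simp add: continuous_on_eq_continuous_within)
    moreover have "A = {a..b} \<inter> \<kappa> -` fst c" by (auto simp: A_def)
    then have "openin (top_of_set {a..b}) A"
      using continuous_openin_preimage_gen[OF cont open_chart[OF c(1)]] by simp
    then obtain T where "open T" "A = {a..b} \<inter> T" by (auto simp: openin_open)
    then have "at t0 within A = at t0 within {a..b}"
      using \<open>t0 \<in> A\<close> by (intro at_within_nhd[of _ T]) auto
    ultimately show ?thesis by simp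
  qed
  then have "continuous_on {a..b} N" by (simp add: continuous_on_eq_continuous_within)
  then have "N integrable_on {a..b}" by (rule integrable_continuous_real)
  then have "N integrable_on cbox a b" by simp
  then have "(\<lambda>t. tnorm M (\<kappa> t) (velocity M \<kappa> t)) integrable_on cbox a b"
  proof (rule integrable_spike_interior[rotated])
    fix t assume "t \<in> box a b"
    then have "at t within {a..b} = at t" by (intro at_within_Icc_at) auto
    then show "tnorm M (\<kappa> t) (velocity M \<kappa> t) = N t" by (simp add: N_def W_def velocity_def)
  qed
  then show ?thesis by simp
qed

text \<open>The pieces are joined by induction on the number of break points to the left.\<close>

lemma integrable_speed:
  assumes "piecewise_C1_curve M \<kappa>"
  shows "(\<lambda>t. tnorm M (\<kappa> t) (velocity M \<kappa> t)) integrable_on {0..1}"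
proof -
  obtain S where S: "finite S" "{0, 1} \<subseteq> S" "S \<subseteq> {0..1}"
    "\<forall>a\<in>S. \<forall>b\<in>S. a < b \<and> {a<..<b} \<inter> S = {} \<longrightarrow> C1_curve_on M a b \<kappa>"
    using assms unfolding piecewise_C1_curve_def by blast
  have "(\<lambda>t. tnorm M (\<kappa> t) (velocity M \<kappa> t)) integrable_on {0..s}" if "s \<in> S" for s
    using that
  proof (induction "card {x \<in> S. x < s}" arbitrary: s rule: less_induct)
    case less
    show ?case
    proof (cases "s = 0")
      case False
      then have "0 \<in> {x \<in> S. x < s}" using S less.prems by force
      then have ne: "{x \<in> S. x < s} \<noteq> {}" by blast
      have fin: "finite {x \<in> S. x < s}" using S by simp
      define r where "r = Max {x \<in> S. x < s}"
      have r: "r \<in> S" "r < s" using Max_in[OF fin ne] by (auto simp: r_def)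
      have gap: "{r<..<s} \<inter> S = {}" using Max_ge[OF fin] by (fastforce simp: r_def)
      have "{x \<in> S. x < r} \<subset> {x \<in> S. x < s}" using r by force
      then have "card {x \<in> S. x < r} < card {x \<in> S. x < s}" by (rule psubset_card_mono[OF fin])
      from less.hyps[OF this r(1)]
      have "(\<lambda>t. tnorm M (\<kappa> t) (velocity M \<kappa> t)) integrable_on {0..r}" .
      moreover have "(\<lambda>t. tnorm M (\<kappa> t) (velocity M \<kappa> t)) integrable_on {r..s}"
        using S(4) r less.prems gap by (intro integrable_speed_piece) auto
      ultimately show ?thesis
        by (rule Henstock_Kurzweil_Integration.integrable_combine[rotated 2]) (use r S in auto)
    next
      case True
      then show ?thesis using integrable_on_refl[of _ "0::real"] by simp
    qed
  qed
  then show ?thesis using S(2) by simp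
qed

lemma piecewise_C1_curve_interior:
  assumes S: "finite S" "{0, 1} \<subseteq> S" "S \<subseteq> {0..1}"
    and pieces: "\<forall>a\<in>S. \<forall>b\<in>S. a < b \<and> {a<..<b} \<inter> S = {} \<longrightarrow> C1_curve_on M a b \<kappa>"
    and t: "t \<in> {0..1} - S"
  shows "\<exists>w. ((snd (chart_at M (\<kappa> t)) \<circ> \<kappa>) has_vector_derivative w) (at t) \<and> continuous (at t) \<kappa>"
proof -
  define a where "a = Max {x \<in> S. x < t}"
  define b where "b = Min {x \<in> S. t < x}"
  have "0 < t" "t < 1" using t S(2) by (auto simp: less_le)
  then have ne: "{x \<in> S. x < t} \<noteq> {}" "{x \<in> S. t < x} \<noteq> {}" using S(2) by blast+
  have fin: "finite {x \<in> S. x < t}" "finite {x \<in> S. t < x}" using S by auto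
  have a: "a \<in> S" "a < t" and b: "b \<in> S" "t < b"
    using Max_in[OF fin(1) ne(1)] Min_in[OF fin(2) ne(2)] by (auto simp: a_def b_def)
  have "{a<..<b} \<inter> S = {}"
  proof (rule ccontr)
    assume "{a<..<b} \<inter> S \<noteq> {}"
    then obtain x where x: "x \<in> S" "a < x" "x < b" by auto
    then have "x \<noteq> t" using t by auto
    then consider "x < t" | "t < x" by linarith
    then show False
    proof cases
      case 1
      then have "x \<le> a" unfolding a_def using x by (intro Max_ge fin) simp
      then show False using x by simp
    next
      case 2
      then have "b \<le> x" unfolding b_def using x by (intro Min_le fin) simp
      then show False using x by simp
    qed
  qed
  then have \<kappa>: "C1_curve_on M a b \<kappa>" using pieces a b by force
  have w: "at t within {a..b} = at t" using a b by (intro at_within_Icc_at)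
  have "continuous (at t within {a..b}) \<kappa>"
    using \<kappa> a b by (auto simp: C1_curve_on_def continuous_on_eq_continuous_within)
  moreover have "\<exists>w. ((snd (chart_at M (\<kappa> t)) \<circ> \<kappa>) has_vector_derivative w) (at t within {a..b})"
    using \<kappa> a b chart_at_in in_chart_at unfolding C1_curve_on_def by (meson atLeastAtMost_iff less_imp_le)
  ultimately show ?thesis unfolding w by blast
qed

end

context complete_riemannian
begin

lemma geodesic_piecewise_C1: "piecewise_C1_curve M (geo p v)"
  unfolding piecewise_C1_curve_def
proof (intro conjI exI[of _ "{0, 1}"] ballI impI)
  have cont: "continuous_on T (geo p v)" for T
    using geodesic_continuous[OF geo(1)] by (simp add: continuous_on_eq_continuous_within)
  then show "continuous_on {0..1} (geo p v)" .
  fix a b :: real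
  show "C1_curve_on M a b (geo p v)"
    unfolding C1_curve_on_def
  proof (intro conjI cont ballI)
    fix c assume c: "c \<in> atlas M"
    show "\<exists>w. continuous_on {t \<in> {a..b}. geo p v t \<in> fst c} w \<and>
      (\<forall>t\<in>{a..b}. geo p v t \<in> fst c \<longrightarrow> ((snd c \<circ> geo p v) has_vector_derivative w t) (at t within {a..b}))"
    proof (intro exI[of _ "chart_vel c (geo p v)"] conjI ballI impI)
      show "continuous_on {t \<in> {a..b}. geo p v t \<in> fst c} (chart_vel c (geo p v))"
        by (intro continuous_at_imp_continuous_on ballI has_vector_derivative_continuous[OF geodesic_equation[OF geo(1) c]]) simp
      show "((snd c \<circ> geo p v) has_vector_derivative chart_vel c (geo p v) t) (at t within {a..b})"
        if "geo p v t \<in> fst c" for t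
        by (rule has_vector_derivative_at_within[OF geodesic_position[OF geo(1) c that]])
    qed
  qed
qed auto

lemma geodesic_length: "curve_length M (geo p v) = tnorm M p v"
  by (simp add: curve_length_def tnorm_velocity_geo)

end

section \<open>The hinge inequality\<close>

context hadamard
begin

definition logmap :: "'a \<Rightarrow> 'a \<Rightarrow> 'e" where
  "logmap p = inv (expmap M p)"

lemma exp_log: "expmap M p (logmap p x) = x"
  unfolding logmap_def using bij_expmap by (metis bij_inv_eq_iff)

lemma log_exp: "logmap p (expmap M p v) = v"
  unfolding logmap_def using bij_expmap by (metis bij_inv_eq_iff)

lemma continuous_logmap: "isCont (logmap p) x"
proof -
  obtain U where U: "open U" "x \<in> U"
    "\<forall>v. expmap M p v \<in> U \<longrightarrow> (\<exists>\<sigma>. continuous_on U \<sigma> \<and> \<sigma> (expmap M p v) = v \<and> open (\<sigma> ` U) \<and> (\<forall>z\<in>U. expmap M p (\<sigma> z) = z))"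
    using expmap_sections[of x p] by blast
  then obtain \<sigma> where \<sigma>: "continuous_on U \<sigma>" "\<forall>z\<in>U. expmap M p (\<sigma> z) = z"
    using exp_log[of p x] by metis
  have "continuous_on U (logmap p)"
    by (rule continuous_on_eq[OF \<sigma>(1)]) (use \<sigma>(2) log_exp in metis)
  then show ?thesis using U by (simp add: continuous_on_eq_continuous_at)
qed

text \<open>The differential of the inverse of an expanding map does not lengthen vectors.\<close>

lemma logmap_derivative:
  assumes c: "c \<in> atlas M" "x \<in> fst c"
  shows "\<exists>P. ((logmap p \<circ> chart_inv c) has_derivative P) (at (snd c x)) \<and>
    (\<forall>w. metric M p (P w) (P w) \<le> metric_in M c (snd c x) w w)"
proof -
  define v where "v = logmap p x"
  have ev: "expmap M p v = x" by (simp add: v_def exp_log)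
  then have cv: "c \<in> atlas M" "expmap M p v \<in> fst c" using c by auto
  define L where "L = jacobi p v c 1"
  have L: "strict_deriv (\<lambda>v. snd c (expmap M p v)) L v" unfolding L_def by (rule expmap_strict_deriv[OF cv])
  then have "linear L" using strict_deriv_bounded_linear bounded_linear.linear by blast
  moreover have "inj L" unfolding L_def by (rule inj_expmap_deriv[OF cv])
  ultimately obtain P where P: "linear P" "\<And>v. P (L v) = v" "\<And>v. L (P v) = v"
    using linear_injective_isomorphism by blast
  have y: "snd c x \<in> chart_image c" using c by simp
  have g: "(logmap p \<circ> chart_inv c) (snd c x) = v" using c by (simp add: chart_inv_left v_def)
  have "((logmap p \<circ> chart_inv c) has_derivative P) (at (snd c x))"
  proof (rule has_derivative_inverse_basic[where f = "\<lambda>v. snd c (expmap M p v)" and T = "chart_image c"])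
    show "((\<lambda>v. snd c (expmap M p v)) has_derivative L) (at ((logmap p \<circ> chart_inv c) (snd c x)))"
      unfolding g by (rule strict_deriv_has_derivative[OF L])
    show "bounded_linear P" using P(1) by (simp add: linear_conv_bounded_linear)
    show "P \<circ> L = id" using P(2) by auto
    have "isCont (chart_inv c) (snd c x)"
      using continuous_on_chart_inv[OF c(1)] y unfolding continuous_on_eq_continuous_at[OF open_chart_image[OF c(1)]] by blast
    then show "isCont (logmap p \<circ> chart_inv c) (snd c x)" by (rule continuous_at_compose[OF _ continuous_logmap])
    show "snd c (expmap M p ((logmap p \<circ> chart_inv c) z)) = z" if "z \<in> chart_image c" for z
      using that by (simp add: exp_log chart_inv_right[OF c(1)])
  qed (use y open_chart_image[OF c(1)] in auto)
  moreover have "metric M p (P w) (P w) \<le> metric_in M c (snd c x) w w" for w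
    using expmap_expanding[OF cv, of "P w"] P(3) by (simp add: L_def ev)
  ultimately show ?thesis by blast
qed

text \<open>Lift the curve to the tangent space at \<open>p\<close> and consider its component
  \<open>G\<close> in the direction of the chord \<open>e\<close>. Its total increase is the squared
  length of \<open>e\<close>, while its derivative is at most the length of \<open>e\<close> times
  the speed of the curve, because the lift is not faster than the curve.\<close>

lemma length_ge:
  assumes \<kappa>: "piecewise_C1_curve M \<kappa>"
  shows "tnorm M p (logmap p (\<kappa> 1) - logmap p (\<kappa> 0)) \<le> curve_length M \<kappa>"
proof -
  obtain S where S: "finite S" "{0, 1} \<subseteq> S" "S \<subseteq> {0..1}"
    "\<forall>a\<in>S. \<forall>b\<in>S. a < b \<and> {a<..<b} \<inter> S = {} \<longrightarrow> C1_curve_on M a b \<kappa>"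
    using \<kappa> unfolding piecewise_C1_curve_def by blast
  have cont: "continuous_on {0..1} \<kappa>" using \<kappa> by (simp add: piecewise_C1_curve_def)
  define e where "e = logmap p (\<kappa> 1) - logmap p (\<kappa> 0)"
  define s where "s t = tnorm M (\<kappa> t) (velocity M \<kappa> t)" for t
  define G where "G t = metric M p e (logmap p (\<kappa> t))" for t
  have linG: "bounded_linear (metric M p e)"
    using bilinear_metric[of p] by (simp add: bilinear_def linear_conv_bounded_linear)
  have der: "\<exists>r. (G has_vector_derivative r) (at t) \<and> r \<le> tnorm M p e * s t" if t: "t \<in> {0<..<1} - S" for t
  proof -
    define c where "c = chart_at M (\<kappa> t)"
    have c: "c \<in> atlas M" "\<kappa> t \<in> fst c" using chart_at_in in_chart_at by (auto simp: c_def)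
    have "t \<in> {0..1} - S" using t by auto
    from piecewise_C1_curve_interior[OF S this] obtain w where
      w: "((snd c \<circ> \<kappa>) has_vector_derivative w) (at t)" "continuous (at t) \<kappa>" by (auto simp: c_def)
    have vel: "velocity M \<kappa> t = w" unfolding velocity_def using w(1) by (simp add: c_def vector_derivative_at)
    obtain P where P: "((logmap p \<circ> chart_inv c) has_derivative P) (at (snd c (\<kappa> t)))"
      "\<And>w. metric M p (P w) (P w) \<le> metric_in M c (snd c (\<kappa> t)) w w"
      using logmap_derivative[OF c] by blast
    have "((logmap p \<circ> chart_inv c) has_derivative P) (at ((snd c \<circ> \<kappa>) t))" using P(1) by simp
    from has_derivative_compose[OF w(1)[unfolded has_vector_derivative_def] this]
    have "((\<lambda>s. (logmap p \<circ> chart_inv c) ((snd c \<circ> \<kappa>) s)) has_derivative (\<lambda>h. P (h *\<^sub>R w))) (at t)" .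
    then have "((\<lambda>s. logmap p (\<kappa> s)) has_derivative (\<lambda>h. P (h *\<^sub>R w))) (at t)"
    proof (rule has_derivative_transform_eventually)
      show "\<forall>\<^sub>F s in at t. (logmap p \<circ> chart_inv c) ((snd c \<circ> \<kappa>) s) = logmap p (\<kappa> s)"
        using eventually_in_chart[OF w(2) c] by eventually_elim (simp add: chart_inv_left[OF c(1)])
    qed (use c in \<open>auto simp: chart_inv_left\<close>)
    then have "((\<lambda>s. logmap p (\<kappa> s)) has_vector_derivative P w) (at t)"
      unfolding has_vector_derivative_def by (simp add: linear_scale[OF has_derivative_linear[OF P(1)]])
    then have "(G has_vector_derivative metric M p e (P w)) (at t)"
      unfolding G_def by (rule bounded_linear.has_vector_derivative[OF linG])
    moreover have "metric M p e (P w) \<le> tnorm M p e * tnorm M p (P w)"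
      using metric_cauchy_schwarz[of p e "P w"] by simp
    moreover have "tnorm M p (P w) \<le> s t"
      using P(2)[of w] by (simp add: s_def vel tnorm_def c_def metric_in_chart_at)
    then have "tnorm M p e * tnorm M p (P w) \<le> tnorm M p e * s t" by (intro mult_left_mono tnorm_nonneg)
    ultimately show ?thesis by (intro exI[of _ "metric M p e (P w)"]) auto
  qed
  have "\<forall>t. \<exists>r. t \<in> {0<..<1} - S \<longrightarrow> (G has_vector_derivative r) (at t) \<and> r \<le> tnorm M p e * s t" using der by blast
  then obtain G0 where G0: "\<And>t. t \<in> {0<..<1} - S \<Longrightarrow> (G has_vector_derivative G0 t) (at t) \<and> G0 t \<le> tnorm M p e * s t" by metis
  \<comment> \<open>At the finitely many exceptional times the value 0 respects the bound, since
    speeds are nonnegative.\<close>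
  define G' where "G' t = (if t \<in> {0<..<1} - S then G0 t else 0)" for t
  have "(G' has_integral (G 1 - G 0)) {0..1}"
  proof (rule fundamental_theorem_of_calculus_interior_strong[OF S(1)])
    show "(G has_vector_derivative G' t) (at t)" if "t \<in> {0<..<1} - S" for t
      using G0[OF that] that by (simp add: G'_def)
    have "continuous_on {0..1} (\<lambda>t. logmap p (\<kappa> t))"
      by (rule continuous_on_compose2[OF continuous_at_imp_continuous_on cont, of UNIV])
        (auto intro: continuous_logmap)
    then show "continuous_on {0..1} G" unfolding G_def
      by (rule bounded_linear.continuous_on[OF linG])
  qed simp
  moreover have "s integrable_on {0..1}" unfolding s_def by (rule integrable_speed[OF \<kappa>])
  then have "((\<lambda>t. tnorm M p e * s t) has_integral (tnorm M p e * integral {0..1} s)) {0..1}"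
    by (intro has_integral_mult_right integrable_integral)
  ultimately have "G 1 - G 0 \<le> tnorm M p e * integral {0..1} s"
  proof (rule has_integral_le)
    fix t show "G' t \<le> tnorm M p e * s t"
      using G0[of t] mult_nonneg_nonneg[OF tnorm_nonneg tnorm_nonneg, of p e "\<kappa> t" "velocity M \<kappa> t"]
      by (auto simp: G'_def s_def)
  qed
  moreover have "G 1 - G 0 = (tnorm M p e)\<^sup>2"
    unfolding G_def tnorm_sq by (simp add: e_def bilinear_rsub[OF bilinear_metric])
  moreover have "integral {0..1} s = curve_length M \<kappa>" by (simp add: curve_length_def s_def[abs_def])
  ultimately have *: "tnorm M p e * tnorm M p e \<le> tnorm M p e * curve_length M \<kappa>" by (simp add: power2_eq_square)
  have "curve_length M \<kappa> \<ge> 0" unfolding curve_length_def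
    by (rule Henstock_Kurzweil_Integration.integral_nonneg[OF integrable_speed[OF \<kappa>]]) (rule tnorm_nonneg)
  then show ?thesis
    using * tnorm_nonneg[of p e] unfolding e_def[symmetric] by (cases "tnorm M p e = 0") auto
qed

text \<open>Comparison with the flat triangle: two sides issue from \<open>p\<close> as
  \<open>a\<close> and \<open>b\<close>, and the third side is at least as long as in the tangent
  space. It is the infimum of \<open>length_ge\<close> over all connecting curves.\<close>

lemma hinge: "tnorm M p (a - b) \<le> rdist M (expmap M p a) (expmap M p b)"
proof -
  define x where "x = expmap M p a"
  define y where "y = expmap M p b"
  let ?L = "{curve_length M \<gamma> | \<gamma>. piecewise_C1_curve M \<gamma> \<and> \<gamma> 0 = x \<and> \<gamma> 1 = y}"
  have "tnorm M p (a - b) \<le> Inf ?L"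
  proof (rule cInf_greatest)
    \<comment> \<open>An infimum over the empty set would be arbitrary; a geodesic joins the two
      points.\<close>
    have "geo x (logmap x y) 1 = y" using exp_log[of x y] by (simp add: expmap_eq)
    then show "?L \<noteq> {}" using geodesic_piecewise_C1 geo(2) by blast
    fix l assume "l \<in> ?L"
    then obtain \<gamma> where \<gamma>: "l = curve_length M \<gamma>" "piecewise_C1_curve M \<gamma>" "\<gamma> 0 = x" "\<gamma> 1 = y" by blast
    have "tnorm M p (b - a) \<le> l"
      using length_ge[OF \<gamma>(2), of p] \<gamma> by (simp add: x_def y_def log_exp)
    then show "tnorm M p (a - b) \<le> l" using tnorm_scale[of p "-1" "b - a"] by simp
  qed
  then show ?thesis by (simp add: rdist_def x_def y_def)
qed

lemma rdist_expmap: "rdist M p (expmap M p v) = tnorm M p v"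
proof (rule antisym)
  have "tnorm M p v \<le> rdist M (expmap M p 0) (expmap M p v)"
    using hinge[of p 0 v] tnorm_scale[of p "-1" v] by simp
  then show "tnorm M p v \<le> rdist M p (expmap M p v)" by (simp add: expmap_zero)
  let ?L = "{curve_length M \<gamma> | \<gamma>. piecewise_C1_curve M \<gamma> \<and> \<gamma> 0 = p \<and> \<gamma> 1 = expmap M p v}"
  have "curve_length M (geo p v) \<in> ?L"    by (intro CollectI exI[of _ "geo p v"]) (simp add: geodesic_piecewise_C1 geo(2) expmap_eq)
  moreover have "bdd_below ?L"
  proof (rule bdd_belowI[of _ 0])
    fix l assume "l \<in> ?L"
    then obtain \<gamma> where "l = curve_length M \<gamma>" "piecewise_C1_curve M \<gamma>" by blast
    then show "0 \<le> l" using length_ge[of \<gamma> p] tnorm_nonneg by (metis order_trans)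
  qed
  ultimately have "Inf ?L \<le> curve_length M (geo p v)" by (rule cInf_lower)
  then show "rdist M p (expmap M p v) \<le> tnorm M p v" by (simp add: rdist_def geodesic_length)
qed

end

section \<open>Comparison geometry\<close>

context riemannian
begin

lemma metric_expand_add:
  "(tnorm M x (u + v))\<^sup>2 = (tnorm M x u)\<^sup>2 + 2 * metric M x u v + (tnorm M x v)\<^sup>2"
  by (simp add: tnorm_sq bilinear_ladd[OF bilinear_metric] bilinear_radd[OF bilinear_metric] metric_sym[of x v u])

lemma tnorm_triangle: "tnorm M x (u + v) \<le> tnorm M x u + tnorm M x v"
proof (rule power2_le_imp_le)
  show "(tnorm M x (u + v))\<^sup>2 \<le> (tnorm M x u + tnorm M x v)\<^sup>2"
    using metric_cauchy_schwarz[of x u v] by (simp add: metric_expand_add power2_sum)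
qed (simp add: tnorm_nonneg)

lemma tnorm_minus: "tnorm M x (- u) = tnorm M x u"
  using tnorm_scale[of x "-1" u] by simp

text \<open>Equality forces the product of \<open>u\<close> and \<open>v\<close> to be the product
  of their lengths, and then the difference of the two rescaled vectors has length 0.\<close>

lemma tnorm_triangle_equality:
  assumes "tnorm M x (u + v) = tnorm M x u + tnorm M x v"
  shows "tnorm M x v *\<^sub>R u = tnorm M x u *\<^sub>R v"
proof -
  have uv: "metric M x u v = tnorm M x u * tnorm M x v"
    using metric_expand_add[of x u v] assms by (simp add: power2_sum)
  have "(tnorm M x (tnorm M x v *\<^sub>R u + - (tnorm M x u *\<^sub>R v)))\<^sup>2 = 0"
    unfolding metric_expand_add
    by (simp add: tnorm_minus tnorm_scale tnorm_nonneg bilinear_lmul[OF bilinear_metric]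
        bilinear_rmul[OF bilinear_metric] bilinear_rneg[OF bilinear_metric] uv power2_eq_square)
  then have "tnorm M x v *\<^sub>R u + - (tnorm M x u *\<^sub>R v) = 0" by (simp add: tnorm_zero_iff)
  then show ?thesis by simp
qed

end

context hadamard
begin

section \<open>Metric axioms and collinearity\<close>

lemma rdist_log: "rdist M p x = tnorm M p (logmap p x)"
  using rdist_expmap[of p "logmap p x"] by (simp add: exp_log)

lemma rdist_nonneg: "rdist M x y \<ge> 0"
  by (simp add: rdist_log tnorm_nonneg)

text \<open>The triangle inequality in the tangent space at \<open>x\<close>, combined with the
  hinge inequality for the side opposite to \<open>x\<close>; no curves are concatenated.\<close>

lemma rdist_triangle: "rdist M x z \<le> rdist M x y + rdist M y z"
proof -
  have "tnorm M x (logmap x z) \<le> tnorm M x (logmap x y) + tnorm M x (logmap x z - logmap x y)"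
    using tnorm_triangle[of x "logmap x y" "logmap x z - logmap x y"] by simp
  moreover have "tnorm M x (logmap x z - logmap x y) \<le> rdist M y z"
    using hinge[of x "logmap x y" "logmap x z"] tnorm_minus[of x "logmap x z - logmap x y"] by (simp add: exp_log)
  ultimately show ?thesis by (simp add: rdist_log[of x])
qed



lemma rdist_geo: "rdist M (geo p v s) (geo p v t) = \<bar>t - s\<bar> * tnorm M p v"
proof -
  have "geo p v t = expmap M (geo p v s) ((t - s) *\<^sub>R velocity M (geo p v) s)"
    by (simp add: expmap_scale geo_shift)
  then show ?thesis by (simp add: rdist_expmap tnorm_scale tnorm_velocity_geo)
qed

lemma rdist_sym: "rdist M x y = rdist M y x"
  using rdist_geo[of x "logmap x y" 0 1] rdist_geo[of x "logmap x y" 1 0]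
  by (simp add: geo expmap_eq[symmetric] exp_log)

lemma rdist_self: "rdist M x x = 0"
  using rdist_geo[of x 0 0 0] by (simp add: geo)

lemma log_eqI: "expmap M p v = x \<Longrightarrow> logmap p x = v"
  by (auto simp: log_exp)

lemma geo_inj: "geo p u s = geo p v t \<Longrightarrow> s *\<^sub>R u = t *\<^sub>R v"
  using log_exp by (metis expmap_scale)

lemma rdist_eq_zero: "rdist M x y = 0 \<Longrightarrow> x = y"
  using exp_log[of x y] by (simp add: rdist_log tnorm_zero_iff expmap_zero)

text \<open>Seen from \<open>y\<close>, the hinge inequality bounds \<open>b - a\<close> by
  \<open>t\<close>, so equality holds in the triangle inequality of the tangent space at
  \<open>y\<close>. Hence \<open>b\<close> is a multiple of \<open>a\<close>, and a single geodesic
  from \<open>y\<close> passes through \<open>p\<close> and \<open>geo p w t\<close>.\<close>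

lemma tight_triangle:
  assumes w: "tnorm M p w = 1" and t: "t > 0" and eq: "rdist M y (geo p w t) = rdist M y p + t"
  shows "y = geo p w (- rdist M y p)"
proof (cases "y = p")
  case True
  then show ?thesis by (simp add: rdist_self geo)
next
  case False
  define a where "a = logmap y p"
  define b where "b = logmap y (geo p w t)"
  define m where "m = rdist M y p"
  have m: "m > 0" using False rdist_eq_zero[of y p] rdist_nonneg[of y p] by (force simp: m_def)
  have ta: "tnorm M y a = m" by (simp add: a_def m_def rdist_log)
  have tb: "tnorm M y b = m + t" using eq by (simp add: b_def m_def rdist_log[of y "geo p w t"])
  have "tnorm M y (b - a) \<le> rdist M (geo p w t) (geo p w 0)"
    using hinge[of y b a] by (simp add: a_def b_def exp_log geo)
  then have le: "tnorm M y (b - a) \<le> t" using rdist_geo[of p w t 0] w t by simp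
  have "tnorm M y (a + (b - a)) \<le> tnorm M y a + tnorm M y (b - a)" by (rule tnorm_triangle)
  then have tc: "tnorm M y (b - a) = t" using le ta tb by simp
  then have "tnorm M y (a + (b - a)) = tnorm M y a + tnorm M y (b - a)" using ta tb by simp
  from tnorm_triangle_equality[OF this] have "t *\<^sub>R a = m *\<^sub>R (b - a)" by (simp add: tc ta)
  then have "b = a + (t / m) *\<^sub>R a"
    using m by (metis (no_types) add_diff_cancel_left' diff_add_cancel divide_inverse_commute
        left_inverse less_irrefl scaleR_one scaleR_scaleR add.commute)
  then have "b = (1 + t / m) *\<^sub>R a" by (simp add: scaleR_add_left)
  then have q: "geo y a (1 + t / m) = geo p w t" using exp_log[of y "geo p w t"] by (simp add: b_def[symmetric] expmap_scale)
  define e where "e = velocity M (geo y a) 1"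
  have p1: "geo y a 1 = p" using exp_log[of y p] by (simp add: a_def expmap_eq)
  then have shift: "geo p e s = geo y a (1 + s)" for s using geo_shift[of y a 1 s] by (simp add: e_def)
  \<comment> \<open>Both sides are points on geodesics from \<open>p\<close>; injectivity of the
    exponential map makes the initial velocities proportional.\<close>
  have "geo p e (t / m) = geo p w t" using shift q by simp
  then have "(t / m) *\<^sub>R e = t *\<^sub>R w" by (rule geo_inj)
  then have "(m / t) *\<^sub>R (t / m) *\<^sub>R e = (m / t) *\<^sub>R t *\<^sub>R w" by simp
  then have em: "e = m *\<^sub>R w" using m t by simp
  have "y = geo p e (-1)" using shift[of "-1"] by (simp add: geo)
  also have "\<dots> = geo p w (- m)" by (simp add: em geo_scale)
  finally show ?thesis by (simp add: m_def)
qed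

text \<open>The hinge inequality on both sides of a point of a geodesic; the two angles there add up to
  \<open>pi\<close>, so that a convex combination eliminates them.\<close>

lemma cn_inequality:
  assumes l: "0 \<le> l" "l \<le> 1"
  shows "(rdist M x (geo q u l))\<^sup>2 \<le> (1 - l) * (rdist M x q)\<^sup>2 + l * (rdist M x (expmap M q u))\<^sup>2
    - l * (1 - l) * (tnorm M q u)\<^sup>2"
proof -
  define m where "m = geo q u l"
  define e where "e = velocity M (geo q u) l"
  define z where "z = logmap m x"
  have te: "tnorm M m e = tnorm M q u" by (simp add: m_def e_def tnorm_velocity_geo)
  have q: "q = expmap M m ((- l) *\<^sub>R e)" unfolding expmap_scale m_def e_def geo_shift by (simp add: geo)
  have eu: "expmap M q u = expmap M m ((1 - l) *\<^sub>R e)" unfolding expmap_scale m_def e_def geo_shift by (simp add: expmap_eq)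
  have x: "x = expmap M m z" by (simp add: z_def exp_log)
  have 1: "(tnorm M m z)\<^sup>2 + 2 * l * metric M m z e + l\<^sup>2 * (tnorm M m e)\<^sup>2 \<le> (rdist M x q)\<^sup>2"
  proof -
    have "(tnorm M m (z + l *\<^sub>R e))\<^sup>2 \<le> (rdist M x q)\<^sup>2"
      using hinge[of m z "(- l) *\<^sub>R e"] x q by (intro power_mono tnorm_nonneg) simp
    then show ?thesis
      by (simp add: metric_expand_add tnorm_scale bilinear_rmul[OF bilinear_metric] power_mult_distrib)
  qed
  have 2: "(tnorm M m z)\<^sup>2 - 2 * (1 - l) * metric M m z e + (1 - l)\<^sup>2 * (tnorm M m e)\<^sup>2 \<le> (rdist M x (expmap M q u))\<^sup>2"
  proof -
    have "(tnorm M m (z + (l - 1) *\<^sub>R e))\<^sup>2 \<le> (rdist M x (expmap M q u))\<^sup>2"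
      using hinge[of m z "(1 - l) *\<^sub>R e"] x eu by (intro power_mono tnorm_nonneg) (simp add: scaleR_diff_left algebra_simps)
    moreover have "(tnorm M m (z + (l - 1) *\<^sub>R e))\<^sup>2 = (tnorm M m z)\<^sup>2 + 2 * ((l - 1) * metric M m z e) + (l - 1)\<^sup>2 * (tnorm M m e)\<^sup>2"
      by (simp only: metric_expand_add tnorm_scale bilinear_rmul[OF bilinear_metric] power_mult_distrib power2_abs real_scaleR_def)
    moreover have "(l - 1)\<^sup>2 = (1 - l)\<^sup>2" by (rule power2_commute)
    ultimately show ?thesis by (simp add: left_diff_distrib right_diff_distrib)
  qed
  have "(rdist M x m)\<^sup>2 = (tnorm M m z)\<^sup>2" using rdist_sym[of x m] rdist_log[of m x] by (simp add: z_def)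
  moreover have "(1 - l) * ((tnorm M m z)\<^sup>2 + 2 * l * metric M m z e + l\<^sup>2 * (tnorm M m e)\<^sup>2)
      + l * ((tnorm M m z)\<^sup>2 - 2 * (1 - l) * metric M m z e + (1 - l)\<^sup>2 * (tnorm M m e)\<^sup>2)
      = (tnorm M m z)\<^sup>2 + l * (1 - l) * (tnorm M m e)\<^sup>2"
    by (simp add: power2_eq_square algebra_simps)
  moreover have "(1 - l) * ((tnorm M m z)\<^sup>2 + 2 * l * metric M m z e + l\<^sup>2 * (tnorm M m e)\<^sup>2)
      \<le> (1 - l) * (rdist M x q)\<^sup>2"
    by (rule mult_left_mono[OF 1]) (use l in simp)
  moreover have "l * ((tnorm M m z)\<^sup>2 - 2 * (1 - l) * metric M m z e + (1 - l)\<^sup>2 * (tnorm M m e)\<^sup>2)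
      \<le> l * (rdist M x (expmap M q u))\<^sup>2"
    by (rule mult_left_mono[OF 2]) (use l in simp)
  ultimately have "(rdist M x m)\<^sup>2 \<le> (1 - l) * (rdist M x q)\<^sup>2 + l * (rdist M x (expmap M q u))\<^sup>2
    - l * (1 - l) * (tnorm M m e)\<^sup>2" by linarith
  then show ?thesis unfolding te by (simp add: m_def)
qed

text \<open>The hinge inequality at \<open>q\<close> gives lower bounds only. The upper bound comes
  from \<open>cn_inequality\<close> used twice, from the end of the first geodesic to the second one
  and from the point \<open>s\<close> to the first one; the squared lengths of \<open>a\<close> and
  \<open>b\<close> cancel.\<close>

lemma geodesic_contraction:
  assumes l: "0 \<le> l" "l \<le> 1"
  shows "rdist M (geo q a l) (geo q b l) \<le> l * rdist M (expmap M q a) (expmap M q b)"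
proof -
  define s where "s = geo q b l"
  define A where "A = expmap M q a"
  define c where "c = rdist M A (expmap M q b)"
  have sq: "(rdist M s q)\<^sup>2 = l\<^sup>2 * (tnorm M q b)\<^sup>2"
    using rdist_geo[of q b l 0] by (simp add: s_def geo power_mult_distrib)
  have Aq: "(rdist M A q)\<^sup>2 = (tnorm M q a)\<^sup>2"
    by (simp add: A_def rdist_sym[of "expmap M q a"] rdist_expmap)
  have "(rdist M A s)\<^sup>2 \<le> (1 - l) * (tnorm M q a)\<^sup>2 + l * c\<^sup>2 - l * (1 - l) * (tnorm M q b)\<^sup>2"
    using cn_inequality[OF l, of A q b] by (simp add: s_def c_def Aq)
  then have "l * (rdist M A s)\<^sup>2 \<le> l * ((1 - l) * (tnorm M q a)\<^sup>2 + l * c\<^sup>2 - l * (1 - l) * (tnorm M q b)\<^sup>2)"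
    by (rule mult_left_mono) (rule l)
  moreover have "(rdist M s (geo q a l))\<^sup>2 \<le> (1 - l) * (l\<^sup>2 * (tnorm M q b)\<^sup>2) + l * (rdist M A s)\<^sup>2 - l * (1 - l) * (tnorm M q a)\<^sup>2"
    using cn_inequality[OF l, of s q a] by (simp add: sq A_def rdist_sym[of s "expmap M q a"])
  ultimately have "(rdist M s (geo q a l))\<^sup>2 \<le> (1 - l) * (l\<^sup>2 * (tnorm M q b)\<^sup>2)
      + l * ((1 - l) * (tnorm M q a)\<^sup>2 + l * c\<^sup>2 - l * (1 - l) * (tnorm M q b)\<^sup>2) - l * (1 - l) * (tnorm M q a)\<^sup>2"
    by linarith
  also have "\<dots> = (l * c)\<^sup>2" by (simp add: power2_eq_square algebra_simps)
  finally have "rdist M s (geo q a l) \<le> l * c"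
    by (rule power2_le_imp_le) (use l in \<open>simp add: c_def rdist_nonneg\<close>)
  then show ?thesis by (simp add: s_def c_def A_def rdist_sym)
qed

section \<open>Asymptotic rays\<close>

lemma geo_backwards:
  assumes "expmap M p v = q"
  shows "geo q (logmap q p) l = geo p v (1 - l)"
proof -
  define e where "e = velocity M (geo p v) 1"
  have q: "q = geo p v 1" using assms by (simp add: expmap_eq)
  have e: "geo q e s = geo p v (1 + s)" for s unfolding q e_def by (rule geo_shift)
  have neg: "geo q (- e) s = geo p v (1 - s)" for s using geo_scale[of q "-1" e s] e[of "- s"] by simp
  have "logmap q p = - e" by (rule log_eqI) (simp add: expmap_eq neg geo)
  then show ?thesis by (simp add: neg)
qed

lemma continuous_rdist: "isCont (rdist M p) x"
proof -
  have bl: "continuous_on UNIV (\<lambda>v. metric M p v v)"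
    by (rule bilinear_family_continuous[where B = "\<lambda>_ :: real. metric M p" and S = UNIV and f = "\<lambda>_. 0"])
      (auto intro: bilinear_metric continuous_intros)
  then have "continuous_on UNIV (tnorm M p)" unfolding tnorm_def[abs_def] by (intro continuous_intros)
  then have "isCont (tnorm M p) (logmap p x)" by (simp add: continuous_on_eq_continuous_at)
  from continuous_at_compose[OF continuous_logmap this] show ?thesis by (simp add: rdist_log[abs_def] o_def)
qed

lemma compact_unit_sphere: "compact {u. tnorm M p u = 1}"
proof -
  obtain k where k: "k > 0" "\<And>u. k * (norm u)\<^sup>2 \<le> metric M p u u"
    using posdef_lower_bound[of "metric M p", OF bilinear_metric metric_pos] by blast
  have "norm u \<le> sqrt (1 / k)" if "tnorm M p u = 1" for u
  proof (rule real_le_rsqrt)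
    show "(norm u)\<^sup>2 \<le> 1 / k" using k(2)[of u] k(1) that tnorm_sq[of p u] by (simp add: field_simps)
  qed
  then have "bounded {u. tnorm M p u = 1}" unfolding bounded_iff by blast
  moreover have "continuous_on UNIV (\<lambda>v. metric M p v v)"
    by (rule bilinear_family_continuous[where B = "\<lambda>_ :: real. metric M p" and S = UNIV and f = "\<lambda>_. 0"])
      (auto intro: bilinear_metric continuous_intros)
  then have "closed {u. tnorm M p u = 1}"
    unfolding tnorm_def by (intro closed_Collect_eq continuous_intros)
  ultimately show ?thesis by (simp add: compact_eq_bounded_closed)
qed

lemma asymptotic_iff:
  "asymptotic M \<gamma> \<sigma> \<longleftrightarrow> (\<exists>B. \<forall>t\<ge>0. rdist M (\<gamma> t) (\<sigma> t) \<le> B)"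
  unfolding asymptotic_def bounded_iff by (auto simp: rdist_nonneg)

lemma asymptotic_sym: "asymptotic M \<gamma> \<sigma> \<Longrightarrow> asymptotic M \<sigma> \<gamma>"
  unfolding asymptotic_iff by (metis rdist_sym)

lemma asymptotic_trans:
  assumes "asymptotic M \<gamma> \<sigma>" "asymptotic M \<sigma> \<tau>"
  shows "asymptotic M \<gamma> \<tau>"
proof -
  obtain B C where "\<forall>t\<ge>0. rdist M (\<gamma> t) (\<sigma> t) \<le> B" "\<forall>t\<ge>0. rdist M (\<sigma> t) (\<tau> t) \<le> C"
    using assms unfolding asymptotic_iff by blast
  then have "\<forall>t\<ge>0. rdist M (\<gamma> t) (\<tau> t) \<le> B + C"
    by (meson add_mono order_trans rdist_triangle)
  then show ?thesis unfolding asymptotic_iff by blast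
qed

text \<open>By the hinge inequality rays with different directions move apart at least
  linearly.\<close>

lemma asymptotic_same_origin:
  assumes "asymptotic M (ray M p u) (ray M p v)"
  shows "u = v"
proof -
  obtain B where B: "\<And>t. t \<ge> 0 \<Longrightarrow> rdist M (ray M p u t) (ray M p v t) \<le> B"
    using assms unfolding asymptotic_iff by blast
  have *: "t * tnorm M p (u - v) \<le> B" if t: "t \<ge> 0" for t
  proof -
    have "tnorm M p (t *\<^sub>R u - t *\<^sub>R v) \<le> B"
      using hinge[of p "t *\<^sub>R u" "t *\<^sub>R v"] B[OF t] by (simp add: ray_def)
    then show ?thesis using t tnorm_scale[of p t "u - v"] by (simp add: scaleR_diff_right)
  qed
  have "tnorm M p (u - v) = 0"
  proof (rule ccontr)
    assume "tnorm M p (u - v) \<noteq> 0"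
    then have pos: "tnorm M p (u - v) > 0" using tnorm_nonneg[of p "u - v"] by simp
    have "B \<ge> 0" using *[of 0] by simp
    then have "(B / tnorm M p (u - v) + 1) * tnorm M p (u - v) \<le> B" using pos by (intro *) auto
    then have "B + tnorm M p (u - v) \<le> B" using pos by (simp add: distrib_right)
    then show False using pos by simp
  qed
  then show ?thesis by (simp add: tnorm_zero_iff)
qed

text \<open>The directions \<open>w n\<close> at \<open>p\<close> point to the points
  \<open>geo x u (real n)\<close> of the given ray. By compactness of the unit sphere a subsequence
  converges, and the bound \<open>2 * D\<close> on bounded time intervals passes to the
  limit.\<close>

lemma asymptotic_exists:
  assumes u: "tnorm M x u = 1"
  shows "\<exists>w. tnorm M p w = 1 \<and> asymptotic M (ray M p w) (ray M x u)"
proof -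
  define D where "D = rdist M p x"
  define v where "v n = logmap p (geo x u (real n))" for n
  define w where "w n = v n /\<^sub>R tnorm M p (v n)" for n
  have D: "D \<ge> 0" by (simp add: D_def rdist_nonneg)
  have dx: "rdist M x (geo x u (real n)) = n" for n using rdist_geo[of x u 0 "real n"] u by (simp add: geo)
  have dv: "tnorm M p (v n) = rdist M p (geo x u (real n))" for n by (simp add: v_def rdist_log)
  have vn: "\<bar>tnorm M p (v n) - n\<bar> \<le> D" for n
    using rdist_triangle[of p "geo x u (real n)" x] rdist_triangle[of x "geo x u (real n)" p]
    by (simp add: dx dv D_def rdist_sym[of x p])
  have tw: "tnorm M p (w n) = 1" if n: "real n > D" for n
  proof -
    have "tnorm M p (v n) > 0" using vn[of n] n by linarith
    then show ?thesis by (simp add: w_def tnorm_scale)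
  qed
  \<comment> \<open>The segments from \<open>p\<close> and from \<open>x\<close> have the common end
    \<open>q\<close>. Contraction towards \<open>q\<close> bounds their distance at equal fractions
    by \<open>D\<close>. Their lengths differ by at most \<open>D\<close>, which costs another
    \<open>D\<close> on passing to unit speed.\<close>
  have close: "rdist M (geo p (w n) s) (geo x u s) \<le> 2 * D" if n: "real n > D" and s: "0 \<le> s" "s \<le> real n" for n s
  proof -
    have n0: "real n > 0" using n D by simp
    have vpos: "tnorm M p (v n) > 0" using vn[of n] n by linarith
    define q where "q = geo x u (real n)"
    \<comment> \<open>Contraction is available from a common starting point, so the segments are
      traversed backwards from \<open>q\<close>; \<open>l\<close> is the fraction still to go from
      \<open>q\<close> to reach time \<open>s\<close>.\<close>
    define l where "l = 1 - s / n"
    have l: "0 \<le> l" "l \<le> 1" using s n0 by (auto simp: l_def field_simps)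
    have "geo q (logmap q p) l = geo p (v n) (1 - l)"
      by (rule geo_backwards) (simp add: v_def q_def exp_log)
    moreover have "geo q (logmap q x) l = geo x (real n *\<^sub>R u) (1 - l)"
      by (rule geo_backwards) (simp add: q_def expmap_scale)
    ultimately have "rdist M (geo p (v n) (1 - l)) (geo x (real n *\<^sub>R u) (1 - l)) \<le> l * D"
      using geodesic_contraction[OF l, of q "logmap q p" "logmap q x"] by (simp add: exp_log D_def)
    also have "\<dots> \<le> 1 * D" using l D by (intro mult_right_mono) auto
    finally have "rdist M (geo p (v n) (1 - l)) (geo x (real n *\<^sub>R u) (1 - l)) \<le> D" by simp
    moreover have "geo x (real n *\<^sub>R u) (1 - l) = geo x u s" using n0 by (simp add: geo_scale l_def)
    moreover have "v n = tnorm M p (v n) *\<^sub>R w n" using vpos by (simp add: w_def)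
    then have "geo p (v n) (1 - l) = geo p (w n) (tnorm M p (v n) * (s / n))"
      by (metis geo_scale l_def add_diff_cancel_left' diff_add_cancel diff_diff_eq2 add.commute)
    ultimately have 1: "rdist M (geo p (w n) (tnorm M p (v n) * (s / n))) (geo x u s) \<le> D" by simp
    have "rdist M (geo p (w n) s) (geo p (w n) (tnorm M p (v n) * (s / n))) = \<bar>tnorm M p (v n) * (s / n) - s\<bar>"
      by (simp add: rdist_geo tw[OF n])
    also have "tnorm M p (v n) * (s / n) - s = (s / n) * (tnorm M p (v n) - n)" using n0 by (simp add: field_simps)
    also have "\<bar>\<dots>\<bar> \<le> 1 * D"
      unfolding abs_mult using vn[of n] s n0 by (intro mult_mono) (auto simp: field_simps)
    finally show ?thesis using 1 rdist_triangle[of "geo p (w n) s" "geo x u s" "geo p (w n) (tnorm M p (v n) * (s / n))"]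
      by simp
  qed
  obtain N :: nat where N: "real N > D" using reals_Archimedean2 by blast
  have "w (n + N) \<in> {u. tnorm M p u = 1}" for n using tw N by simp
  from compact_unit_sphere[of p, unfolded compact_def, rule_format, of "\<lambda>n. w (n + N)", OF this]
  obtain l r where lr: "l \<in> {u. tnorm M p u = 1}" "strict_mono r" "((\<lambda>n. w (n + N)) \<circ> r) \<longlonglongrightarrow> l"
    by blast
  have "rdist M (geo p l s) (geo x u s) \<le> 2 * D" if s: "s \<ge> 0" for s
  proof -
    have "isCont (expmap M p) (s *\<^sub>R l)" using continuous_expmap by (simp add: continuous_on_eq_continuous_at)
    moreover have "(\<lambda>i. s *\<^sub>R w (r i + N)) \<longlonglongrightarrow> s *\<^sub>R l" using lr(3) by (intro tendsto_intros) (simp add: o_def)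
    ultimately have "(\<lambda>i. expmap M p (s *\<^sub>R w (r i + N))) \<longlonglongrightarrow> expmap M p (s *\<^sub>R l)"
      by (rule isCont_tendsto_compose)
    then have "(\<lambda>i. rdist M (geo x u s) (expmap M p (s *\<^sub>R w (r i + N)))) \<longlonglongrightarrow> rdist M (geo x u s) (expmap M p (s *\<^sub>R l))"
      by (rule isCont_tendsto_compose[OF continuous_rdist])
    moreover have "\<forall>\<^sub>F i in sequentially. rdist M (geo x u s) (expmap M p (s *\<^sub>R w (r i + N))) \<le> 2 * D"
    proof -
      obtain i0 :: nat where i0: "real i0 \<ge> s" using real_arch_simple by blast
      have "rdist M (geo x u s) (expmap M p (s *\<^sub>R w (r i + N))) \<le> 2 * D" if "i \<ge> i0" for i
      proof -
        have "i \<le> r i" by (rule seq_suble[OF lr(2)])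
        then have "real (r i + N) > D" "s \<le> real (r i + N)" using N i0 that by auto
        then show ?thesis using close[where n = "r i + N" and s = s] s by (simp add: expmap_scale rdist_sym)
      qed
      then show ?thesis unfolding eventually_sequentially by blast
    qed
    ultimately have "rdist M (geo x u s) (expmap M p (s *\<^sub>R l)) \<le> 2 * D"
      by (rule tendsto_upperbound) simp
    then show ?thesis by (simp add: expmap_scale rdist_sym)
  qed
  then have "asymptotic M (ray M p l) (ray M x u)" unfolding asymptotic_iff ray_eq by blast
  then show ?thesis using lr(1) by blast
qed

lemma unit_vec_norm: "v \<noteq> 0 \<Longrightarrow> tnorm M x (unit_vec M x v) = 1"
  using tnorm_nonneg[of x v] by (simp add: unit_vec_def tnorm_scale tnorm_zero_iff)

lemma asym_dir_eqI:
  assumes w: "tnorm M p w = 1" "asymptotic M (ray M p w) (ray M x (- unit_vec M x v))"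
  shows "asym_dir M p x v = w"
  unfolding asym_dir_def
proof (rule the_equality)
  fix w' assume "tnorm M p w' = 1 \<and> asymptotic M (ray M p w') (ray M x (- unit_vec M x v))"
  then show "w' = w" using asymptotic_same_origin asymptotic_trans asymptotic_sym w(2) by blast
qed (use w in blast)

lemma asym_dir:
  assumes "v \<noteq> 0"
  shows "tnorm M p (asym_dir M p x v) = 1"
    "asymptotic M (ray M p (asym_dir M p x v)) (ray M x (- unit_vec M x v))"
proof -
  have "tnorm M x (- unit_vec M x v) = 1" by (simp add: tnorm_minus unit_vec_norm[OF assms])
  from asymptotic_exists[OF this, of p] obtain w where
    w: "tnorm M p w = 1" "asymptotic M (ray M p w) (ray M x (- unit_vec M x v))" by blast
  then show "tnorm M p (asym_dir M p x v) = 1"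
    "asymptotic M (ray M p (asym_dir M p x v)) (ray M x (- unit_vec M x v))"
    using asym_dir_eqI[OF w] by simp_all
qed

section \<open>Busemann functions\<close>

text \<open>By the triangle inequality the function is nonincreasing in \<open>t\<close> and bounded
  below by \<open>- rdist M y p\<close>, so it converges to its infimum.\<close>

lemma busemann_tendsto:
  assumes u: "tnorm M p u = 1"
  shows "((\<lambda>t. rdist M y (geo p u t) - t) \<longlongrightarrow> busemann M p u y) at_top"
    and "t \<ge> 0 \<Longrightarrow> busemann M p u y \<le> rdist M y (geo p u t) - t"
proof -
  define f where "f t = rdist M y (geo p u t) - t" for t
  have anti: "f t \<le> f s" if "s \<le> t" for s t
    using rdist_triangle[of y "geo p u t" "geo p u s"] rdist_geo[of p u s t] that u by (simp add: f_def)
  have low: "- rdist M y p \<le> f t" if "t \<ge> 0" for t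
    using rdist_triangle[of p "geo p u t" y] rdist_geo[of p u 0 t] that u by (simp add: f_def geo rdist_sym)
  define L where "L = Inf (f ` {0..})"
  have bdd: "bdd_below (f ` {0..})" using low by (intro bdd_belowI2[of _ "- rdist M y p"]) simp
  have L: "L \<le> f t" if "t \<ge> 0" for t unfolding L_def by (rule cInf_lower[OF _ bdd]) (use that in simp)
  have lim: "(f \<longlongrightarrow> L) at_top"
  proof (rule order_tendstoI)
    fix a assume "a < L"
    show "\<forall>\<^sub>F t in at_top. a < f t"
      using eventually_ge_at_top[of "0::real"] by eventually_elim (use L \<open>a < L\<close> in force)
  next
    fix a assume "L < a"
    then obtain s where "s \<ge> 0" "f s < a" unfolding L_def using cInf_less_iff[OF _ bdd] by auto
    show "\<forall>\<^sub>F t in at_top. f t < a"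
      using eventually_ge_at_top[of s] by eventually_elim (use anti \<open>f s < a\<close> in force)
  qed
  have "unit_vec M p u = u" using u by (simp add: unit_vec_def)
  then have "busemann M p u y = L"
    unfolding busemann_def ray_eq f_def[symmetric, abs_def] using lim by (intro tendsto_Lim) (auto simp: f_def[abs_def])
  then show "((\<lambda>t. rdist M y (geo p u t) - t) \<longlongrightarrow> busemann M p u y) at_top"
    "t \<ge> 0 \<Longrightarrow> busemann M p u y \<le> rdist M y (geo p u t) - t"
    using lim L by (auto simp: f_def[abs_def])
qed

lemma busemann_le_rdist: "tnorm M p u = 1 \<Longrightarrow> busemann M p u y \<le> rdist M p y"
  using busemann_tendsto(2)[of p u 0 y] by (simp add: geo rdist_sym)

lemma busemann_opposite_ray:
  assumes u: "tnorm M p u = 1" and m: "m \<ge> 0"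
  shows "busemann M p u (geo p u (- m)) = m"
proof (rule tendsto_unique[OF _ busemann_tendsto(1)[OF u]])
  have "\<forall>\<^sub>F t in at_top. m = rdist M (geo p u (- m)) (geo p u t) - t"
    using eventually_ge_at_top[of "0::real"] by eventually_elim (use m u in \<open>simp add: rdist_geo\<close>)
  then show "((\<lambda>t. rdist M (geo p u (- m)) (geo p u t) - t) \<longlongrightarrow> m) at_top"
    by (rule tendsto_eventually[OF eventually_mono]) simp
qed simp

text \<open>The Busemann function is a decreasing limit, so equality in the limit forces equality
  already at \<open>t = 1\<close>. There the triangle through \<open>p\<close> is
  degenerate.\<close>

lemma busemann_maximal:
  assumes u: "tnorm M p u = 1" and y: "rdist M p y \<le> busemann M p u y"
  shows "y = geo p u (- rdist M p y)"
proof -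
  have "rdist M p y \<le> rdist M y (geo p u 1) - 1" using busemann_tendsto(2)[OF u, of 1 y] y by simp
  moreover have "rdist M y (geo p u 1) \<le> rdist M y p + 1"
    using rdist_triangle[of y "geo p u 1" p] rdist_geo[of p u 0 1] u by (simp add: geo)
  ultimately have "rdist M y (geo p u 1) = rdist M y p + 1" by (simp add: rdist_sym[of p y])
  from tight_triangle[OF u _ this] show ?thesis by (simp add: rdist_sym[of p y])
qed

end

section \<open>The Busemann subdifferential of a radial function\<close>

context hadamard
begin

section \<open>Polar coordinates and the coupling\<close>

lemma geo_minus: "geo p (- u) t = geo p u (- t)"
  using geo_scale[of p "-1" u t] by simp

lemma polar:
  assumes "x \<noteq> p"
  obtains u where "tnorm M p u = 1" "rdist M p x > 0" "x = geo p u (rdist M p x)"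
proof -
  have r: "rdist M p x > 0" using assms rdist_eq_zero[of p x] rdist_nonneg[of p x] by force
  define u where "u = logmap p x /\<^sub>R rdist M p x"
  have "tnorm M p u = 1" using r by (simp add: u_def tnorm_scale rdist_log[symmetric])
  moreover have "x = geo p u (rdist M p x)"
    using r exp_log[of p x] by (simp add: u_def expmap_scale[symmetric])
  ultimately show thesis using r that by blast
qed

lemma coupling_geo:
  assumes u: "tnorm M p u = 1" and r: "r > 0"
  shows "busemann_coupling M p (geo p u r) y = r * busemann M p (- u) y"
proof -
  have d: "rdist M p (geo p u r) = r" using rdist_geo[of p u 0 r] u r by (simp add: geo)
  then have "geo p u r \<noteq> p" using r rdist_self by auto
  moreover have "logmap p (geo p u r) = r *\<^sub>R u" by (rule log_eqI) (simp add: expmap_scale)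
  then have "- inv (expmap M p) (geo p u r) = r *\<^sub>R (- u)" by (simp add: logmap_def)
  moreover have "unit_vec M p (r *\<^sub>R (- u)) = unit_vec M p (- u)"
    using r u by (simp add: unit_vec_def tnorm_minus tnorm_scale)
  then have "busemann M p (r *\<^sub>R (- u)) y = busemann M p (- u) y" by (simp only: busemann_def)
  ultimately show ?thesis using d by (simp add: busemann_coupling_def)
qed

lemma coupling_base: "busemann_coupling M p p y = 0"
  by (simp add: busemann_coupling_def)

lemma coupling_same_ray:
  assumes u: "tnorm M p u = 1" and "r > 0" "m \<ge> 0"
  shows "busemann_coupling M p (geo p u r) (geo p u m) = r * m"
  using coupling_geo[OF assms(1,2)] busemann_opposite_ray[of p "- u" m] assms by (simp add: tnorm_minus geo_minus)

lemma coupling_le: "busemann_coupling M p z y \<le> rdist M p z * rdist M p y"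
proof (cases "z = p")
  case True
  then show ?thesis by (simp add: coupling_base rdist_self)
next
  case False
  then obtain u where u: "tnorm M p u = 1" "rdist M p z > 0" "z = geo p u (rdist M p z)" by (rule polar)
  have "rdist M p z * busemann M p (- u) y \<le> rdist M p z * rdist M p y"
    using u busemann_le_rdist[of p "- u" y] by (intro mult_left_mono) (auto simp: tnorm_minus)
  then show ?thesis using coupling_geo[OF u(1,2), of y] u(3) by simp
qed

lemma coupling_maximal:
  assumes u: "tnorm M p u = 1" and r: "r > 0" and y: "r * rdist M p y \<le> busemann_coupling M p (geo p u r) y"
  shows "y = geo p u (rdist M p y)"
proof -
  have "rdist M p y \<le> busemann M p (- u) y" using y r by (simp add: coupling_geo[OF u r])
  then show ?thesis using busemann_maximal[of p "- u" y] u by (simp add: tnorm_minus geo_minus)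
qed

text \<open>Differentiability comes from the logarithm at \<open>p\<close>, but the derivative
  \<open>l\<close> is then expressed at \<open>p\<close>. To express it at \<open>x\<close>, the
  hinge inequality at \<open>x\<close> bounds the squared distance to \<open>p\<close> along a
  geodesic from below by a quadratic polynomial, with equality at time 0; the two derivatives at
  that time must agree.\<close>

lemma rdist_directional_derivative:
  assumes u0: "tnorm M p u0 = 1" and R: "R > 0" and x: "x = geo p u0 R"
  shows "((rdist M p \<circ> chart_inv (chart_at M x)) has_derivative metric M x (velocity M (geo p u0) R))
    (at (snd (chart_at M x) x))"
proof -
  define c where "c = chart_at M x"
  define G where "G = velocity M (geo p u0) R"
  have c: "c \<in> atlas M" "x \<in> fst c" using chart_at_in in_chart_at by (auto simp: c_def)
  obtain P where P: "((logmap p \<circ> chart_inv c) has_derivative P) (at (snd c x))"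
    using logmap_derivative[OF c] by blast
  have lx: "logmap p x = R *\<^sub>R u0" by (rule log_eqI) (simp add: expmap_scale x)
  have dx: "rdist M p x = R" using rdist_geo[of p u0 0 R] u0 R by (simp add: x geo)
  have sq: "metric M p (logmap p x) (logmap p x) > 0" using dx R by (simp add: rdist_log flip: tnorm_sq)
  define l where "l \<xi> = metric M p u0 (P \<xi>)" for \<xi>
  have bl: "bounded_bilinear (metric M p)" by (rule bilinear_conv_bounded_bilinear[THEN iffD1, OF bilinear_metric])
  have 1: "((\<lambda>y. metric M p ((logmap p \<circ> chart_inv c) y) ((logmap p \<circ> chart_inv c) y)) has_derivative
      (\<lambda>\<xi>. metric M p (logmap p x) (P \<xi>) + metric M p (P \<xi>) (logmap p x))) (at (snd c x))"
    using bounded_bilinear.FDERIV[OF bl P P] c by (simp add: chart_inv_left)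
  have "((\<lambda>y. sqrt (metric M p ((logmap p \<circ> chart_inv c) y) ((logmap p \<circ> chart_inv c) y))) has_derivative
      (\<lambda>\<xi>. (metric M p (logmap p x) (P \<xi>) + metric M p (P \<xi>) (logmap p x)) * (inverse (sqrt (metric M p (logmap p x) (logmap p x))) / 2))) (at (snd c x))"
    using has_derivative_real_sqrt[OF _ 1] sq c by (simp add: chart_inv_left field_simps)
  moreover have "(\<lambda>y. sqrt (metric M p ((logmap p \<circ> chart_inv c) y) ((logmap p \<circ> chart_inv c) y))) = rdist M p \<circ> chart_inv c"
    by (auto simp: rdist_log tnorm_def)
  moreover have "(metric M p (logmap p x) (P \<xi>) + metric M p (P \<xi>) (logmap p x)) * (inverse (sqrt (metric M p (logmap p x) (logmap p x))) / 2) = l \<xi>" for \<xi>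
    using dx R by (simp add: rdist_log tnorm_def l_def metric_sym[of p "P \<xi>"]) (simp add: lx bilinear_lmul[OF bilinear_metric])
  ultimately have dl: "((rdist M p \<circ> chart_inv c) has_derivative l) (at (snd c x))" by simp
  have p: "p = expmap M x (- R *\<^sub>R G)" unfolding expmap_scale x G_def geo_shift by (simp add: geo)
  have tG: "tnorm M x G = 1" by (simp add: x G_def tnorm_velocity_geo u0)
  have "l \<xi> = metric M x G \<xi>" for \<xi>
  proof -
    define \<sigma> where "\<sigma> = geo x \<xi>"
    have \<sigma>: "geodesic M \<sigma>" "\<sigma> 0 = x" "velocity M \<sigma> 0 = \<xi>" unfolding \<sigma>_def by (rule geo)+
    have "chart_vel c \<sigma> 0 = \<xi>" using \<sigma> velocity_eq_chart_vel[of \<sigma> 0] by (simp add: c_def)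
    then have ds: "((snd c \<circ> \<sigma>) has_derivative (\<lambda>h. h *\<^sub>R \<xi>)) (at 0)"
      using geodesic_position[OF \<sigma>(1) c(1), of 0] \<sigma>(2) c(2) by (simp add: has_vector_derivative_def)
    have "((rdist M p \<circ> chart_inv c) has_derivative l) (at ((snd c \<circ> \<sigma>) 0))" using dl \<sigma>(2) by simp
    from has_derivative_compose[OF ds this]
    have "((\<lambda>t. (rdist M p \<circ> chart_inv c) ((snd c \<circ> \<sigma>) t)) has_derivative (\<lambda>h. l (h *\<^sub>R \<xi>))) (at 0)" .
    then have "((\<lambda>t. rdist M p (\<sigma> t)) has_derivative (\<lambda>h. l (h *\<^sub>R \<xi>))) (at 0)"
    proof (rule has_derivative_transform_eventually)
      have "\<forall>\<^sub>F t in at 0. \<sigma> t \<in> fst c"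
        by (rule eventually_in_chart[OF geodesic_continuous[OF \<sigma>(1)] c(1)]) (simp add: \<sigma>(2) c(2))
      then show "\<forall>\<^sub>F t in at 0. (rdist M p \<circ> chart_inv c) ((snd c \<circ> \<sigma>) t) = rdist M p (\<sigma> t)"
        by eventually_elim (simp add: chart_inv_left[OF c(1)])
    qed (use c \<sigma>(2) in \<open>auto simp: chart_inv_left\<close>)
    then have d1: "((\<lambda>t. rdist M p (\<sigma> t)) has_real_derivative l \<xi>) (at 0)"
      by (simp add: has_field_derivative_def linear_scale[OF has_derivative_linear[OF dl]] mult_commute_abs)
    \<comment> \<open>The polynomial is the squared length of
      \<open>R *\<^sub>R G + t *\<^sub>R \<xi>\<close>, the flat distance in the tangent space at
      \<open>x\<close>, where \<open>p\<close> is the point \<open>- R *\<^sub>R G\<close>.\<close>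
    define q where "q t = (rdist M p (\<sigma> t))\<^sup>2 - (R\<^sup>2 + 2 * R * metric M x G \<xi> * t + (tnorm M x \<xi>)\<^sup>2 * t\<^sup>2)" for t
    have "(q has_real_derivative 2 * R * l \<xi> - 2 * R * metric M x G \<xi>) (at 0)"
      unfolding q_def by (rule derivative_eq_intros d1 refl | simp add: \<sigma>(2) dx)+
    moreover have "q 0 \<le> q t" for t
    proof -
      have "tnorm M x (R *\<^sub>R G + t *\<^sub>R \<xi>) \<le> rdist M p (\<sigma> t)"
        using hinge[of x "t *\<^sub>R \<xi>" "- R *\<^sub>R G"] p
        by (simp add: expmap_scale \<sigma>_def rdist_sym[of _ "geo x \<xi> t"] add.commute)
      then have "(tnorm M x (R *\<^sub>R G + t *\<^sub>R \<xi>))\<^sup>2 \<le> (rdist M p (\<sigma> t))\<^sup>2"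
        by (intro power_mono tnorm_nonneg)
      moreover have "(tnorm M x (R *\<^sub>R G + t *\<^sub>R \<xi>))\<^sup>2 = R\<^sup>2 + 2 * R * metric M x G \<xi> * t + (tnorm M x \<xi>)\<^sup>2 * t\<^sup>2"
        by (simp add: metric_expand_add tnorm_scale power_mult_distrib tG bilinear_lmul[OF bilinear_metric]
            bilinear_rmul[OF bilinear_metric])
      ultimately show ?thesis by (simp add: q_def \<sigma>(2) dx)
    qed
    ultimately have "2 * R * l \<xi> - 2 * R * metric M x G \<xi> = 0"
      by (intro DERIV_local_min[of q _ 0 1]) auto
    then show ?thesis using R by simp
  qed
  then have "l = metric M x G" by (rule ext)
  then show ?thesis using dl by (simp add: c_def G_def)
qed

lemma grad_eqI:
  assumes "((f \<circ> chart_inv (chart_at M x)) has_derivative metric M x w) (at (snd (chart_at M x) x))"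
  shows "grad M f x = w"
  unfolding grad_def
proof (rule the_equality)
  fix w' assume "((f \<circ> chart_inv (chart_at M x)) has_derivative (\<lambda>v. metric M x w' v)) (at (snd (chart_at M x) x))"
  from has_derivative_unique[OF this assms] have "metric M x w' (w' - w) = metric M x w (w' - w)" by metis
  then have "metric M x (w' - w) (w' - w) = 0" by (simp add: bilinear_lsub[OF bilinear_metric])
  then show "w' = w" using metric_pos[of "w' - w" x] by force
qed (use assms in simp)

lemma grad_radial:
  assumes u0: "tnorm M p u0 = 1" and R: "R > 0" and x: "x = geo p u0 R"
    and h: "(h has_real_derivative h'R) (at R)"
  shows "grad M (\<lambda>y. h (rdist M p y)) x = h'R *\<^sub>R velocity M (geo p u0) R"
proof (rule grad_eqI)
  let ?c = "chart_at M x" and ?G = "velocity M (geo p u0) R"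
  have "(rdist M p \<circ> chart_inv ?c) (snd ?c x) = R"
    using rdist_geo[of p u0 0 R] u0 R by (simp add: chart_inv_left[OF chart_at_in in_chart_at]) (simp add: x geo)
  then have "(h has_derivative (*) h'R) (at ((rdist M p \<circ> chart_inv ?c) (snd ?c x)))"
    using h by (simp add: has_field_derivative_def)
  have scaled: "metric M x (h'R *\<^sub>R ?G) = (\<lambda>\<xi>. h'R * metric M x ?G \<xi>)"
    by (rule ext) (simp add: bilinear_lmul[OF bilinear_metric])
  from has_derivative_compose[OF rdist_directional_derivative[OF u0 R x] \<open>(h has_derivative _) _\<close>]
  show "(((\<lambda>y. h (rdist M p y)) \<circ> chart_inv ?c) has_derivative metric M x (h'R *\<^sub>R ?G)) (at (snd ?c x))"
    by (simp add: o_def scaled)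
qed

text \<open>For positive \<open>R\<close>, the ray from \<open>geo p u R\<close> back towards
  \<open>p\<close> lies on the same geodesic as the ray with direction \<open>- u\<close> at
  \<open>p\<close>. Their parameters differ by \<open>R\<close>, so the distance is
  constant.\<close>

lemma ray_through_base_asymptotic:
  "asymptotic M (ray M p (- u)) (ray M (geo p u R) (- velocity M (geo p u) R))"
proof -
  have "rdist M (ray M p (- u) t) (ray M (geo p u R) (- velocity M (geo p u) R) t) = \<bar>R\<bar> * tnorm M p u" for t
    by (simp add: ray_eq geo_minus geo_shift rdist_geo)
  then show ?thesis unfolding asymptotic_iff by auto
qed

end

text \<open>The derivative within \<open>{0..}\<close> is two-sided at positive arguments and the
  right derivative at 0.\<close>

locale radial_convex = hadamard M
  for M :: "('a::{t2_space, second_countable_topology}, 'e::euclidean_space) riemannian" +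
  fixes p :: 'a and h h' :: "real \<Rightarrow> real" and f :: "'a \<Rightarrow> ereal"
  assumes f: "\<And>x. f x = ereal (h (rdist M x p))"
    and h_deriv: "\<And>t. t \<ge> 0 \<Longrightarrow> (h has_real_derivative h' t) (at t within {0..})"
    and h_convex: "convex_on {0..} h"
    and h_0: "h 0 = 0" and h'_0: "h' 0 = 0" and h'_pos: "\<And>t. t > 0 \<Longrightarrow> h' t > 0"
begin

lemma h_deriv_at: "t > 0 \<Longrightarrow> (h has_real_derivative h' t) (at t)"
  using h_deriv[of t] at_within_interior[of t "{0..}"] by (simp add: interior_real_atLeast)

lemma h_pos: "t > 0 \<Longrightarrow> h t > 0"
proof -
  assume t: "t > 0"
  have "continuous_on {0..} h" using h_deriv by (intro DERIV_continuous_on) auto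
  then have "continuous_on {0..t} h" by (rule continuous_on_subset) auto
  then have "h 0 < h t"
    using t h_deriv_at h'_pos by (intro DERIV_pos_imp_increasing_open[of 0 t h]) blast+
  then show "h t > 0" by (simp add: h_0)
qed

lemma h_nonneg: "t \<ge> 0 \<Longrightarrow> h t \<ge> 0"
  using h_pos[of t] h_0 by (cases "t = 0") auto

lemma h_tangent: "s > 0 \<Longrightarrow> t \<ge> 0 \<Longrightarrow> h t \<ge> h s + h' s * (t - s)"
  using convex_on_imp_above_tangent[OF h_convex connected_Ici, of s t "h' s"] h_deriv[of s]
  by (simp add: interior_real_atLeast)

lemma mem_subdiff:
  "v \<in> busemann_subdiff M p f x \<longleftrightarrow>
    (\<forall>z. h (rdist M p z) \<ge> h (rdist M p x) + busemann_coupling M p z (busemann_point M p x v)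
       - busemann_coupling M p x (busemann_point M p x v))"
  by (simp add: busemann_subdiff_def f rdist_sym[of _ p])

lemma subdiff_base: "busemann_subdiff M p f p = {0}"
proof (intro set_eqI iffI)
  fix v :: 'e assume "v \<in> {0}"
  then have "busemann_point M p p v = p" by (simp add: busemann_point_def)
  then show "v \<in> busemann_subdiff M p f p"
    using coupling_le[of p _ p] h_nonneg[OF rdist_nonneg[of p]]
    by (auto simp: mem_subdiff coupling_base rdist_self h_0 intro: order_trans)
next
  fix v :: 'e assume v: "v \<in> busemann_subdiff M p f p"
  show "v \<in> {0}"
  proof (rule ccontr)
    assume "v \<notin> {0}"
    then have v0: "v \<noteq> 0" by simp
    define m where "m = tnorm M p v"
    define u where "u = - asym_dir M p p v"
    have m: "m > 0" using v0 tnorm_nonneg[of p v] tnorm_zero_iff[of p v] by (simp add: m_def less_le)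
    have u: "tnorm M p u = 1" using asym_dir(1)[OF v0] by (simp add: u_def tnorm_minus)
    have "expmap M p (- (m *\<^sub>R asym_dir M p p v)) = geo p u m"
      using expmap_scale[of p m u] by (simp add: u_def)
    then have y: "busemann_point M p p v = geo p u m" using v0 by (simp add: busemann_point_def m_def)
    have ge: "h r \<ge> r * m" if r: "r > 0" for r
    proof -
      have "rdist M p (geo p u r) = r" using rdist_geo[of p u 0 r] u r by (simp add: geo)
      then show ?thesis
        using v[unfolded mem_subdiff y, rule_format, of "geo p u r"] coupling_same_ray[OF u r, of m] m
        by (simp add: coupling_base rdist_self h_0)
    qed
    have "((\<lambda>t. (h t - h 0) / (t - 0)) \<longlongrightarrow> 0) (at 0 within {0..})"
      using h_deriv[of 0] by (simp add: has_field_derivative_iff h'_0)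
    then have lim: "((\<lambda>t. h t / t) \<longlongrightarrow> 0) (at_right 0)"
      by (simp add: h_0 at_within_Ici_at_right)
    moreover have "\<forall>\<^sub>F t in at_right 0. m \<le> h t / t"
      using eventually_at_right_less[of 0] by eventually_elim (use ge in \<open>simp add: field_simps\<close>)
    ultimately have "m \<le> 0" by (rule tendsto_lowerbound) simp
    then show False using m by simp
  qed
qed

lemma subdiff_off_base:
  assumes u0: "tnorm M p u0 = 1" and R: "R > 0" and x: "x = geo p u0 R"
  shows "busemann_subdiff M p f x = {h' R *\<^sub>R velocity M (geo p u0) R}"
proof (intro set_eqI iffI)
  define G where "G = velocity M (geo p u0) R"
  have tG: "tnorm M x G = 1" by (simp add: x G_def tnorm_velocity_geo u0)
  have asy: "asymptotic M (ray M p (- u0)) (ray M x (- G))"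
    unfolding x G_def by (rule ray_through_base_asymptotic)
  have dx: "rdist M p x = R" using rdist_geo[of p u0 0 R] u0 R by (simp add: x geo)
  {
    fix v assume "v \<in> {h' R *\<^sub>R velocity M (geo p u0) R}"
    then have v: "v = h' R *\<^sub>R G" by (simp add: G_def)
    have m: "h' R > 0" by (rule h'_pos[OF R])
    have tv: "tnorm M x v = h' R" using m by (simp add: v tnorm_scale tG)
    have "unit_vec M x v = G" using m tv by (simp add: unit_vec_def v)
    \<comment> \<open>The definition of the Busemann point follows the ray of \<open>- v\<close>,
      which leads back through \<open>p\<close> in the direction \<open>- u0\<close>. The minus sign
      in \<open>busemann_point\<close> then restores \<open>u0\<close>.\<close>
    then have "asym_dir M p x v = - u0" using asy u0 by (intro asym_dir_eqI) (simp_all add: tnorm_minus)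
    moreover have "v \<noteq> 0" using tv m tnorm_zero_iff[of x v] by auto
    ultimately have y: "busemann_point M p x v = geo p u0 (h' R)"
      by (simp add: busemann_point_def tv expmap_scale)
    have dy: "rdist M p (geo p u0 (h' R)) = h' R" using rdist_geo[of p u0 0 "h' R"] u0 m by (simp add: geo)
    show "v \<in> busemann_subdiff M p f x"
      unfolding mem_subdiff y
    proof
      fix z
      have "busemann_coupling M p x (geo p u0 (h' R)) = R * h' R"
        using coupling_same_ray[OF u0 R] m by (simp add: x)
      moreover have "busemann_coupling M p z (geo p u0 (h' R)) \<le> rdist M p z * h' R"
        using coupling_le[of p z "geo p u0 (h' R)"] by (simp add: dy)
      moreover have "h (rdist M p z) \<ge> h R + h' R * (rdist M p z - R)"
        by (rule h_tangent[OF R rdist_nonneg])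
      ultimately show "h (rdist M p x) + busemann_coupling M p z (geo p u0 (h' R)) -
          busemann_coupling M p x (geo p u0 (h' R)) \<le> h (rdist M p z)"
        by (simp add: dx algebra_simps)
    qed
  next
    fix v assume v: "v \<in> busemann_subdiff M p f x"
    have v0: "v \<noteq> 0"
    proof
      assume "v = 0"
      then have "busemann_point M p x v = p" by (simp add: busemann_point_def)
      moreover have "busemann_coupling M p x p = 0"
        using coupling_same_ray[OF u0 R, of 0] by (simp add: x geo)
      ultimately have "h R \<le> 0"
        using v[unfolded mem_subdiff, rule_format, of p] by (simp add: coupling_base rdist_self h_0 dx)
      then show False using h_pos[OF R] by simp
    qed
    define m where "m = tnorm M x v"
    define u where "u = - asym_dir M p x v"
    have m: "m > 0" using v0 tnorm_nonneg[of x v] tnorm_zero_iff[of x v] by (simp add: m_def less_le)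
    have u: "tnorm M p u = 1" using asym_dir(1)[OF v0] by (simp add: u_def tnorm_minus)
    have "expmap M p (- (m *\<^sub>R asym_dir M p x v)) = geo p u m"
      using expmap_scale[of p m u] by (simp add: u_def)
    then have y: "busemann_point M p x v = geo p u m" using v0 by (simp add: busemann_point_def m_def)
    have dy: "rdist M p (geo p u m) = m" using rdist_geo[of p u 0 m] u m by (simp add: geo)
    note sub = v[unfolded mem_subdiff y, rule_format]
    \<comment> \<open>The test point and \<open>x\<close> have the same distance from
      \<open>p\<close>, so the values of \<open>f\<close> cancel and only the couplings
      remain.\<close>
    have "R * m \<le> busemann_coupling M p x (geo p u m)"
      using sub[of "geo p u R"] coupling_same_ray[OF u R, of m] m rdist_geo[of p u 0 R] u R
      by (simp add: geo dx)
    then have "geo p u m = geo p u0 m"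
      using coupling_maximal[OF u0 R, of "geo p u m"] by (simp add: x dy)
    then have "m *\<^sub>R u = m *\<^sub>R u0" by (rule geo_inj)
    then have uu: "u = u0" using m by simp
    have ge: "h r \<ge> h R + (r - R) * m" if r: "r > 0" for r
      using sub[of "geo p u0 r"] coupling_same_ray[OF u0 r, of m] coupling_same_ray[OF u0 R, of m] m
        rdist_geo[of p u0 0 r] u0 r
      by (simp add: uu geo dx) (simp add: x left_diff_distrib)
    have "((\<lambda>r. h r - r * m) has_real_derivative h' R - 1 * m) (at R)"
      by (intro DERIV_diff h_deriv_at R DERIV_cmult_right DERIV_ident)
    \<comment> \<open>The radius \<open>R\<close> of this neighbourhood keeps \<open>r\<close>
      positive, as \<open>ge\<close> requires. The function has a local minimum at \<open>R\<close>,
      so its derivative vanishes there.\<close>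
    moreover have "\<forall>r. \<bar>R - r\<bar> < R \<longrightarrow> h R - R * m \<le> h r - r * m"
      using ge by (auto simp: algebra_simps abs_if split: if_splits)
    ultimately have "h' R - 1 * m = 0" by (rule DERIV_local_min[OF _ R])
    then have mh: "m = h' R" by simp
    have "asym_dir M p x v = - u0" using uu u_def by (metis minus_minus)
    then have "asymptotic M (ray M p (- u0)) (ray M x (- unit_vec M x v))"
      using asym_dir(2)[OF v0, of p x] by simp
    \<comment> \<open>The length of \<open>v\<close> is known; its direction follows because two
      asymptotic rays from \<open>x\<close> have the same direction.\<close>
    then have "asymptotic M (ray M x (- unit_vec M x v)) (ray M x (- G))"
      using asy asymptotic_sym asymptotic_trans by blast
    then have "unit_vec M x v = G" using asymptotic_same_origin by fastforce
    then have "v = m *\<^sub>R G" using m by (auto simp: unit_vec_def m_def)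
    then show "v \<in> {h' R *\<^sub>R velocity M (geo p u0) R}" by (simp add: mh G_def)
  }
qed

end

text \<open>As \<open>h\<close> is real valued, \<open>f\<close> is finite and every point is in its
  effective domain; \<open>real_of_ereal\<close> only changes the type so that the gradient can be
  formed.\<close>

theorem theorem10:
  fixes M :: "('a::{t2_space, second_countable_topology}, 'e::euclidean_space) riemannian"
    and p :: 'a
    and f :: "'a \<Rightarrow> ereal"
    and h h' :: "real \<Rightarrow> real"
  assumes "hadamard_manifold M"
    and "\<And>x. f x = ereal (h (rdist M x p))"
    and "\<And>t. t \<ge> 0 \<Longrightarrow> (h has_real_derivative h' t) (at t within {0..})"
    and "convex_on {0..} h"
    and "h 0 = 0" and "h' 0 = 0"
    and "\<And>t. t > 0 \<Longrightarrow> h' t > 0"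
  shows "(\<forall>x. x \<noteq> p \<longrightarrow> busemann_subdiff M p f x = {grad M (\<lambda>y. real_of_ereal (f y)) x}) \<and>
         busemann_subdiff M p f p = {0}"
proof -
  interpret radial_convex M p h h' f
    by unfold_locales (use assms in auto)
  have "busemann_subdiff M p f x = {grad M (\<lambda>y. real_of_ereal (f y)) x}" if x: "x \<noteq> p" for x
  proof -
    obtain u0 where u0: "tnorm M p u0 = 1" "rdist M p x > 0" "x = geo p u0 (rdist M p x)"
      by (rule polar[OF x])
    have "(\<lambda>y. real_of_ereal (f y)) = (\<lambda>y. h (rdist M p y))" by (simp add: f rdist_sym[of _ p])
    then show ?thesis
      using subdiff_off_base[OF u0] grad_radial[OF u0 h_deriv_at[OF u0(2)]] by simp
  qed
  then show ?thesis using subdiff_base by blast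
qed

end
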